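(* Let $a,b\in\mathbb{R}^*$ and $\Lambda_4=ayz\,\partial_{23}+axz\,\partial_{31}+(bxy+z^2)\,\partial_{12}$ on $\mathbb{R}^3$. The limit $E_\infty$ of the spectral sequence of $\Lambda_4$, the associated graded space $G=G(H(\Lambda_4))$ and the formal Poisson cohomology $H(\Lambda_4)$ are isomorphic, $E_\infty\simeq G\simeq H(\Lambda_4)$, and admit the following system of representatives. 1. If $\frac ba\in\mathbb{Q}^*_+$: $$\begin{aligned}H(\Lambda_4)=\;&\mathrm{Cas}(\Lambda_4)\oplus\mathrm{Cas}(\Lambda_4)(Y_1+\tfrac12Y_3)\oplus\mathrm{Cas}(\Lambda_4)(Y_2+\tfrac12Y_3)\\&\oplus\mathrm{Cas}(\Lambda_{4,I})(Y_{23}+Y_{31})\oplus\mathrm{Cas}(\Lambda_{4,I})Y_{12}\oplus\mathrm{Cas}(\Lambda_{4,I})Y_{123}\\&\oplus\bigoplus_{k\in\mathbb{N}\setminus(\mathbb{N}(2\alpha+\beta)+2)}\mathbb{R}z^k\partial_{12}\oplus\bigoplus_{k\in\mathbb{N}\setminus(\mathbb{N}(2\alpha+\beta)+3)}\mathbb{R}z^k\partial_{123}\\&\oplus\begin{cases}\mathbb{R}[[x]]\partial_{23}\oplus\mathbb{R}[[y]]\partial_{31}\oplus(\mathbb{R}[[x]]\oplus\mathbb{R}[[y]])\partial_{123},&\text{if }b=a\\0,&\text{otherwise.}\end{cases}\end{aligned}$$ 2. If $\frac ba\in\mathbb{R}^*\setminus\mathbb{Q}^*_+$: $$\begin{aligned}H(\Lambda_4)=\;&\mathrm{Cas}(\Lambda_4)\oplus\mathrm{Cas}(\Lambda_4)(Y_1+\tfrac12Y_3)\oplus\mathrm{Cas}(\Lambda_4)(Y_2+\tfrac12Y_3)\\&\oplus\mathrm{Cas}(\Lambda_4)(Y_{23}+Y_{31})\oplus\mathrm{Cas}(\Lambda_4)Y_{12}\oplus\mathrm{Cas}(\Lambda_4)Y_{123}\\&\oplus\begin{cases}\mathbb{R}\mathcal{A}_\alpha(Y_{23}+Y_{31})\oplus\mathbb{R}\mathcal{A}_\alpha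 Y_{123},&\text{if }(b,a)\sim(-1,\alpha)\\0,&\text{otherwise}\end{cases}\\&\oplus\begin{cases}\bigoplus_{k\in\mathbb{N}\setminus\{2,2\alpha+1\}}\mathbb{R}z^k\partial_{12}\oplus\bigoplus_{k\in\mathbb{N}\setminus\{3,2\alpha+2\}}\mathbb{R}z^k\partial_{123},&\text{if }(b,a)\sim(-1,\alpha)\\\bigoplus_{k\in\mathbb{N}\setminus\{2\}}\mathbb{R}z^k\partial_{12}\oplus\bigoplus_{k\in\mathbb{N}\setminus\{3\}}\mathbb{R}z^k\partial_{123},&\text{otherwise.}\end{cases}\end{aligned}$$
   Context: Coordinates $(x,y,z)=(x_1,x_2,x_3)$ on $\mathbb{R}^3$; $\partial_{ij}=\partial_i\wedge\partial_j$, $\partial_{123}=\partial_1\wedge\partial_2\wedge\partial_3$; $Y_1=x\partial_1$, $Y_2=y\partial_2$, $Y_3=z\partial_3$, $Y_{ij}=Y_i\wedge Y_j$, $Y_{123}=Y_1\wedge Y_2\wedge Y_3$; $D=xyz$, $D'=xy$; $\Lambda_{4,I}=aY_{23}+aY_{31}+bY_{12}$, $\Lambda_{4,II}=z^2\partial_{12}$, $\Lambda_4=\Lambda_{4,I}+\Lambda_{4,II}$. $H(\Lambda_4)$ is the formal Poisson (Lichnerowicz–Poisson) cohomology: the cohomology of the space $\mathcal{P}$ of polyvector fields on $\mathbb{R}^3$ with coefficients in $\mathbb{R}[[x,y,z]]$ for the differential $d=[\Lambda_4,\cdot]$ (Schouten bracket). The equalities mean that the right-hand side is a system of representatives (cocycles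 in one-to-one correspondence with the classes). Direct sums over infinitely many degrees are understood in the formal sense (infinite formal sums allowed). In a sum of spaces such as $\mathbb{R}[[x]]$, $\mathbb{R}[[y]]$ and powers of $z$ occurring as coefficients of the same $\partial_{123}$, the constant term $\mathbb{R}$ is counted only once. If $\frac ba\in\mathbb{Q}^*_+$, $(\beta,\alpha)\sim(b,a)$ denotes the irreducible representative of $\frac ba$, $\alpha,\beta\in\mathbb{N}^*$, and $$\mathrm{Cas}(\Lambda_4):=\bigoplus_{i\in\mathbb{N}}\mathbb{R}\left(D'+\tfrac{z^2}{2a+b}\right)^{\alpha i}z^{\beta i},\qquad\mathrm{Cas}(\Lambda_{4,I})=\bigoplus_{i\in\mathbb{N}}\mathbb{R}D'^{\alpha i}z^{\beta i}.$$ If $\frac ba\in\mathbb{R}^*\setminus\mathbb{Q}^*_+$, $\mathrm{Cas}(\Lambda_4):=\mathbb{R}$. The notation $(b,a)\sim(-1,\alpha)$ means $\frac ba=\frac{-1}{\alpha}$ with $\alpha\in\mathbb{N}^*$; $\mathcal{A}_\alpha=D'^{\alpha}z^{-1}$. Spectral sequence: a cochain of degree $c$ is written $\sum\frac\sigma D\mathbf{Y}$ with $\sigma$ formal power series and $\mathbf{Y}$ wedge products of $c$ fields $Y_i$; $\mathcal{P}^{rs}$ is spanned by the cochains all of whose numerator monomials $x^{j_1}y^{j_2}z^{j_3}$ satisfy $r=j_1+j_2+c$, $s=j_3$; $K^n=\bigoplus_{r+s=n}\mathcal{P}^{rs}$, $K_p=\bigoplus_{r\in\mathbb{N},s\ge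 p}\mathcal{P}^{rs}$. The associated spectral sequence is $E_r^{pq}=Z_r^{pq}/(Z_{r-1}^{p+1,q-1}+B_{r-1}^{pq})$, $Z_r^{pq}=K_p\cap d^{-1}K_{p+r}\cap K^{p+q}$, $B_r^{pq}=K_p\cap dK_{p-r}\cap K^{p+q}$; its limit $E_\infty^{pq}$ is defined in the same way with $Z_\infty^{pq}$, $B_\infty^{pq}$ the spaces of $d$-cocycles and $d$-coboundaries in $K_p\cap K^{p+q}$. $G$ is the bigraded space associated with the filtration of $H(\Lambda_4)$ by the images $H_p$ of $H(K_p)$, $G^{pq}=H_p^{p+q}/H_{p+1}^{p+q}$. *)

theory Defs
  imports
    "HOL-Computational_Algebra.Formal_Power_Series"
    "HOL-Library.Extended_Nat"
    "HOL-Library.Function_Algebras"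
    "HOL-Library.Set_Algebras"
begin

unbundle fps_syntax

section \<open>Formal polyvector fields on three-dimensional space\<close>

text \<open>
  The ring \<open>\<real>[[x,y,z]]\<close> is realised as \<open>((\<real>[[z]])[[y]])[[x]]\<close>, so \<open>f $ i $ j $ k\<close> is the
  coefficient of \<open>x^i y^j z^k\<close>.
\<close>

type_synonym series = "real fps fps fps"

definition cst :: "real \<Rightarrow> series" where
  "cst c = fps_const (fps_const (fps_const c))"

abbreviation xx :: series where "xx \<equiv> fps_X"
abbreviation yy :: series where "yy \<equiv> fps_const fps_X"
abbreviation zz :: series where "zz \<equiv> fps_const (fps_const fps_X)"

definition coord :: "nat \<Rightarrow> series" where
  "coord l = (if l = 1 then xx else if l = 2 then yy else zz)"

definition partial_deriv :: "nat \<Rightarrow> series \<Rightarrow> series" where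
  "partial_deriv l f =
     (if l = 1 then fps_deriv f
      else if l = 2 then Abs_fps (\<lambda>i. fps_deriv (f $ i))
      else Abs_fps (\<lambda>i. Abs_fps (\<lambda>j. fps_deriv (f $ i $ j))))"

text \<open>
  A polyvector field is stored by its coefficients: \<open>P I\<close>, for \<open>I \<subseteq> {1,2,3}\<close>, is the coefficient
  of the wedge product of the \<open>\<partial>\<^sub>l\<close>, \<open>l \<in> I\<close>, taken in increasing order. Polyvector fields of mixed
  cochain degree \<open>card I\<close> are allowed. Addition is pointwise.
\<close>

type_synonym polyvec = "nat set \<Rightarrow> series"

definition polyvecs :: "polyvec set" where
  "polyvecs = {P. \<forall>I. \<not> I \<subseteq> {1,2,3} \<longrightarrow> P I = 0}"

definition mul :: "series \<Rightarrow> polyvec \<Rightarrow> polyvec"  (infixr "\<odot>" 72) where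
  "f \<odot> P = (\<lambda>I. f * P I)"

definition scale :: "real \<Rightarrow> polyvec \<Rightarrow> polyvec" where
  "scale c P = cst c \<odot> P"

definition unit_pv :: polyvec where
  "unit_pv = (\<lambda>I. if I = {} then 1 else 0)"

definition pd :: "nat \<Rightarrow> polyvec" where
  "pd l = (\<lambda>I. if I = {l} then 1 else 0)"

text \<open>Sign of the permutation sorting the concatenation of the increasing words on \<open>I\<close> and \<open>J\<close>.\<close>

definition shuffle_sign :: "nat set \<Rightarrow> nat set \<Rightarrow> series" where
  "shuffle_sign I J = (- 1) ^ card {(i, j). i \<in> I \<and> j \<in> J \<and> j < i}"

definition wedge :: "polyvec \<Rightarrow> polyvec \<Rightarrow> polyvec"  (infixr "\<^bold>\<and>" 73) where
  "P \<^bold>\<and> Q = (\<lambda>K. \<Sum>I\<in>Pow K. shuffle_sign I (K - I) * P I * Q (K - I))"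

text \<open>Left and right interior derivatives with respect to the odd variable \<open>\<partial>\<^sub>l\<close>.\<close>

definition odd_deriv_left :: "nat \<Rightarrow> polyvec \<Rightarrow> polyvec" where
  "odd_deriv_left l P =
     (\<lambda>I. if l \<in> I then 0 else shuffle_sign {l} I * P (insert l I))"

definition odd_deriv_right :: "nat \<Rightarrow> polyvec \<Rightarrow> polyvec" where
  "odd_deriv_right l P =
     (\<lambda>I. if l \<in> I then 0 else shuffle_sign I {l} * P (insert l I))"

definition even_deriv :: "nat \<Rightarrow> polyvec \<Rightarrow> polyvec" where
  "even_deriv l P = (\<lambda>I. partial_deriv l (P I))"

text \<open>
  The Schouten bracket in coordinates. It extends the Lie bracket of vector fields, and
  \<open>[X, f] = X f\<close> for a vector field \<open>X\<close> and a function \<open>f\<close>.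
\<close>

definition schouten :: "polyvec \<Rightarrow> polyvec \<Rightarrow> polyvec" where
  "schouten P Q =
     (\<Sum>l\<in>{1,2,3}. odd_deriv_right l P \<^bold>\<and> even_deriv l Q - even_deriv l P \<^bold>\<and> odd_deriv_left l Q)"


section \<open>Quotients and linear isomorphisms\<close>

text \<open>
  A quotient \<open>U / W\<close> is a set of cosets \<open>u +o W\<close>; the sum of two cosets is their sum as sets.
  In \<open>coset_scale\<close> the summand \<open>W\<close> only matters for the scalar \<open>0\<close>.
\<close>

definition quot :: "'a::plus set \<Rightarrow> 'a set \<Rightarrow> 'a set set" where
  "quot U W = (\<lambda>u. u +o W) ` U"

definition coset_scale ::
    "(real \<Rightarrow> 'a::plus \<Rightarrow> 'a) \<Rightarrow> 'a set \<Rightarrow> real \<Rightarrow> 'a set \<Rightarrow> 'a set" where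
  "coset_scale s W c A = s c ` A + W"

definition linear_iso ::
    "(real \<Rightarrow> 'a::plus \<Rightarrow> 'a) \<Rightarrow> (real \<Rightarrow> 'b::plus \<Rightarrow> 'b) \<Rightarrow> 'a set \<Rightarrow> 'b set \<Rightarrow> ('a \<Rightarrow> 'b) \<Rightarrow> bool" where
  "linear_iso s t U V \<phi> \<longleftrightarrow>
     bij_betw \<phi> U V \<and>
     (\<forall>u\<in>U. \<forall>v\<in>U. \<phi> (u + v) = \<phi> u + \<phi> v) \<and>
     (\<forall>c. \<forall>u\<in>U. \<phi> (s c u) = t c (\<phi> u))"


section \<open>Formal cohomology and the spectral sequence of a bivector field\<close>

definition cocycles :: "polyvec \<Rightarrow> polyvec set" where
  "cocycles L = {P \<in> polyvecs. schouten L P = 0}"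

definition coboundaries :: "polyvec \<Rightarrow> polyvec set" where
  "coboundaries L = schouten L ` polyvecs"

definition cohomology :: "polyvec \<Rightarrow> polyvec set set" where
  "cohomology L = quot (cocycles L) (coboundaries L)"

definition coh_class :: "polyvec \<Rightarrow> polyvec \<Rightarrow> polyvec set" where
  "coh_class L P = P +o coboundaries L"

definition coh_scale :: "polyvec \<Rightarrow> real \<Rightarrow> polyvec set \<Rightarrow> polyvec set" where
  "coh_scale L = coset_scale scale (coboundaries L)"

text \<open>
  The numerator \<open>\<sigma>\<close> of the component \<open>I\<close>, when \<open>P\<close> is written as a sum of terms \<open>(\<sigma> / xyz) Y\<^sub>I\<close>
  with \<open>Y\<^sub>I\<close> the wedge product of the fields \<open>Y\<^sub>l = x\<^sub>l \<partial>\<^sub>l\<close>, \<open>l \<in> I\<close>.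
\<close>

definition numerator :: "polyvec \<Rightarrow> nat set \<Rightarrow> series" where
  "numerator P I = P I * (\<Prod>l\<in>{1,2,3} - I. coord l)"

definition supported :: "(int \<times> int) set \<Rightarrow> polyvec set" where
  "supported A =
     {P \<in> polyvecs. \<forall>I\<subseteq>{1,2,3}. \<forall>j1 j2 j3.
        numerator P I $ j1 $ j2 $ j3 \<noteq> 0 \<longrightarrow> (int (j1 + j2 + card I), int j3) \<in> A}"

text \<open>The bidegree spaces \<open>P\<^sup>r\<^sup>s\<close> are \<open>supported {(r, s)}\<close>; the following are formal sums of them.\<close>

definition K_deg :: "int \<Rightarrow> polyvec set" where
  "K_deg n = supported {(r, s). r + s = n}"

definition K_filt :: "int \<Rightarrow> polyvec set" where
  "K_filt p = supported {(r, s). p \<le> s}"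

fun Z_page :: "polyvec \<Rightarrow> enat \<Rightarrow> int \<Rightarrow> int \<Rightarrow> polyvec set" where
  "Z_page L (enat r) p q = K_filt p \<inter> {P. schouten L P \<in> K_filt (p + int r)} \<inter> K_deg (p + q)"
| "Z_page L \<infinity> p q = K_filt p \<inter> cocycles L \<inter> K_deg (p + q)"

fun B_page :: "polyvec \<Rightarrow> enat \<Rightarrow> int \<Rightarrow> int \<Rightarrow> polyvec set" where
  "B_page L (enat r) p q = K_filt p \<inter> schouten L ` K_filt (p - int r) \<inter> K_deg (p + q)"
| "B_page L \<infinity> p q = K_filt p \<inter> coboundaries L \<inter> K_deg (p + q)"

text \<open>
  The pages \<open>E\<^sub>r\<close>, \<open>r \<ge> 1\<close> (for \<open>r = 0\<close> the subtraction below is truncated), and the limit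
  \<open>E\<^sub>\<infinity>\<close>, for which \<open>\<infinity> - 1 = \<infinity>\<close>.
\<close>

definition E_denom :: "polyvec \<Rightarrow> enat \<Rightarrow> int \<Rightarrow> int \<Rightarrow> polyvec set" where
  "E_denom L r p q = Z_page L (r - 1) (p + 1) (q - 1) + B_page L (r - 1) p q"

definition E_page :: "polyvec \<Rightarrow> enat \<Rightarrow> int \<Rightarrow> int \<Rightarrow> polyvec set set" where
  "E_page L r p q = quot (Z_page L r p q) (E_denom L r p q)"

definition E_inf_class :: "polyvec \<Rightarrow> int \<Rightarrow> int \<Rightarrow> polyvec \<Rightarrow> polyvec set" where
  "E_inf_class L p q P = P +o E_denom L \<infinity> p q"

definition E_inf_scale :: "polyvec \<Rightarrow> int \<Rightarrow> int \<Rightarrow> real \<Rightarrow> polyvec set \<Rightarrow> polyvec set" where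
  "E_inf_scale L p q = coset_scale scale (E_denom L \<infinity> p q)"

text \<open>
  \<open>coh_filt L p n\<close> consists of the classes, in the whole cohomology, of the cocycles of degree
  \<open>n\<close> lying in \<open>K_filt p\<close>. The graded space \<open>G\<close> is a quotient of a space of cosets.
\<close>

definition coh_filt :: "polyvec \<Rightarrow> int \<Rightarrow> int \<Rightarrow> polyvec set set" where
  "coh_filt L p n = coh_class L ` (cocycles L \<inter> K_filt p \<inter> K_deg n)"

definition G :: "polyvec \<Rightarrow> int \<Rightarrow> int \<Rightarrow> polyvec set set set" where
  "G L p q = quot (coh_filt L p (p + q)) (coh_filt L (p + 1) (p + q))"

definition G_class :: "polyvec \<Rightarrow> int \<Rightarrow> int \<Rightarrow> polyvec \<Rightarrow> polyvec set set" where
  "G_class L p q P = coh_class L P +o coh_filt L (p + 1) (p + q)"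

definition G_scale :: "polyvec \<Rightarrow> int \<Rightarrow> int \<Rightarrow> real \<Rightarrow> polyvec set set \<Rightarrow> polyvec set set" where
  "G_scale L p q = coset_scale (coh_scale L) (coh_filt L (p + 1) (p + q))"

definition G_total :: "polyvec \<Rightarrow> (int \<Rightarrow> int \<Rightarrow> polyvec set set) set" where
  "G_total L = {g. \<forall>p q. g p q \<in> G L p q}"

definition G_total_scale ::
    "polyvec \<Rightarrow> real \<Rightarrow> (int \<Rightarrow> int \<Rightarrow> polyvec set set) \<Rightarrow> int \<Rightarrow> int \<Rightarrow> polyvec set set" where
  "G_total_scale L c g = (\<lambda>p q. G_scale L p q c (g p q))"


section \<open>Systems of representatives\<close>

text \<open>
  Formal, possibly infinite, linear combinations of the elements of \<open>B\<close>, computed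
  coefficientwise. They are meaningful for the locally finite families \<open>B\<close> singled out by
  \<open>formally_independent\<close>, for which they are moreover unique, i.e. the sum of the lines
  \<open>\<real>v\<close>, \<open>v \<in> B\<close>, is direct.
\<close>

definition formal_sum :: "(polyvec \<Rightarrow> real) \<Rightarrow> polyvec set \<Rightarrow> polyvec" where
  "formal_sum c B =
     (\<lambda>I. Abs_fps (\<lambda>i. Abs_fps (\<lambda>j. Abs_fps (\<lambda>k.
        \<Sum>v\<in>{v \<in> B. v I $ i $ j $ k \<noteq> 0}. c v * v I $ i $ j $ k))))"

definition formal_span :: "polyvec set \<Rightarrow> polyvec set" where
  "formal_span B = range (\<lambda>c. formal_sum c B)"

definition formally_independent :: "polyvec set \<Rightarrow> bool" where
  "formally_independent B \<longleftrightarrow>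
     (\<forall>I i j k. finite {v \<in> B. v I $ i $ j $ k \<noteq> 0}) \<and>
     (\<forall>c. formal_sum c B = 0 \<longrightarrow> (\<forall>v\<in>B. c v = 0))"

definition represents :: "polyvec set \<Rightarrow> (polyvec \<Rightarrow> 'q) \<Rightarrow> polyvec set \<Rightarrow> 'q set \<Rightarrow> bool" where
  "represents B cls Z Q \<longleftrightarrow> formal_span B \<subseteq> Z \<and> bij_betw cls (formal_span B) Q"

text \<open>The members of \<open>B\<close> of degree \<open>p + q\<close> whose filtration level is exactly \<open>p\<close>.\<close>

definition part_at :: "polyvec set \<Rightarrow> int \<Rightarrow> int \<Rightarrow> polyvec set" where
  "part_at B p q = B \<inter> K_deg (p + q) \<inter> (K_filt p - K_filt (p + 1))"

definition system_of_representatives :: "polyvec \<Rightarrow> polyvec set \<Rightarrow> bool" where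
  "system_of_representatives L B \<longleftrightarrow>
     formally_independent B \<and>
     represents B (coh_class L) (cocycles L) (cohomology L) \<and>
     (\<forall>p q. represents (part_at B p q) (E_inf_class L p q) (Z_page L \<infinity> p q) (E_page L \<infinity> p q)) \<and>
     (\<forall>p q. represents (part_at B p q) (G_class L p q) (Z_page L \<infinity> p q) (G L p q))"

text \<open>
  \<open>E\<^sub>\<infinity> \<simeq> G\<close> (bidegree by bidegree) and \<open>G \<simeq> H\<close>, by linear isomorphisms that match the classes of
  the common representatives \<open>B\<close>.
\<close>

definition limit_isomorphic :: "polyvec \<Rightarrow> polyvec set \<Rightarrow> bool" where
  "limit_isomorphic L B \<longleftrightarrow>
     (\<forall>p q. \<exists>\<phi>. linear_iso (E_inf_scale L p q) (G_scale L p q) (E_page L \<infinity> p q) (G L p q) \<phi> \<and>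
        (\<forall>c. \<phi> (E_inf_class L p q (formal_sum c (part_at B p q)))
             = G_class L p q (formal_sum c (part_at B p q)))) \<and>
     (\<exists>\<psi>. linear_iso (G_total_scale L) (coh_scale L) (G_total L) (cohomology L) \<psi> \<and>
        (\<forall>c. \<psi> (\<lambda>p q. G_class L p q (formal_sum c (part_at B p q)))
             = coh_class L (formal_sum c B)))"


section \<open>The quadratic structure and its representatives\<close>

definition Lambda4 :: "real \<Rightarrow> real \<Rightarrow> polyvec" where
  "Lambda4 a b =
     (cst a * yy * zz) \<odot> (pd 2 \<^bold>\<and> pd 3) + (cst a * xx * zz) \<odot> (pd 3 \<^bold>\<and> pd 1)
     + (cst b * xx * yy + zz ^ 2) \<odot> (pd 1 \<^bold>\<and> pd 2)"

definition Y :: "nat \<Rightarrow> polyvec" where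
  "Y l = coord l \<odot> pd l"

text \<open>
  The sums of spaces in the cohomology are formal spans of unions of the following generating
  families; a generator shared by two families, such as the constant term of
  \<open>\<real>[[x]] \<partial>\<^sub>1\<^sub>2\<^sub>3\<close> and \<open>\<real>[[y]] \<partial>\<^sub>1\<^sub>2\<^sub>3\<close>, is thereby counted only once.
\<close>

definition multiples :: "series set \<Rightarrow> polyvec \<Rightarrow> polyvec set" where
  "multiples F P = (\<lambda>f. f \<odot> P) ` F"

definition Cas4 :: "real \<Rightarrow> real \<Rightarrow> nat \<Rightarrow> nat \<Rightarrow> series set" where
  "Cas4 a b \<alpha> \<beta> =
     range (\<lambda>i. (xx * yy + cst (1 / (2 * a + b)) * zz ^ 2) ^ (\<alpha> * i) * zz ^ (\<beta> * i))"

definition Cas4I :: "nat \<Rightarrow> nat \<Rightarrow> series set" where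
  "Cas4I \<alpha> \<beta> = range (\<lambda>i. (xx * yy) ^ (\<alpha> * i) * zz ^ (\<beta> * i))"

definition casimir_part :: "series set \<Rightarrow> series set \<Rightarrow> polyvec set" where
  "casimir_part C C' =
     multiples C unit_pv
     \<union> multiples C (Y 1 + scale (1/2) (Y 3))
     \<union> multiples C (Y 2 + scale (1/2) (Y 3))
     \<union> multiples C' (Y 2 \<^bold>\<and> Y 3 + Y 3 \<^bold>\<and> Y 1)
     \<union> multiples C' (Y 1 \<^bold>\<and> Y 2)
     \<union> multiples C' (Y 1 \<^bold>\<and> Y 2 \<^bold>\<and> Y 3)"

definition singular_part :: "nat set \<Rightarrow> nat set \<Rightarrow> polyvec set" where
  "singular_part N2 N3 =
     multiples {zz ^ k | k. k \<notin> N2} (pd 1 \<^bold>\<and> pd 2)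
     \<union> multiples {zz ^ k | k. k \<notin> N3} (pd 1 \<^bold>\<and> pd 2 \<^bold>\<and> pd 3)"

definition equal_part :: "polyvec set" where
  "equal_part =
     multiples (range (\<lambda>k. xx ^ k)) (pd 2 \<^bold>\<and> pd 3)
     \<union> multiples (range (\<lambda>k. yy ^ k)) (pd 3 \<^bold>\<and> pd 1)
     \<union> multiples (range (\<lambda>k. xx ^ k) \<union> range (\<lambda>k. yy ^ k)) (pd 1 \<^bold>\<and> pd 2 \<^bold>\<and> pd 3)"

text \<open>
  The factor \<open>z^(-1)\<close> of \<open>(xy)^\<alpha> z^(-1)\<close> cancels against the factor \<open>z\<close> of \<open>Y\<^sub>3\<close>:
  \<open>z^(-1) (Y\<^sub>2\<^sub>3 + Y\<^sub>3\<^sub>1) = Y\<^sub>2 \<and> \<partial>\<^sub>3 + \<partial>\<^sub>3 \<and> Y\<^sub>1\<close> and \<open>z^(-1) Y\<^sub>1\<^sub>2\<^sub>3 = Y\<^sub>1 \<and> Y\<^sub>2 \<and> \<partial>\<^sub>3\<close>.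
\<close>

definition exceptional_part :: "nat \<Rightarrow> polyvec set" where
  "exceptional_part \<alpha> =
     {(xx * yy) ^ \<alpha> \<odot> (Y 2 \<^bold>\<and> pd 3 + pd 3 \<^bold>\<and> Y 1),
      (xx * yy) ^ \<alpha> \<odot> (Y 1 \<^bold>\<and> Y 2 \<^bold>\<and> pd 3)}"

definition reps_positive :: "real \<Rightarrow> real \<Rightarrow> nat \<Rightarrow> nat \<Rightarrow> polyvec set" where
  "reps_positive a b \<alpha> \<beta> =
     casimir_part (Cas4 a b \<alpha> \<beta>) (Cas4I \<alpha> \<beta>)
     \<union> singular_part {m * (2 * \<alpha> + \<beta>) + 2 | m. True} {m * (2 * \<alpha> + \<beta>) + 3 | m. True}
     \<union> (if b = a then equal_part else {})"

definition reps_exceptional :: "nat \<Rightarrow> polyvec set" where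
  "reps_exceptional \<alpha> =
     casimir_part {1} {1} \<union> exceptional_part \<alpha>
     \<union> singular_part {2, 2 * \<alpha> + 1} {3, 2 * \<alpha> + 2}"

definition reps_generic :: "polyvec set" where
  "reps_generic = casimir_part {1} {1} \<union> singular_part {2} {3}"

end

theory Submission
  imports Defs
begin

text \<open>
  On numerator monomials \<open>x\<^sup>i y\<^sup>j z\<^sup>k / D\<close> the differential of \<open>Lambda4\<close> splits as \<open>d\<^sub>0 + d\<^sub>1\<close>: \<open>d\<^sub>0\<close> keeps
  the monomial and is the exterior product with a vector depending linearly on \<open>(i, j, k)\<close>, while
  \<open>d\<^sub>1\<close> raises the exponent of \<open>z\<close> by two. A contraction with a dual covector is a homotopy \<open>h\<close>
  for \<open>d\<^sub>0\<close> away from the few harmonic monomials, on which \<open>d\<^sub>0\<close> vanishes. Each harmonic coordinate is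
  the leading term of an explicit cochain \<open>e\<close>, and the map \<open>x + d\<^sub>0 g + g' \<mapsto> e(x) + d g + g'\<close>, with
  \<open>x\<close> harmonic and \<open>g, g'\<close> in the range of \<open>h\<close>, is unipotent for the filtration by powers of \<open>z\<close>,
  hence bijective on formal series. It transports \<open>d\<close> to its action on the cochains \<open>e\<close>. All of these
  are cocycles, except those with leading terms \<open>D'\<^sup>n z\<^sup>m Y\<^sub>3\<close> and \<open>D'\<^sup>n z\<^sup>m Y\<^sub>1\<^sub>3\<close>, \<open>b n = a m\<close>, whose
  differentials are nonzero multiples of \<open>z\<^bsup>m+2n+2\<^esup> \<partial>\<^sub>1\<^sub>2\<close> and \<open>z\<^bsup>m+2n+3\<^esup> \<partial>\<^sub>1\<^sub>2\<^sub>3\<close>. The remaining cochains \<open>e\<close>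
  are the representatives, and their compatibility with the filtration gives \<open>E\<^sub>\<infinity>\<close> and \<open>G\<close> as well.
\<close>

section \<open>Filtered complexes of formal series\<close>

definition vanish_below :: "('i \<Rightarrow> nat) \<Rightarrow> nat \<Rightarrow> ('i \<Rightarrow> real) \<Rightarrow> bool" where
  "vanish_below lev p F \<longleftrightarrow> (\<forall>i. lev i < p \<longrightarrow> F i = 0)"

definition real_linear :: "(('i \<Rightarrow> real) \<Rightarrow> ('j \<Rightarrow> real)) \<Rightarrow> bool" where
  "real_linear U \<longleftrightarrow> (\<forall>F W. U (F + W) = U F + U W) \<and> (\<forall>c F. U (\<lambda>i. c * F i) = (\<lambda>i. c * U F i))"

lemma real_linear_add: "real_linear U \<Longrightarrow> U (F + W) = U F + U W"
  by (simp add: real_linear_def)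

lemma real_linear_scale: "real_linear U \<Longrightarrow> U (\<lambda>i. c * F i) = (\<lambda>i. c * U F i)"
  by (simp add: real_linear_def)

lemma real_linear_zero: "real_linear U \<Longrightarrow> U 0 = 0"
  using real_linear_scale [of U 0 0] by (simp add: zero_fun_def)

lemma real_linear_minus: "real_linear U \<Longrightarrow> U (- F) = - U F"
  using real_linear_scale [of U "-1" F] by (simp add: fun_Compl_def)

lemma real_linear_diff: "real_linear U \<Longrightarrow> U (F - W) = U F - U W"
  using real_linear_add [of U F "- W"] real_linear_minus [of U W] by simp

lemma real_linear_sum:
  assumes "real_linear U"
  shows "U (\<lambda>i. \<Sum>s\<in>S. c s * E s i) = (\<lambda>i. \<Sum>s\<in>S. c s * U (E s) i)"
proof (induction S rule: infinite_finite_induct)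
  case (insert s S)
  have "(\<lambda>i. \<Sum>t\<in>insert s S. c t * E t i) = (\<lambda>i. c s * E s i) + (\<lambda>i. \<Sum>t\<in>S. c t * E t i)"
    using insert.hyps by (simp add: plus_fun_def)
  then show ?case
    using insert real_linear_add [OF assms, of "\<lambda>i. c s * E s i"] real_linear_scale [OF assms, of "c s" "E s"]
    by (simp add: plus_fun_def)
qed (use real_linear_zero [OF assms] in \<open>simp_all add: zero_fun_def\<close>)

definition supported_on :: "'i set \<Rightarrow> ('i \<Rightarrow> real) set" where
  "supported_on X = {F. \<forall>i. i \<notin> X \<longrightarrow> F i = 0}"

lemma supported_onD: "F \<in> supported_on X \<Longrightarrow> i \<notin> X \<Longrightarrow> F i = 0"
  by (simp add: supported_on_def)

lemma supported_on_add: "F \<in> supported_on X \<Longrightarrow> W \<in> supported_on X \<Longrightarrow> F + W \<in> supported_on X"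
  by (simp add: supported_on_def)

lemma supported_on_diff: "F \<in> supported_on X \<Longrightarrow> W \<in> supported_on X \<Longrightarrow> F - W \<in> supported_on X"
  by (simp add: supported_on_def)

lemma supported_on_minus: "F \<in> supported_on X \<Longrightarrow> - F \<in> supported_on X"
  by (simp add: supported_on_def)

lemma supported_on_zero: "0 \<in> supported_on X"
  by (simp add: supported_on_def)

text \<open>\<open>U\<close> is the identity modulo the next level. If \<open>F\<close> vanishes
  below \<open>q\<close>, it therefore agrees with \<open>U F\<close> at level \<open>q\<close>,
  where \<open>U F\<close> is zero; the levels are cleared one at a time.\<close>

lemma unipotent_vanish:
  assumes U: "real_linear U" "\<And>F. F \<in> supported_on X \<Longrightarrow> U F \<in> supported_on X"
    and uni: "\<And>F p. F \<in> supported_on X \<Longrightarrow> vanish_below lev p F \<Longrightarrow> vanish_below lev (Suc p) (U F - F)"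
    and F: "F \<in> supported_on X" and UF: "vanish_below lev p (U F)"
  shows "vanish_below lev p F"
proof -
  have "vanish_below lev q F" if "q \<le> p" for q
    using that
  proof (induction q)
    case 0
    then show ?case by (simp add: vanish_below_def)
  next
    case (Suc q)
    then have "vanish_below lev (Suc q) (U F - F)"
      using uni F by simp
    moreover have "vanish_below lev (Suc q) (U F)"
      using UF Suc.prems by (auto simp: vanish_below_def)
    ultimately show ?case
      by (simp add: vanish_below_def)
  qed
  then show ?thesis by simp
qed

lemma unipotent_inj:
  assumes "real_linear U" "\<And>F. F \<in> supported_on X \<Longrightarrow> U F \<in> supported_on X"
    and "\<And>F p. F \<in> supported_on X \<Longrightarrow> vanish_below lev p F \<Longrightarrow> vanish_below lev (Suc p) (U F - F)"
    and "F \<in> supported_on X" and "U F = 0"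
  shows "F = 0"
proof
  fix i
  have "vanish_below lev (Suc (lev i)) F"
    by (rule unipotent_vanish [OF assms(1-4)]) (use assms in \<open>auto simp: vanish_below_def\<close>)
  then show "F i = 0 i"
    by (simp add: vanish_below_def)
qed

text \<open>The preimage is the limit, level by level, of the iteration \<open>F \<mapsto> F + (P - U F)\<close>.\<close>

lemma unipotent_surj:
  assumes U: "real_linear U" "\<And>F. F \<in> supported_on X \<Longrightarrow> U F \<in> supported_on X"
    and uni: "\<And>F p. F \<in> supported_on X \<Longrightarrow> vanish_below lev p F \<Longrightarrow> vanish_below lev (Suc p) (U F - F)"
    and P: "P \<in> supported_on X"
  obtains F where "F \<in> supported_on X" "U F = P"
proof -
  define A where "A = rec_nat 0 (\<lambda>_ F. F + (P - U F))"
  have A0: "A 0 = 0" and AS: "A (Suc n) = A n + (P - U (A n))" for n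
    by (simp_all add: A_def)
  have AX: "A n \<in> supported_on X" for n
    by (induction n) (auto simp only: A0 AS intro!: P U(2) supported_on_zero supported_on_add supported_on_diff)
  have res: "vanish_below lev n (P - U (A n))" for n
  proof (induction n)
    case (Suc n)
    let ?R = "P - U (A n)"
    have "U (A (Suc n)) i = U (A n) i + U ?R i" for i
      by (simp add: AS real_linear_add [OF U(1)])
    moreover have "vanish_below lev (Suc n) (U ?R - ?R)"
      by (rule uni [OF supported_on_diff [OF P U(2) [OF AX]] Suc])
    ultimately show ?case
      by (simp add: vanish_below_def)
  qed (simp add: vanish_below_def)
  have stable: "A (n + m) i = A n i" if "lev i < n" for n m i
  proof (induction m)
    case (Suc m)
    have "(P - U (A (n + m))) i = 0"
      using res [of "n + m"] that unfolding vanish_below_def by (meson trans_less_add1)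
    with Suc show ?case
      by (simp add: AS)
  qed simp
  define F where "F i = A (Suc (lev i)) i" for i
  have FX: "F \<in> supported_on X"
    using AX by (auto simp: F_def supported_on_def)
  have "U F i = P i" for i
  proof -
    let ?n = "Suc (lev i)"
    let ?R = "F - A ?n"
    have "vanish_below lev ?n ?R"
      unfolding vanish_below_def
    proof (intro allI impI)
      fix j assume "lev j < ?n"
      then have "A ?n j = A (Suc (lev j)) j"
        using stable [of j "Suc (lev j)" "?n - Suc (lev j)"] by simp
      then show "?R j = 0"
        by (simp add: F_def)
    qed
    then have "vanish_below lev (Suc ?n) (U ?R - ?R)" and "?R i = 0"
      using uni FX AX by (auto simp: supported_on_diff) (simp add: vanish_below_def)
    then have "U ?R i = 0"
      by (simp add: vanish_below_def)
    then have "U F i = U (A ?n) i"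
      by (simp add: real_linear_diff [OF U(1)])
    also have "\<dots> = P i"
      using res [of ?n] by (simp add: vanish_below_def)
    finally show ?thesis .
  qed
  then show thesis
    using that FX by blast
qed

text \<open>
  A filtered complex of formal series with a contraction \<open>h\<close> of its leading differential \<open>d0\<close> onto
  the coordinates in \<open>H\<close>, and cochains \<open>e i\<close>, \<open>i \<in> H\<close>, with leading coordinate \<open>i\<close>, on which the
  full differential \<open>d\<close> acts as a matching \<open>\<nu>\<close>.
\<close>

locale matched_complex =
  fixes X :: "'i set" and deg lev :: "'i \<Rightarrow> nat"
    and d d0 h :: "('i \<Rightarrow> real) \<Rightarrow> 'i \<Rightarrow> real"
    and H T :: "'i set" and e :: "'i \<Rightarrow> 'i \<Rightarrow> real" and \<nu> :: "'i \<Rightarrow> 'i" and \<mu> :: "'i \<Rightarrow> real"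
  assumes fin: "finite {i \<in> X. deg i = n}"
    and lin: "real_linear d" "real_linear d0" "real_linear h"
    and closed: "F \<in> supported_on X \<Longrightarrow> d F \<in> supported_on X"
      "F \<in> supported_on X \<Longrightarrow> d0 F \<in> supported_on X"
      "F \<in> supported_on X \<Longrightarrow> h F \<in> supported_on X"
    and d_local: "(\<And>j. Suc (deg j) = deg i \<Longrightarrow> F j = W j) \<Longrightarrow> d F i = d W i"
    and d_d: "F \<in> supported_on X \<Longrightarrow> d (d F) = 0"
    and leading: "F \<in> supported_on X \<Longrightarrow> vanish_below lev p F \<Longrightarrow>
      vanish_below lev (Suc p) (d (h F) - d0 (h F))"
    and homotopy: "F \<in> supported_on X \<Longrightarrow>
      (\<lambda>i. if i \<in> H then F i else 0) + d0 (h F) + h (d0 F) = F"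
    and h_h: "F \<in> supported_on X \<Longrightarrow> h (h F) = 0"
    and d0_d0: "F \<in> supported_on X \<Longrightarrow> d0 (d0 F) = 0"
    and harmonic: "F \<in> supported_on X \<Longrightarrow> F \<in> supported_on H \<Longrightarrow> d0 F = 0 \<and> h F = 0"
    and not_harmonic: "F \<in> supported_on X \<Longrightarrow> i \<in> H \<Longrightarrow> d0 F i = 0 \<and> h F i = 0"
    and HX: "H \<subseteq> X"
    and e_closed: "i \<in> H \<Longrightarrow> e i \<in> supported_on X"
    and e_deg: "i \<in> H \<Longrightarrow> e i j \<noteq> 0 \<Longrightarrow> deg j = deg i"
    and e_lead: "i \<in> H \<Longrightarrow> e i i = 1"
    and e_lev: "i \<in> H \<Longrightarrow> e i j \<noteq> 0 \<Longrightarrow> j = i \<or> lev i < lev j"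
    and TH: "T \<subseteq> H" and \<nu>H: "\<nu> ` T \<subseteq> H" and \<nu>T: "\<nu> ` T \<inter> T = {}" and \<nu>_inj: "inj_on \<nu> T"
    and \<mu>: "i \<in> T \<Longrightarrow> \<mu> i \<noteq> 0"
    and d_e: "i \<in> H \<Longrightarrow> i \<notin> T \<Longrightarrow> d (e i) = 0"
    and d_eT: "i \<in> T \<Longrightarrow> d (e i) = (\<lambda>j. \<mu> i * e (\<nu> i) j)"
    and deg_\<nu>: "i \<in> T \<Longrightarrow> deg (\<nu> i) = Suc (deg i)"
begin

section \<open>Decomposition of cochains adapted to the full differential\<close>

text \<open>Combinations of infinitely many cochains \<open>e j\<close> are meant. As
  \<open>e j\<close> is homogeneous, only indices of the degree of \<open>i\<close> contribute at
  \<open>i\<close>, and these are finite in number.\<close>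

definition \<Phi> :: "('i \<Rightarrow> real) \<Rightarrow> 'i \<Rightarrow> real" where
  "\<Phi> c i = (\<Sum>j | j \<in> H \<and> deg j = deg i. c j * e j i)"

lemma finH: "finite {j. j \<in> H \<and> deg j = n}"
  by (rule finite_subset [OF _ fin [of n]]) (use HX in auto)

lemma \<Phi>_linear: "real_linear \<Phi>"
  by (auto simp: real_linear_def \<Phi>_def fun_eq_iff sum.distrib distrib_right sum_distrib_left
      intro!: sum.cong)

lemma \<Phi>_closed: "\<Phi> c \<in> supported_on X"
  unfolding supported_on_def \<Phi>_def
  by (auto intro!: sum.neutral dest: supported_onD [OF e_closed])

text \<open>This is \<open>d\<close> written in the cochains \<open>e\<close>. Since
  \<open>\<nu>\<close> is injective, at most one of them contributes to each coefficient.\<close>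

definition \<delta> :: "('i \<Rightarrow> real) \<Rightarrow> 'i \<Rightarrow> real" where
  "\<delta> c i = (if i \<in> \<nu> ` T then \<mu> (inv_into T \<nu> i) * c (inv_into T \<nu> i) else 0)"

lemma \<delta>_\<nu>: "i \<in> T \<Longrightarrow> \<delta> c (\<nu> i) = \<mu> i * c i"
  by (simp add: \<delta>_def inv_into_f_f [OF \<nu>_inj])

text \<open>Linearity covers finite sums only. At a given index \<open>d\<close> sees a single
  degree, and there the combination is finite.\<close>

lemma d_\<Phi>: "d (\<Phi> c) = \<Phi> (\<delta> c)"
proof
  fix i
  show "d (\<Phi> c) i = \<Phi> (\<delta> c) i"
  proof (cases "deg i")
    case 0
    have "d (\<Phi> c) i = d 0 i"
      by (rule d_local) (use 0 in simp)
    moreover have "\<Phi> (\<delta> c) i = 0"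
      unfolding \<Phi>_def using 0 deg_\<nu> by (auto intro!: sum.neutral simp: \<delta>_def)
    ultimately show ?thesis
      by (simp add: real_linear_zero lin)
  next
    case (Suc n)
    let ?S = "{j. j \<in> H \<and> deg j = n}"
    have "d (\<Phi> c) i = d (\<lambda>i. \<Sum>j\<in>?S. c j * e j i) i"
      by (rule d_local) (use Suc in \<open>simp add: \<Phi>_def\<close>)
    also have "\<dots> = (\<Sum>j\<in>?S. c j * d (e j) i)"
      by (simp add: real_linear_sum lin)
    also have "\<dots> = (\<Sum>j\<in>?S \<inter> T. \<delta> c (\<nu> j) * e (\<nu> j) i)"
      by (rule sum.mono_neutral_cong_right) (use finH [of n] d_e in \<open>auto simp: d_eT \<delta>_\<nu>\<close>)
    also have "\<dots> = (\<Sum>j\<in>\<nu> ` (?S \<inter> T). \<delta> c j * e j i)"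
      by (subst sum.reindex) (auto intro: inj_on_subset [OF \<nu>_inj])
    also have "\<dots> = \<Phi> (\<delta> c) i"
      unfolding \<Phi>_def
    proof (rule sum.mono_neutral_left)
      show "\<forall>j\<in>{j. j \<in> H \<and> deg j = deg i} - \<nu> ` (?S \<inter> T). \<delta> c j * e j i = 0"
        using Suc deg_\<nu> TH by (auto simp: \<delta>_def)
    qed (use Suc deg_\<nu> \<nu>H in \<open>auto simp: finH\<close>)
    finally show ?thesis .
  qed
qed

text \<open>By the homotopy formula \<open>F\<close> is its harmonic part plus
  \<open>d0 (h F)\<close> plus \<open>h (d0 F)\<close>. Here the harmonic part is replaced by its
  extension \<open>\<Phi>\<close> and \<open>d0\<close> by \<open>d\<close>.\<close>

definition U :: "('i \<Rightarrow> real) \<Rightarrow> 'i \<Rightarrow> real" where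
  "U F = \<Phi> F + d (h F) + h (d0 F)"

lemmas linear_simps =
  real_linear_add [OF \<Phi>_linear] real_linear_add [OF lin(1)] real_linear_add [OF lin(2)] real_linear_add [OF lin(3)]
  real_linear_diff [OF \<Phi>_linear] real_linear_diff [OF lin(1)] real_linear_diff [OF lin(2)] real_linear_diff [OF lin(3)]
  real_linear_minus [OF \<Phi>_linear] real_linear_minus [OF lin(1)] real_linear_minus [OF lin(2)] real_linear_minus [OF lin(3)]
  real_linear_zero [OF \<Phi>_linear] real_linear_zero [OF lin(1)] real_linear_zero [OF lin(2)] real_linear_zero [OF lin(3)]
  real_linear_scale [OF \<Phi>_linear] real_linear_scale [OF lin(1)] real_linear_scale [OF lin(2)] real_linear_scale [OF lin(3)]

lemma U_linear: "real_linear U"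
  by (auto simp: real_linear_def U_def linear_simps algebra_simps)

lemma U_closed: "F \<in> supported_on X \<Longrightarrow> U F \<in> supported_on X"
  by (simp add: U_def supported_on_add \<Phi>_closed closed)

text \<open>The difference to the identity has two sources: the terms of \<open>e i\<close> other
  than \<open>i\<close>, which lie above the level of \<open>i\<close>, and \<open>d - d0\<close> on
  the range of \<open>h\<close>, which raises the level.\<close>

lemma U_unipotent:
  assumes F: "F \<in> supported_on X" "vanish_below lev p F"
  shows "vanish_below lev (Suc p) (U F - F)"
proof -
  let ?\<pi> = "\<lambda>i. if i \<in> H then F i else 0"
  have eq: "U F - F = (\<Phi> F - ?\<pi>) + (d (h F) - d0 (h F))"
    unfolding U_def by (subst homotopy [OF F(1), symmetric]) (simp add: algebra_simps)
  have "\<Phi> F i = ?\<pi> i" if "lev i \<le> p" for i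
  proof -
    have 0: "F j * e j i = 0" if "j \<in> H" "j \<noteq> i" for j
    proof (cases "lev j < p")
      case True
      with F show ?thesis by (simp add: vanish_below_def)
    next
      case False
      then show ?thesis
        using e_lev [of j i] that \<open>lev i \<le> p\<close> by force
    qed
    have "\<Phi> F i = (\<Sum>j | j \<in> H \<and> deg j = deg i. if j = i then F i else 0)"
      unfolding \<Phi>_def by (rule sum.cong) (auto simp: 0 e_lead)
    also have "\<dots> = ?\<pi> i"
      using finH [of "deg i"] by (simp add: sum.delta)
    finally show ?thesis .
  qed
  then have "vanish_below lev (Suc p) (\<Phi> F - ?\<pi>)"
    by (simp add: vanish_below_def)
  with leading [OF F] show ?thesis
    unfolding eq by (simp add: vanish_below_def)
qed

lemma decompose:
  assumes P: "P \<in> supported_on X" "vanish_below lev p P"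
  obtains c g g' where "c \<in> supported_on H" "vanish_below lev p c"
    "g \<in> h ` supported_on X" "g' \<in> h ` supported_on X" "P = \<Phi> c + d g + g'"
proof -
  obtain F where F: "F \<in> supported_on X" "U F = P"
    by (rule unipotent_surj [OF U_linear U_closed U_unipotent P(1)])
  let ?c = "\<lambda>i. if i \<in> H then F i else 0"
  have "vanish_below lev p F"
    by (rule unipotent_vanish [OF U_linear U_closed U_unipotent]) (use F P in auto)
  moreover have "\<Phi> ?c = \<Phi> F"
    by (auto simp: \<Phi>_def intro!: sum.cong)
  ultimately show thesis
    using F closed by (intro that [of ?c "h F" "h (d0 F)"])
      (auto simp: U_def supported_on_def vanish_below_def)
qed

text \<open>The three components reassemble to a single \<open>F\<close> with
  \<open>U F = 0\<close>, so injectivity of \<open>U\<close> applies; \<open>h F\<close> and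
  \<open>h (d0 F)\<close> recover \<open>g\<close> and \<open>g'\<close>.\<close>

lemma decompose_unique:
  assumes c: "c \<in> supported_on H" and g: "g \<in> h ` supported_on X" "g' \<in> h ` supported_on X"
    and eq: "\<Phi> c + d g + g' = 0"
  shows "c = 0" "g = 0" "g' = 0"
proof -
  have cX: "c \<in> supported_on X"
    using c HX by (auto simp: supported_on_def)
  have gX: "g \<in> supported_on X" "g' \<in> supported_on X" "h g = 0" "h g' = 0"
    using g closed h_h by auto
  \<comment> \<open>An element of the range of \<open>h\<close> has no harmonic part and is
    annihilated by \<open>h\<close>, so one term of the homotopy formula survives.\<close>
  have hd0: "h (d0 W) = W" if "W \<in> h ` supported_on X" for W
  proof -
    have W: "W \<in> supported_on X" "h W = 0" "\<And>i. i \<in> H \<Longrightarrow> W i = 0"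
      using that closed h_h not_harmonic by auto
    then have 0: "(\<lambda>i. if i \<in> H then W i else 0) = 0"
      by auto
    show ?thesis
      using homotopy [OF W(1)] unfolding 0 W(2) by (simp add: linear_simps)
  qed
  define F where "F = c + d0 g + g'"
  have FX: "F \<in> supported_on X"
    by (simp add: F_def cX gX closed supported_on_add)
  have "h F = g" "h (d0 F) = g'"
    using harmonic [OF cX c] gX d0_d0
    by (simp_all add: F_def linear_simps hd0 g)
  moreover have "\<Phi> F = \<Phi> c"
    unfolding \<Phi>_def F_def using not_harmonic g gX by (fastforce intro!: sum.cong)
  ultimately have "U F = 0"
    using eq by (simp add: U_def)
  then have "F = 0"
    by (rule unipotent_inj [OF U_linear U_closed U_unipotent FX, rotated -1])
  then have z: "h F = 0" "h (d0 F) = 0"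
    by (simp_all add: linear_simps)
  with \<open>h F = g\<close> \<open>h (d0 F) = g'\<close> have "g = 0" "g' = 0"
    by simp_all
  then show "c = 0" "g = 0" "g' = 0"
    using \<open>F = 0\<close> by (simp_all add: F_def linear_simps)
qed

section \<open>Cohomology of a matched complex\<close>

definition free :: "'i set" where
  "free = H - T - \<nu> ` T"

lemma \<Phi>_cocycle: "c \<in> supported_on free \<Longrightarrow> d (\<Phi> c) = 0"
proof -
  assume "c \<in> supported_on free"
  then have "\<delta> c = 0"
    using inv_into_into [of _ \<nu> T] by (auto simp: \<delta>_def free_def supported_on_def fun_eq_iff)
  then show ?thesis
    by (simp add: d_\<Phi> linear_simps)
qed

text \<open>Decomposing \<open>Q\<close> turns the equation into one between decompositions, whence
  \<open>c = \<delta> c'\<close> by uniqueness. The right-hand side lives on the image of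
  \<open>\<nu>\<close>, where \<open>c\<close> vanishes.\<close>

lemma independent_classes:
  assumes c: "c \<in> supported_on free" and Q: "Q \<in> supported_on X" and eq: "\<Phi> c = d Q"
  shows "c = 0"
proof -
  have "vanish_below lev 0 Q"
    by (simp add: vanish_below_def)
  from decompose [OF Q this] obtain c' g g' where
    *: "c' \<in> supported_on H" "g \<in> h ` supported_on X" "g' \<in> h ` supported_on X" "Q = \<Phi> c' + d g + g'"
    by metis
  have "d Q = \<Phi> (\<delta> c') + d g'"
    using * closed d_d by (auto simp: linear_simps d_\<Phi>)
  then have "\<Phi> (c - \<delta> c') + d (- g') + 0 = 0"
    using eq by (simp add: linear_simps)
  moreover have "c - \<delta> c' \<in> supported_on H"
    using c \<nu>H by (auto simp: supported_on_def \<delta>_def free_def)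
  moreover have "- g' \<in> h ` supported_on X"
    using *(3) real_linear_minus [OF lin(3)] by (metis (no_types, lifting) imageE imageI supported_on_minus)
  moreover have "0 \<in> h ` supported_on X"
    by (metis imageI lin(3) real_linear_zero supported_on_zero)
  ultimately have "c - \<delta> c' = 0"
    by (metis decompose_unique(1))
  then have "c i = 0" for i
    using c by (cases "i \<in> \<nu> ` T") (auto simp: fun_eq_iff supported_on_def free_def \<delta>_def split: if_splits)
  then show ?thesis
    by auto
qed

text \<open>For a cocycle, uniqueness forces \<open>\<delta> c = 0\<close> and
  \<open>g' = 0\<close>. Hence \<open>c\<close> vanishes on \<open>T\<close>, and its part on the
  image of \<open>\<nu>\<close> is a differential because the factors \<open>\<mu>\<close> are
  invertible.\<close>

lemma spanning_classes:
  assumes P: "P \<in> supported_on X" "vanish_below lev p P" and dP: "d P = 0"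
  obtains c Q where "c \<in> supported_on free" "vanish_below lev p c" "Q \<in> supported_on X"
    "P = \<Phi> c + d Q"
proof -
  from decompose [OF P] obtain c g g' where
    *: "c \<in> supported_on H" "vanish_below lev p c" "g \<in> h ` supported_on X" "g' \<in> h ` supported_on X"
      "P = \<Phi> c + d g + g'"
    by metis
  have gX: "g \<in> supported_on X" "g' \<in> supported_on X"
    using * closed by auto
  have "\<Phi> (\<delta> c) + d g' + 0 = 0"
    using dP *(5) gX d_d by (simp add: linear_simps d_\<Phi>)
  moreover have "\<delta> c \<in> supported_on H"
    using \<nu>H by (auto simp: supported_on_def \<delta>_def)
  moreover have "0 \<in> h ` supported_on X"
    by (metis imageI lin(3) real_linear_zero supported_on_zero)
  ultimately have "\<delta> c = 0"
    using *(4) by (metis decompose_unique(1))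
  then have cT: "c i = 0" if "i \<in> T" for i
  proof -
    have "\<mu> i * c i = 0"
      using \<open>\<delta> c = 0\<close> \<delta>_\<nu> [OF that, of c] by simp
    then show ?thesis
      using \<mu> [OF that] by simp
  qed
  have g'0: "g' = 0"
    by (rule decompose_unique(2) [of "\<delta> c" g' 0]) fact+
  define c1 where "c1 i = (if i \<in> free then c i else 0)" for i
  define c2 where "c2 i = (if i \<in> T then c (\<nu> i) / \<mu> i else 0)" for i
  have "c = c1 + \<delta> c2"
  proof
    fix i
    show "c i = (c1 + \<delta> c2) i"
    proof (cases "i \<in> \<nu> ` T")
      case True
      then obtain t where "t \<in> T" "i = \<nu> t" by auto
      then show ?thesis
        using \<mu> by (auto simp: \<delta>_\<nu> c2_def c1_def free_def)
    next
      case False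
      then show ?thesis
        using *(1) cT by (auto simp: c1_def free_def \<delta>_def supported_on_def)
    qed
  qed
  then have "P = \<Phi> c1 + d (\<Phi> c2 + g)"
    by (simp add: *(5) g'0 linear_simps d_\<Phi> add.assoc)
  moreover have "c1 \<in> supported_on free" "vanish_below lev p c1"
    using *(2) by (auto simp: c1_def supported_on_def vanish_below_def)
  ultimately show thesis
    using that gX \<Phi>_closed supported_on_add by metis
qed

text \<open>Both \<open>\<Phi>\<close> and \<open>d\<close> are homogeneous, so cutting
  \<open>c\<close> to degree \<open>n\<close> and \<open>Q\<close> to the degree below leaves the
  equation intact.\<close>

lemma spanning_classes_deg:
  assumes P: "P \<in> supported_on X" "vanish_below lev p P" "\<And>i. deg i \<noteq> n \<Longrightarrow> P i = 0" and dP: "d P = 0"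
  obtains c Q where "c \<in> supported_on free" "vanish_below lev p c" "\<And>i. deg i \<noteq> n \<Longrightarrow> c i = 0"
    "Q \<in> supported_on X" "P = \<Phi> c + d Q"
proof -
  obtain c Q where *: "c \<in> supported_on free" "vanish_below lev p c" "Q \<in> supported_on X" "P = \<Phi> c + d Q"
    using spanning_classes [OF P(1,2) dP] .
  define c' where "c' i = (if deg i = n then c i else 0)" for i
  define Q' where "Q' i = (if Suc (deg i) = n then Q i else 0)" for i
  have "P i = (\<Phi> c' + d Q') i" for i
  proof (cases "deg i = n")
    case True
    have "d Q' i = d Q i"
      by (rule d_local) (simp add: Q'_def True)
    moreover have "\<Phi> c' i = \<Phi> c i"
      by (simp add: \<Phi>_def c'_def True)
    ultimately show ?thesis
      by (simp add: *(4))
  next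
    case False
    have "d Q' i = d 0 i"
      by (rule d_local) (simp add: Q'_def False)
    moreover have "\<Phi> c' i = 0"
      using False by (simp add: \<Phi>_def c'_def)
    ultimately show ?thesis
      by (simp add: P(3) [OF False] linear_simps)
  qed
  moreover have "c' \<in> supported_on free" "vanish_below lev p c'" "Q' \<in> supported_on X"
    using * by (auto simp: c'_def Q'_def supported_on_def vanish_below_def)
  ultimately show thesis
    by (intro that [of c' Q']) (auto simp: c'_def)
qed

end

section \<open>Coordinates of polyvector fields\<close>

text \<open>Constructors in place of subsets of {1, 2, 3} let identities between components be
  checked by a case distinction with eight cases.\<close>

datatype bas = B0 | B1 | B2 | B3 | B12 | B13 | B23 | B123

primrec st :: "bas \<Rightarrow> nat set" where
  "st B0 = {}" | "st B1 = {1}" | "st B2 = {2}" | "st B3 = {3}"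
| "st B12 = {1, 2}" | "st B13 = {1, 3}" | "st B23 = {2, 3}" | "st B123 = {1, 2, 3}"

lemma subset_123: "I \<subseteq> {1, 2, 3} \<longleftrightarrow> (\<exists>b. I = st b)"
proof
  assume *: "I \<subseteq> {1, 2, 3}"
  have "\<exists>b. (1 \<in> st b \<longleftrightarrow> 1 \<in> I) \<and> (2 \<in> st b \<longleftrightarrow> 2 \<in> I) \<and> (3 \<in> st b \<longleftrightarrow> 3 \<in> I)"
    by (cases "1 \<in> I"; cases "2 \<in> I"; cases "3 \<in> I")
      (auto intro: exI [of _ B0] exI [of _ B1] exI [of _ B2] exI [of _ B3]
        exI [of _ B12] exI [of _ B13] exI [of _ B23] exI [of _ B123])
  then obtain b where b: "1 \<in> st b \<longleftrightarrow> 1 \<in> I" "2 \<in> st b \<longleftrightarrow> 2 \<in> I" "3 \<in> st b \<longleftrightarrow> 3 \<in> I"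
    by blast
  have "st b \<subseteq> {1, 2, 3}"
    by (cases b) auto
  with * b have "I = st b"
    by blast
  then show "\<exists>b. I = st b" ..
next
  assume "\<exists>b. I = st b"
  then obtain b where "I = st b" by blast
  then show "I \<subseteq> {1, 2, 3}"
    by (cases b) auto
qed

lemma st_inject: "st b = st b' \<longleftrightarrow> b = b'"
proof -
  have "b = b'" if "st b = st b'"
  proof -
    have "1 \<in> st b \<longleftrightarrow> 1 \<in> st b'" "2 \<in> st b \<longleftrightarrow> 2 \<in> st b'" "3 \<in> st b \<longleftrightarrow> 3 \<in> st b'"
      using that by simp_all
    then show ?thesis
      by (cases b; cases b'; simp)
  qed
  then show ?thesis by blast
qed

text \<open>The numerator of a component is its coefficient times the missing coordinates;
  \<open>o1\<close>, \<open>o2\<close>, \<open>o3\<close> are the exponents of x, y, z in that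
  factor.\<close>

definition o1 :: "bas \<Rightarrow> nat" where "o1 b = (if 1 \<in> st b then 0 else 1)"
definition o2 :: "bas \<Rightarrow> nat" where "o2 b = (if 2 \<in> st b then 0 else 1)"
definition o3 :: "bas \<Rightarrow> nat" where "o3 b = (if 3 \<in> st b then 0 else 1)"

lemma o_simps [simp]:
  "o1 B0 = 1" "o1 B1 = 0" "o1 B2 = 1" "o1 B3 = 1" "o1 B12 = 0" "o1 B13 = 0" "o1 B23 = 1" "o1 B123 = 0"
  "o2 B0 = 1" "o2 B1 = 1" "o2 B2 = 0" "o2 B3 = 1" "o2 B12 = 0" "o2 B13 = 1" "o2 B23 = 0" "o2 B123 = 0"
  "o3 B0 = 1" "o3 B1 = 1" "o3 B2 = 1" "o3 B3 = 0" "o3 B12 = 1" "o3 B13 = 0" "o3 B23 = 0" "o3 B123 = 0"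
  by (simp_all add: o1_def o2_def o3_def)

type_synonym idx = "bas \<times> nat \<times> nat \<times> nat"

text \<open>
  \<open>co P (b, i, j, k)\<close> is the coefficient of \<open>(x\<^sup>i y\<^sup>j z\<^sup>k / D) Y\<^sub>b\<close>. Such a term has no pole exactly if the
  variables missing from \<open>b\<close> have a positive exponent.
\<close>

definition co :: "polyvec \<Rightarrow> idx \<Rightarrow> real" where
  "co P = (\<lambda>(b, i, j, k). numerator P (st b) $ i $ j $ k)"

definition allowed :: "idx set" where
  "allowed = {(b, i, j, k). o1 b \<le> i \<and> o2 b \<le> j \<and> o3 b \<le> k}"

lemma co_coeff:
  "co P (b, i, j, k) = (if (b, i, j, k) \<in> allowed then P (st b) $ (i - o1 b) $ (j - o2 b) $ (k - o3 b) else 0)"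
proof -
  have *: "numerator P (st b) = P (st b) * (if o1 b = 0 then 1 else xx) * (if o2 b = 0 then 1 else yy) * (if o3 b = 0 then 1 else zz)"
    by (cases b) (simp_all add: numerator_def coord_def insert_Diff_if mult.assoc)
  have "o1 b = 0 \<or> o1 b = 1" "o2 b = 0 \<or> o2 b = 1" "o3 b = 0 \<or> o3 b = 1"
    by (cases b; simp)+
  then show ?thesis
    by (elim disjE) (simp_all add: co_def allowed_def * Suc_le_eq)
qed

text \<open>Inverse of \<open>co\<close>: it only reads \<open>F\<close> at allowed indices, so
  \<open>co (mk F) = F\<close> for \<open>F\<close> supported there.\<close>

definition mk :: "(idx \<Rightarrow> real) \<Rightarrow> polyvec" where
  "mk F I = (if I \<subseteq> {1, 2, 3} then
     (let b = (THE b. I = st b) in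
       Abs_fps (\<lambda>i. Abs_fps (\<lambda>j. Abs_fps (\<lambda>k. F (b, i + o1 b, j + o2 b, k + o3 b))))) else 0)"

lemma mk_st: "mk F (st b) = Abs_fps (\<lambda>i. Abs_fps (\<lambda>j. Abs_fps (\<lambda>k. F (b, i + o1 b, j + o2 b, k + o3 b))))"
proof -
  have "(THE c. st b = st c) = b"
    by (auto simp: st_inject)
  moreover have "st b \<subseteq> {1, 2, 3}"
    using subset_123 by blast
  ultimately show ?thesis
    by (simp only: mk_def if_True Let_def)
qed

lemma mk_polyvecs: "mk F \<in> polyvecs"
proof -
  have "mk F I = 0" if "\<not> I \<subseteq> {1, 2, 3}" for I
    unfolding mk_def by (rule if_not_P [OF that])
  then show ?thesis
    unfolding polyvecs_def mem_Collect_eq by iprover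
qed

lemma polyvec_eqI:
  assumes "P \<in> polyvecs" "Q \<in> polyvecs" "\<And>b. P (st b) = Q (st b)"
  shows "P = Q"
proof
  fix I
  show "P I = Q I"
  proof (cases "I \<subseteq> {1, 2, 3}")
    case True
    then obtain b where "I = st b"
      using subset_123 by blast
    then show ?thesis using assms(3) by simp
  next
    case False
    then have "P I = 0" "Q I = 0"
      using assms(1,2) unfolding polyvecs_def by blast+
    then show ?thesis by simp
  qed
qed

lemma mk_nth: "mk F (st b) $ i $ j $ k = F (b, i + o1 b, j + o2 b, k + o3 b)"
  by (simp add: mk_st)

lemma mk_co:
  assumes "P \<in> polyvecs"
  shows "mk (co P) = P"
proof (rule polyvec_eqI [OF mk_polyvecs assms], intro fps_ext)
  fix b i j k
  show "mk (co P) (st b) $ i $ j $ k = P (st b) $ i $ j $ k"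
    by (simp add: mk_nth co_coeff allowed_def)
qed

lemma co_mk:
  assumes "F \<in> supported_on allowed"
  shows "co (mk F) = F"
proof
  fix t :: idx
  obtain b i j k where "t = (b, i, j, k)"
    by (metis prod_cases4)
  then show "co (mk F) t = F t"
    using supported_onD [OF assms, of t] by (simp add: co_coeff mk_nth) (simp add: allowed_def)
qed

section \<open>The wedge product and the Schouten bracket by components\<close>

lemma sum_Pow_insert:
  assumes "finite A" "x \<notin> A"
  shows "sum f (Pow (insert x A)) = sum f (Pow A) + (\<Sum>B\<in>Pow A. f (insert x B))"
proof -
  have "inj_on (insert x) (Pow A)"
    using assms by (auto simp: inj_on_def)
  moreover have "Pow A \<inter> insert x ` Pow A = {}"
    using assms by auto
  ultimately show ?thesis
    using assms by (simp add: Pow_insert sum.union_disjoint sum.reindex)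
qed

lemma shuffle_sign_empty: "shuffle_sign {} J = 1"
  by (simp add: shuffle_sign_def)

lemma shuffle_sign_insert:
  assumes "finite I" "finite J" "x \<notin> I"
  shows "shuffle_sign (insert x I) J = (- 1) ^ card (J \<inter> {..<x}) * shuffle_sign I J"
proof -
  let ?S = "{(i, j). i \<in> I \<and> j \<in> J \<and> j < i}"
  have "{(i, j). i \<in> insert x I \<and> j \<in> J \<and> j < i} = Pair x ` (J \<inter> {..<x}) \<union> ?S"
    by auto
  moreover have "finite ?S"
    by (rule finite_subset [of _ "I \<times> J"]) (use assms in auto)
  moreover have "card (Pair x ` (J \<inter> {..<x})) = card (J \<inter> {..<x})"
    by (rule card_image) (auto simp: inj_on_def)
  moreover have "Pair x ` (J \<inter> {..<x}) \<inter> ?S = {}"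
    using assms by auto
  ultimately have "card {(i, j). i \<in> insert x I \<and> j \<in> J \<and> j < i} = card (J \<inter> {..<x}) + card ?S"
    using assms by (simp only: card_Un_disjoint finite_imageI finite_Int simp_thms)
  then show ?thesis
    by (simp only: shuffle_sign_def power_add)
qed

lemmas wedge_simps = wedge_def sum_Pow_insert shuffle_sign_insert shuffle_sign_empty insert_Diff_if

lemma wedge_st:
  "wedge P Q (st B0) = P (st B0) * Q (st B0)"
  "wedge P Q (st B1) = P (st B0) * Q (st B1) + P (st B1) * Q (st B0)"
  "wedge P Q (st B2) = P (st B0) * Q (st B2) + P (st B2) * Q (st B0)"
  "wedge P Q (st B3) = P (st B0) * Q (st B3) + P (st B3) * Q (st B0)"
  "wedge P Q (st B12) = P (st B0) * Q (st B12) + P (st B1) * Q (st B2) - P (st B2) * Q (st B1) + P (st B12) * Q (st B0)"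
  "wedge P Q (st B13) = P (st B0) * Q (st B13) + P (st B1) * Q (st B3) - P (st B3) * Q (st B1) + P (st B13) * Q (st B0)"
  "wedge P Q (st B23) = P (st B0) * Q (st B23) + P (st B2) * Q (st B3) - P (st B3) * Q (st B2) + P (st B23) * Q (st B0)"
  "wedge P Q (st B123) = P (st B0) * Q (st B123) + P (st B1) * Q (st B23) - P (st B2) * Q (st B13) + P (st B3) * Q (st B12)
     + P (st B12) * Q (st B3) - P (st B13) * Q (st B2) + P (st B23) * Q (st B1) + P (st B123) * Q (st B0)"
  by (simp_all add: wedge_simps)

lemma odd_deriv_left_st:
  "odd_deriv_left 1 P (st B0) = P (st B1)" "odd_deriv_left 1 P (st B2) = P (st B12)" 
  "odd_deriv_left 1 P (st B3) = P (st B13)" "odd_deriv_left 1 P (st B23) = P (st B123)"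
  "odd_deriv_left 1 P (st B1) = 0" "odd_deriv_left 1 P (st B12) = 0" "odd_deriv_left 1 P (st B13) = 0" "odd_deriv_left 1 P (st B123) = 0"
  "odd_deriv_left 2 P (st B0) = P (st B2)" "odd_deriv_left 2 P (st B1) = - P (st B12)" 
  "odd_deriv_left 2 P (st B3) = P (st B23)" "odd_deriv_left 2 P (st B13) = - P (st B123)"
  "odd_deriv_left 2 P (st B2) = 0" "odd_deriv_left 2 P (st B12) = 0" "odd_deriv_left 2 P (st B23) = 0" "odd_deriv_left 2 P (st B123) = 0"
  "odd_deriv_left 3 P (st B0) = P (st B3)" "odd_deriv_left 3 P (st B1) = - P (st B13)" 
  "odd_deriv_left 3 P (st B2) = - P (st B23)" "odd_deriv_left 3 P (st B12) = P (st B123)"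
  "odd_deriv_left 3 P (st B3) = 0" "odd_deriv_left 3 P (st B13) = 0" "odd_deriv_left 3 P (st B23) = 0" "odd_deriv_left 3 P (st B123) = 0"
  by (simp_all add: odd_deriv_left_def shuffle_sign_insert shuffle_sign_empty insert_commute)

lemma odd_deriv_right_st:
  "odd_deriv_right 1 P (st B0) = P (st B1)" "odd_deriv_right 1 P (st B2) = - P (st B12)" 
  "odd_deriv_right 1 P (st B3) = - P (st B13)" "odd_deriv_right 1 P (st B23) = P (st B123)"
  "odd_deriv_right 1 P (st B1) = 0" "odd_deriv_right 1 P (st B12) = 0" "odd_deriv_right 1 P (st B13) = 0" "odd_deriv_right 1 P (st B123) = 0"
  "odd_deriv_right 2 P (st B0) = P (st B2)" "odd_deriv_right 2 P (st B1) = P (st B12)" 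
  "odd_deriv_right 2 P (st B3) = - P (st B23)" "odd_deriv_right 2 P (st B13) = - P (st B123)"
  "odd_deriv_right 2 P (st B2) = 0" "odd_deriv_right 2 P (st B12) = 0" "odd_deriv_right 2 P (st B23) = 0" "odd_deriv_right 2 P (st B123) = 0"
  "odd_deriv_right 3 P (st B0) = P (st B3)" "odd_deriv_right 3 P (st B1) = P (st B13)" 
  "odd_deriv_right 3 P (st B2) = P (st B23)" "odd_deriv_right 3 P (st B12) = P (st B123)"
  "odd_deriv_right 3 P (st B3) = 0" "odd_deriv_right 3 P (st B13) = 0" "odd_deriv_right 3 P (st B23) = 0" "odd_deriv_right 3 P (st B123) = 0"
  by (simp_all add: odd_deriv_right_def shuffle_sign_insert shuffle_sign_empty insert_commute)

text \<open>Opaque names for the coordinates: the simplifier would multiply out \<open>fps_const\<close>.\<close>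

definition vx :: series where "vx = xx"
definition vy :: series where "vy = yy"
definition vz :: series where "vz = zz"

lemma partial_deriv_nth:
  "partial_deriv l f $ i $ j $ k =
     (if l = 1 then real (Suc i) * f $ Suc i $ j $ k
      else if l = 2 then real (Suc j) * f $ i $ Suc j $ k else real (Suc k) * f $ i $ j $ Suc k)"
proof -
  have "(of_nat n * g :: real fps fps) $ j $ k = real n * g $ j $ k" for n g
    by (simp add: fps_of_nat [symmetric])
  moreover have "(of_nat n * g :: real fps) $ k = real n * g $ k" for n g
    by (simp add: fps_of_nat [symmetric])
  ultimately show ?thesis
    by (simp add: partial_deriv_def del: of_nat_Suc)
qed

lemma partial_deriv_add: "partial_deriv l (f + g) = partial_deriv l f + partial_deriv l g"
  by (auto simp: fps_eq_iff partial_deriv_nth algebra_simps)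

lemma partial_deriv_minus: "partial_deriv l (- f) = - partial_deriv l f"
  by (auto simp: fps_eq_iff partial_deriv_nth algebra_simps)

lemma partial_deriv_diff: "partial_deriv l (f - g) = partial_deriv l f - partial_deriv l g"
  by (auto simp: fps_eq_iff partial_deriv_nth algebra_simps)

lemma partial_deriv_zero [simp]: "partial_deriv l 0 = 0"
  by (auto simp: fps_eq_iff partial_deriv_nth)

text \<open>A derivation of the coefficient ring acts coefficientwise as a derivation of the power
  series ring. One application gives the Leibniz rule for the derivative in y, two give it for
  z.\<close>

lemma fps_deriv_map_mult:
  fixes D :: "'a::comm_ring_1 \<Rightarrow> 'a"
  assumes "\<And>u v. D (u + v) = D u + D v" "\<And>u v. D (u * v) = D u * v + u * D v"
  shows "Abs_fps (\<lambda>i. D ((f * g) $ i)) = Abs_fps (\<lambda>i. D (f $ i)) * g + f * Abs_fps (\<lambda>i. D (g $ i))"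
proof -
  have "D 0 = 0"
    using assms(1) [of 0 0] by simp
  then have "D (sum h S) = (\<Sum>x\<in>S. D (h x))" for h :: "nat \<Rightarrow> 'a" and S
    by (induction S rule: infinite_finite_induct) (simp_all add: assms)
  then show ?thesis
    by (simp add: fps_eq_iff fps_mult_nth assms sum.distrib)
qed

lemma partial_deriv_mult: "partial_deriv l (f * g) = partial_deriv l f * g + f * partial_deriv l g"
proof -
  define D where "D = (\<lambda>u::real fps fps. Abs_fps (\<lambda>j. fps_deriv (u $ j)))"
  have D: "D (u + v) = D u + D v" "D (u * v) = D u * v + u * D v" for u v
    unfolding D_def using fps_deriv_map_mult [of fps_deriv u v] by (simp_all add: fps_eq_iff distrib_left)
  show ?thesis
    using fps_deriv_map_mult [of fps_deriv f g] fps_deriv_map_mult [of D f g] D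
    by (simp add: partial_deriv_def D_def algebra_simps)
qed

lemma cst_nth: "cst c $ i $ j $ k = (if i = 0 \<and> j = 0 \<and> k = 0 then c else 0)"
  by (simp add: cst_def)

lemma partial_deriv_cst [simp]: "partial_deriv l (cst c) = 0"
  by (auto simp: fps_eq_iff partial_deriv_nth cst_nth)

lemma cst_simps: "cst 0 = 0" "cst 1 = 1" "cst (u + v) = cst u + cst v" "cst (u * v) = cst u * cst v"
  "cst (- u) = - cst u" "cst (u - v) = cst u - cst v" "cst (u ^ n) = cst u ^ n"
  by (simp_all add: cst_def fps_const_add [symmetric] fps_const_mult [symmetric] fps_const_neg [symmetric]
      fps_const_sub [symmetric] fps_const_power del: fps_const_add fps_const_mult fps_const_neg fps_const_sub)

lemma cst_of_nat: "cst (real n) = of_nat n"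
  by (induction n) (simp_all add: cst_simps)

lemma cst_numeral: "cst (numeral n) = numeral n"
  using cst_of_nat [of "numeral n"] by simp

lemma cst_mult_nth: "(cst c * f) $ i $ j $ k = c * f $ i $ j $ k"
  by (simp add: cst_def)

lemma partial_deriv_one [simp]: "partial_deriv l 1 = 0"
  using partial_deriv_cst [of l 1] by (simp add: cst_simps)

lemma partial_deriv_vars [simp]:
  "partial_deriv 1 vx = 1" "partial_deriv 1 vy = 0" "partial_deriv 1 vz = 0"
  "partial_deriv 2 vx = 0" "partial_deriv 2 vy = 1" "partial_deriv 2 vz = 0"
  "partial_deriv 3 vx = 0" "partial_deriv 3 vy = 0" "partial_deriv 3 vz = 1"
  by (auto simp: fps_eq_iff partial_deriv_def fps_X_def vx_def vy_def vz_def)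

lemmas partial_deriv_simps = partial_deriv_add partial_deriv_minus partial_deriv_diff partial_deriv_mult

lemma Lambda4_st:
  "Lambda4 a b (st B0) = 0" "Lambda4 a b (st B1) = 0" "Lambda4 a b (st B2) = 0" "Lambda4 a b (st B3) = 0"
  "Lambda4 a b (st B12) = cst b * vx * vy + vz * vz" "Lambda4 a b (st B13) = - (cst a * vx * vz)"
  "Lambda4 a b (st B23) = cst a * vy * vz" "Lambda4 a b (st B123) = 0"
  unfolding Lambda4_def plus_fun_apply mul_def wedge_st vx_def [symmetric] vy_def [symmetric] vz_def [symmetric]
  by (simp_all add: pd_def doubleton_eq_iff power2_eq_square)

lemma schouten_nth:
  "schouten P Q I =
     (odd_deriv_right 1 P \<^bold>\<and> even_deriv 1 Q) I - (even_deriv 1 P \<^bold>\<and> odd_deriv_left 1 Q) I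
   + ((odd_deriv_right 2 P \<^bold>\<and> even_deriv 2 Q) I - (even_deriv 2 P \<^bold>\<and> odd_deriv_left 2 Q) I)
   + ((odd_deriv_right 3 P \<^bold>\<and> even_deriv 3 Q) I - (even_deriv 3 P \<^bold>\<and> odd_deriv_left 3 Q) I)"
proof -
  have "(\<Sum>l\<in>{1, 2, 3::nat}. f l) I = f 1 I + f 2 I + f 3 I" for f :: "nat \<Rightarrow> polyvec"
    by (simp add: add.assoc)
  then show ?thesis
    unfolding schouten_def fun_diff_def .
qed

lemma schouten_st:
  fixes P :: polyvec and a b :: real
  defines "A \<equiv> cst a" and "B \<equiv> cst b" and "D \<equiv> partial_deriv"
  defines "L \<equiv> B * vx * vy + vz * vz"
  shows "schouten (Lambda4 a b) P (st B0) = 0"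
    "schouten (Lambda4 a b) P (st B1) = L * D 2 (P (st B0)) - A * vx * vz * D 3 (P (st B0))"
    "schouten (Lambda4 a b) P (st B2) = - (L * D 1 (P (st B0))) + A * vy * vz * D 3 (P (st B0))"
    "schouten (Lambda4 a b) P (st B3) = A * vx * vz * D 1 (P (st B0)) - A * vy * vz * D 2 (P (st B0))"
    "schouten (Lambda4 a b) P (st B12) =
       L * D 1 (P (st B1)) - A * vy * vz * D 3 (P (st B1)) + L * D 2 (P (st B2)) - A * vx * vz * D 3 (P (st B2))
       - B * vy * P (st B1) - B * vx * P (st B2) - 2 * vz * P (st B3)"
    "schouten (Lambda4 a b) P (st B13) =
       A * vy * vz * D 2 (P (st B1)) - A * vx * vz * D 1 (P (st B1)) + L * D 2 (P (st B3)) - A * vx * vz * D 3 (P (st B3))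
       + A * vz * P (st B1) + A * vx * P (st B3)"
    "schouten (Lambda4 a b) P (st B23) =
       A * vy * vz * D 2 (P (st B2)) - A * vx * vz * D 1 (P (st B2)) - L * D 1 (P (st B3)) + A * vy * vz * D 3 (P (st B3))
       - A * vz * P (st B2) - A * vy * P (st B3)"
    "schouten (Lambda4 a b) P (st B123) =
       A * vx * vz * D 1 (P (st B12)) - A * vy * vz * D 2 (P (st B12))
       + L * D 1 (P (st B13)) - A * vy * vz * D 3 (P (st B13))
       + L * D 2 (P (st B23)) - A * vx * vz * D 3 (P (st B23))
       + (A - B) * vy * P (st B13) + (A - B) * vx * P (st B23)"
  unfolding schouten_nth wedge_st
  by (simp_all add: odd_deriv_left_st odd_deriv_right_st even_deriv_def Lambda4_st partial_deriv_simps
      A_def B_def D_def L_def algebra_simps del: st.simps One_nat_def)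

section \<open>The differential on numerator coefficients\<close>

definition dV1 :: "real \<Rightarrow> real \<Rightarrow> nat \<Rightarrow> nat \<Rightarrow> nat \<Rightarrow> real" where
  "dV1 a b i j k = b * (real j - 1) - a * (real k - 1)"
definition dV2 :: "real \<Rightarrow> real \<Rightarrow> nat \<Rightarrow> nat \<Rightarrow> nat \<Rightarrow> real" where
  "dV2 a b i j k = a * (real k - 1) - b * (real i - 1)"
definition dV3 :: "real \<Rightarrow> real \<Rightarrow> nat \<Rightarrow> nat \<Rightarrow> nat \<Rightarrow> real" where
  "dV3 a b i j k = a * (real i - 1) - a * (real j - 1)"

text \<open>The fields Y_l commute, so bracketing their wedge products with f Y_I only
  differentiates f. For f = x^(i-1) y^(j-1) z^(k-1), the eigenvalues of Y_1, Y_2, Y_3 are i-1, j-1,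
  k-1, the shift coming from the denominator D. The result is f times the vector v with coordinates
  \<open>dV1\<close>, \<open>dV2\<close>, \<open>dV3\<close>, and the differential is the exterior
  product with v.\<close>

definition lead_diff :: "real \<Rightarrow> real \<Rightarrow> (idx \<Rightarrow> real) \<Rightarrow> idx \<Rightarrow> real" where
  "lead_diff a b F = (\<lambda>(I, i, j, k).
     let f = (\<lambda>J. F (J, i, j, k)); v1 = dV1 a b i j k; v2 = dV2 a b i j k; v3 = dV3 a b i j k
     in case I of
       B0 \<Rightarrow> 0
     | B1 \<Rightarrow> v1 * f B0
     | B2 \<Rightarrow> v2 * f B0
     | B3 \<Rightarrow> v3 * f B0
     | B12 \<Rightarrow> v1 * f B2 - v2 * f B1
     | B13 \<Rightarrow> v1 * f B3 - v3 * f B1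
     | B23 \<Rightarrow> v2 * f B3 - v3 * f B2
     | B123 \<Rightarrow> v1 * f B23 - v2 * f B13 + v3 * f B12)"

text \<open>Since z^2 \<open>\<partial>\<^sub>1\<^sub>2\<close> = (z^2 / (xy)) Y_12, this part
  lowers the exponents of x and y by one and raises that of z by two; the coefficient at (i, j, k)
  is fed from (i+1, j+1, k-2). The factor -2 comes from differentiating z^2.\<close>

definition corr_diff :: "(idx \<Rightarrow> real) \<Rightarrow> idx \<Rightarrow> real" where
  "corr_diff F = (\<lambda>(I, i, j, k).
     let f = (\<lambda>J. if k < 2 then 0 else F (J, i + 1, j + 1, k - 2))
     in case I of
       B0 \<Rightarrow> 0
     | B1 \<Rightarrow> real j * f B0
     | B2 \<Rightarrow> - real i * f B0
     | B3 \<Rightarrow> 0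
     | B12 \<Rightarrow> real (i + 1) * f B1 + real (j + 1) * f B2 - 2 * f B3
     | B13 \<Rightarrow> real j * f B3
     | B23 \<Rightarrow> - real i * f B3
     | B123 \<Rightarrow> real (i + 1) * f B13 + real (j + 1) * f B23)"

definition diff :: "real \<Rightarrow> real \<Rightarrow> (idx \<Rightarrow> real) \<Rightarrow> idx \<Rightarrow> real" where
  "diff a b F = lead_diff a b F + corr_diff F"

lemma vars_mult_nth:
  "(vx * f) $ i $ j $ k = (if i = 0 then 0 else f $ (i - 1) $ j $ k)"
  "(vy * f) $ i $ j $ k = (if j = 0 then 0 else f $ i $ (j - 1) $ k)"
  "(vz * f) $ i $ j $ k = (if k = 0 then 0 else f $ i $ j $ (k - 1))"
  by (simp_all add: vx_def vy_def vz_def)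

lemma two_mult_nth: "(2 * f :: series) $ i $ j $ k = 2 * f $ i $ j $ k"
  using cst_mult_nth [of 2 f] by (simp add: cst_numeral)

text \<open>From here on the bracket can be handled as an operator on coefficients. The zero
  exponents, and k = 1, are split off because natural subtraction truncates there.\<close>

lemma co_schouten: "co (schouten (Lambda4 a b) P) = diff a b (co P)"
proof
  fix t :: idx
  obtain I i j k where t: "t = (I, i, j, k)"
    by (metis prod_cases4)
  note simps = co_coeff allowed_def schouten_st diff_def lead_diff_def plus_fun_apply
      corr_diff_def dV1_def dV2_def dV3_def Let_def mult.assoc cst_mult_nth vars_mult_nth two_mult_nth
      partial_deriv_nth distrib_right left_diff_distrib
  note [simp del] = st.simps fps_mult_nth_0

  show "co (schouten (Lambda4 a b) P) t = diff a b (co P) t"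
    unfolding t
    by (cases I; cases k; cases "k - 1"; cases i; cases j; simp add: simps; simp add: algebra_simps)
qed

section \<open>The homotopy for the leading differential\<close>

text \<open>This is r + s for the bidegree (r, s). Both parts of the differential raise it by one:
  the correction loses two in x and y but gains two in z.\<close>

definition cdeg :: "idx \<Rightarrow> nat" where
  "cdeg = (\<lambda>(I, i, j, k). i + j + k + card (st I))"

text \<open>
  The exponent of \<open>z\<close> is refined so that \<open>Y\<^sub>1\<close> and \<open>Y\<^sub>2\<close> lead in \<open>Y\<^sub>1 + Y\<^sub>3 / 2\<close> and \<open>Y\<^sub>2 + Y\<^sub>3 / 2\<close>, and
  \<open>Y\<^sub>2\<^sub>3\<close> in \<open>Y\<^sub>2\<^sub>3 + Y\<^sub>3\<^sub>1\<close>.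
\<close>

definition flev :: "idx \<Rightarrow> nat" where
  "flev = (\<lambda>(I, i, j, k). 2 * k + (if I = B3 \<or> I = B13 then 1 else 0))"

text \<open>A vanishing exponent forces the component to contain the corresponding Y_l, so exterior
  multiplication in that direction gives nothing and contraction would create a pole. Only
  coordinates of v with positive exponent count.\<close>

definition harm_at :: "real \<Rightarrow> real \<Rightarrow> nat \<Rightarrow> nat \<Rightarrow> nat \<Rightarrow> bool" where
  "harm_at a b i j k \<longleftrightarrow> (i = 0 \<or> dV1 a b i j k = 0) \<and> (j = 0 \<or> dV2 a b i j k = 0) \<and> (k = 0 \<or> dV3 a b i j k = 0)"

definition harm :: "real \<Rightarrow> real \<Rightarrow> idx set" where
  "harm a b = {(I, i, j, k). (I, i, j, k) \<in> allowed \<and> harm_at a b i j k}"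

text \<open>
  A covector dual to \<open>(dV1, dV2, dV3)\<close>, supported on a coordinate whose exponent is positive, so
  that the contraction with it stays among the allowed cochains.
\<close>

definition th1 :: "real \<Rightarrow> real \<Rightarrow> nat \<Rightarrow> nat \<Rightarrow> nat \<Rightarrow> real" where
  "th1 a b i j k = (if i = 0 then 0 else inverse (dV1 a b i j k))"
definition th2 :: "real \<Rightarrow> real \<Rightarrow> nat \<Rightarrow> nat \<Rightarrow> nat \<Rightarrow> real" where
  "th2 a b i j k = (if j = 0 \<or> th1 a b i j k \<noteq> 0 then 0 else inverse (dV2 a b i j k))"
definition th3 :: "real \<Rightarrow> real \<Rightarrow> nat \<Rightarrow> nat \<Rightarrow> nat \<Rightarrow> real" where
  "th3 a b i j k = (if k = 0 \<or> th1 a b i j k \<noteq> 0 \<or> th2 a b i j k \<noteq> 0 then 0 else inverse (dV3 a b i j k))"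

lemma th_support: "th1 a b 0 j k = 0" "th2 a b i 0 k = 0" "th3 a b i j 0 = 0"
  by (simp_all add: th1_def th2_def th3_def)

text \<open>The covector uses the first admissible nonzero coordinate of v. As
  \<open>inverse 0 = 0\<close>, a vanishing coordinate yields the entry 0 and the choice passes on
  to the next one.\<close>

lemma th_dual:
  "th1 a b i j k * dV1 a b i j k + th2 a b i j k * dV2 a b i j k + th3 a b i j k * dV3 a b i j k =
     (if harm_at a b i j k then 0 else 1)"
  by (auto simp: th1_def th2_def th3_def harm_at_def)

lemma th_harm: "harm_at a b i j k \<Longrightarrow> th1 a b i j k = 0 \<and> th2 a b i j k = 0 \<and> th3 a b i j k = 0"
  by (auto simp: th1_def th2_def th3_def harm_at_def)

definition contraction :: "real \<Rightarrow> real \<Rightarrow> (idx \<Rightarrow> real) \<Rightarrow> idx \<Rightarrow> real" where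
  "contraction a b F = (\<lambda>(I, i, j, k).
     let f = (\<lambda>J. F (J, i, j, k)); t1 = th1 a b i j k; t2 = th2 a b i j k; t3 = th3 a b i j k
     in case I of
       B0 \<Rightarrow> t1 * f B1 + t2 * f B2 + t3 * f B3
     | B1 \<Rightarrow> - t2 * f B12 - t3 * f B13
     | B2 \<Rightarrow> t1 * f B12 - t3 * f B23
     | B3 \<Rightarrow> t1 * f B13 + t2 * f B23
     | B12 \<Rightarrow> t3 * f B123
     | B13 \<Rightarrow> - t2 * f B123
     | B23 \<Rightarrow> t1 * f B123
     | B123 \<Rightarrow> 0)"

lemma idx_eqI:
  fixes F W :: "idx \<Rightarrow> real"
  assumes "\<And>I i j k. F (I, i, j, k) = W (I, i, j, k)"
  shows "F = W"
proof
  fix t :: idx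
  show "F t = W t"
    by (cases t rule: prod_cases4) (simp add: assms)
qed

lemma real_linearI:
  fixes U :: "(idx \<Rightarrow> real) \<Rightarrow> idx \<Rightarrow> real"
  assumes "\<And>F W I i j k. U (F + W) (I, i, j, k) = U F (I, i, j, k) + U W (I, i, j, k)"
    and "\<And>c F I i j k. U (\<lambda>i. c * F i) (I, i, j, k) = c * U F (I, i, j, k)"
  shows "real_linear U"
proof -
  have "U (F + W) = U F + U W" for F W
    by (rule idx_eqI) (simp add: assms(1))
  moreover have "U (\<lambda>i. c * F i) = (\<lambda>i. c * U F i)" for c F
    by (rule idx_eqI) (rule assms(2))
  ultimately show ?thesis
    unfolding real_linear_def by blast
qed

lemma lead_diff_eqs:
  "lead_diff a b F (B0, i, j, k) = 0"
  "lead_diff a b F (B1, i, j, k) = dV1 a b i j k * F (B0, i, j, k)"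
  "lead_diff a b F (B2, i, j, k) = dV2 a b i j k * F (B0, i, j, k)"
  "lead_diff a b F (B3, i, j, k) = dV3 a b i j k * F (B0, i, j, k)"
  "lead_diff a b F (B12, i, j, k) = dV1 a b i j k * F (B2, i, j, k) - dV2 a b i j k * F (B1, i, j, k)"
  "lead_diff a b F (B13, i, j, k) = dV1 a b i j k * F (B3, i, j, k) - dV3 a b i j k * F (B1, i, j, k)"
  "lead_diff a b F (B23, i, j, k) = dV2 a b i j k * F (B3, i, j, k) - dV3 a b i j k * F (B2, i, j, k)"
  "lead_diff a b F (B123, i, j, k) = dV1 a b i j k * F (B23, i, j, k) - dV2 a b i j k * F (B13, i, j, k)
     + dV3 a b i j k * F (B12, i, j, k)"
  by (simp_all add: lead_diff_def Let_def)

lemma lead_diff_linear: "real_linear (lead_diff a b)"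
proof (rule real_linearI)
  fix F W c I i j k
  show "lead_diff a b (F + W) (I, i, j, k) = lead_diff a b F (I, i, j, k) + lead_diff a b W (I, i, j, k)"
    by (cases I; simp add: lead_diff_eqs algebra_simps)
  show "lead_diff a b (\<lambda>i. c * F i) (I, i, j, k) = c * lead_diff a b F (I, i, j, k)"
    by (cases I; simp add: lead_diff_eqs algebra_simps)
qed

lemma corr_diff_linear: "real_linear corr_diff"
proof (rule real_linearI)
  fix F W c I i j k
  show "corr_diff (F + W) (I, i, j, k) = corr_diff F (I, i, j, k) + corr_diff W (I, i, j, k)"
    by (cases I) (simp_all add: corr_diff_def algebra_simps)
  show "corr_diff (\<lambda>i. c * F i) (I, i, j, k) = c * corr_diff F (I, i, j, k)"
    by (cases I) (simp_all add: corr_diff_def distrib_left right_diff_distrib)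
qed

lemma diff_linear: "real_linear (diff a b)"
  by (rule real_linearI) (simp_all add: diff_def real_linear_add [OF lead_diff_linear] real_linear_add [OF corr_diff_linear]
      real_linear_scale [OF lead_diff_linear] real_linear_scale [OF corr_diff_linear] distrib_left)

lemma contraction_eqs:
  "contraction a b F (B0, i, j, k) = th1 a b i j k * F (B1, i, j, k) + th2 a b i j k * F (B2, i, j, k) + th3 a b i j k * F (B3, i, j, k)"
  "contraction a b F (B1, i, j, k) = - (th2 a b i j k * F (B12, i, j, k)) - th3 a b i j k * F (B13, i, j, k)"
  "contraction a b F (B2, i, j, k) = th1 a b i j k * F (B12, i, j, k) - th3 a b i j k * F (B23, i, j, k)"
  "contraction a b F (B3, i, j, k) = th1 a b i j k * F (B13, i, j, k) + th2 a b i j k * F (B23, i, j, k)"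
  "contraction a b F (B12, i, j, k) = th3 a b i j k * F (B123, i, j, k)"
  "contraction a b F (B13, i, j, k) = - (th2 a b i j k * F (B123, i, j, k))"
  "contraction a b F (B23, i, j, k) = th1 a b i j k * F (B123, i, j, k)"
  "contraction a b F (B123, i, j, k) = 0"
  by (simp_all add: contraction_def Let_def)

lemma contraction_linear: "real_linear (contraction a b)"
proof (rule real_linearI)
  fix F W c I i j k
  show "contraction a b (F + W) (I, i, j, k) = contraction a b F (I, i, j, k) + contraction a b W (I, i, j, k)"
    by (cases I; simp add: contraction_eqs algebra_simps)
  show "contraction a b (\<lambda>i. c * F i) (I, i, j, k) = c * contraction a b F (I, i, j, k)"
    by (cases I; simp add: contraction_eqs algebra_simps)
qed

lemma allowedD:
  assumes "F \<in> supported_on allowed"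
  shows "i < o1 I \<Longrightarrow> F (I, i, j, k) = 0" "j < o2 I \<Longrightarrow> F (I, i, j, k) = 0" "k < o3 I \<Longrightarrow> F (I, i, j, k) = 0"
  using assms by (auto simp: supported_on_def allowed_def)

lemma supported_onI: "(\<And>i. i \<notin> X \<Longrightarrow> F i = 0) \<Longrightarrow> F \<in> supported_on X"
  by (simp add: supported_on_def)

lemma diff_local:
  assumes "\<And>t. Suc (cdeg t) = cdeg s \<Longrightarrow> F t = W t"
  shows "diff a b F s = diff a b W s"
proof -
  obtain I i j k where s: "s = (I, i, j, k)"
    by (metis prod_cases4)
  show ?thesis
    using assms unfolding s
    by (cases I) (auto simp: diff_def lead_diff_eqs corr_diff_def Let_def cdeg_def)
qed

lemma lead_diff_closed:
  assumes "F \<in> supported_on allowed"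
  shows "lead_diff a b F \<in> supported_on allowed"
proof (rule supported_onI)
  fix t assume "t \<notin> allowed"
  moreover obtain I i j k where t: "t = (I, i, j, k)"
    by (metis prod_cases4)
  ultimately show "lead_diff a b F t = 0"
    unfolding t by (cases I) (auto simp: lead_diff_eqs Let_def allowed_def allowedD [OF assms])
qed

lemma corr_diff_closed:
  assumes "F \<in> supported_on allowed"
  shows "corr_diff F \<in> supported_on allowed"
proof (rule supported_onI)
  fix t assume "t \<notin> allowed"
  moreover obtain I i j k where t: "t = (I, i, j, k)"
    by (metis prod_cases4)
  ultimately show "corr_diff F t = 0"
    unfolding t by (cases I) (auto simp: corr_diff_def Let_def allowed_def allowedD [OF assms])
qed

lemma diff_closed: "F \<in> supported_on allowed \<Longrightarrow> diff a b F \<in> supported_on allowed"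
  unfolding diff_def by (intro supported_on_add lead_diff_closed corr_diff_closed)

lemma contraction_closed:
  assumes "F \<in> supported_on allowed"
  shows "contraction a b F \<in> supported_on allowed"
proof (rule supported_onI)
  fix t assume "t \<notin> allowed"
  moreover obtain I i j k where t: "t = (I, i, j, k)"
    by (metis prod_cases4)
  ultimately show "contraction a b F t = 0"
    unfolding t by (cases I) (auto simp: contraction_eqs th_support allowed_def Suc_le_eq allowedD [OF assms])
qed

lemma lead_diff_lead_diff: "lead_diff a b (lead_diff a b F) = 0"
proof (rule idx_eqI)
  fix I i j k
  show "lead_diff a b (lead_diff a b F) (I, i, j, k) = 0 (I, i, j, k)"
    by (cases I; simp add: lead_diff_eqs algebra_simps)
qed

lemma contraction_contraction: "contraction a b (contraction a b F) = 0"
proof (rule idx_eqI)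
  fix I i j k
  show "contraction a b (contraction a b F) (I, i, j, k) = 0 (I, i, j, k)"
    by (cases I; simp add: contraction_eqs algebra_simps)
qed

lemma diff_eqs:
  "diff a b F (B0, i, j, k) = 0"
  "diff a b F (B1, i, j, k) = dV1 a b i j k * F (B0, i, j, k)
     + (if k < 2 then 0 else real j * F (B0, Suc i, Suc j, k - 2))"
  "diff a b F (B2, i, j, k) = dV2 a b i j k * F (B0, i, j, k)
     - (if k < 2 then 0 else real i * F (B0, Suc i, Suc j, k - 2))"
  "diff a b F (B3, i, j, k) = dV3 a b i j k * F (B0, i, j, k)"
  "diff a b F (B12, i, j, k) = dV1 a b i j k * F (B2, i, j, k) - dV2 a b i j k * F (B1, i, j, k)
     + (if k < 2 then 0 else (real i + 1) * F (B1, Suc i, Suc j, k - 2)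
          + (real j + 1) * F (B2, Suc i, Suc j, k - 2) - 2 * F (B3, Suc i, Suc j, k - 2))"
  "diff a b F (B13, i, j, k) = dV1 a b i j k * F (B3, i, j, k) - dV3 a b i j k * F (B1, i, j, k)
     + (if k < 2 then 0 else real j * F (B3, Suc i, Suc j, k - 2))"
  "diff a b F (B23, i, j, k) = dV2 a b i j k * F (B3, i, j, k) - dV3 a b i j k * F (B2, i, j, k)
     - (if k < 2 then 0 else real i * F (B3, Suc i, Suc j, k - 2))"
  "diff a b F (B123, i, j, k) = dV1 a b i j k * F (B23, i, j, k) - dV2 a b i j k * F (B13, i, j, k)
     + dV3 a b i j k * F (B12, i, j, k)
     + (if k < 2 then 0 else (real i + 1) * F (B13, Suc i, Suc j, k - 2)
          + (real j + 1) * F (B23, Suc i, Suc j, k - 2))"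
  by (simp_all add: diff_def lead_diff_eqs corr_diff_def Let_def algebra_simps)

lemma diff_diff: "diff a b (diff a b F) = 0"
proof
  fix t :: idx
  obtain I i j k where t: "t = (I, i, j, k)"
    by (metis prod_cases4)
  consider "k < 2" | "2 \<le> k" "k < 4" | k' where "k = k' + 4"
    by (metis le_add_diff_inverse2 not_less)
  then have "diff a b (diff a b F) (I, i, j, k) = 0 (I, i, j, k)"
  proof cases
    case 1
    then show ?thesis
      by (cases I; simp add: diff_eqs algebra_simps)
  next
    case 2
    then show ?thesis
      by (cases I; simp add: diff_eqs dV1_def dV2_def dV3_def of_nat_diff; simp add: algebra_simps)
  next
    case 3
    then have "\<not> k < 2" "\<not> k - 2 < 2" "k - 2 - 2 = k'" "real (k - 2) = real k' + 2" "real k = real k' + 4"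
      by simp_all
    then show ?thesis
      by (cases I; simp add: diff_eqs dV1_def dV2_def dV3_def; simp add: algebra_simps)
  qed
  then show "diff a b (diff a b F) t = 0 t"
    unfolding t .
qed

text \<open>Exterior product with v and contraction with \<theta> anticommute to the scalar
  \<theta>(v), which is 1 off the harmonic monomials and 0 on them.\<close>

lemma homotopy_formula:
  assumes F: "F \<in> supported_on allowed"
  shows "(\<lambda>t. if t \<in> harm a b then F t else 0) + lead_diff a b (contraction a b F) + contraction a b (lead_diff a b F) = F"
proof (rule idx_eqI)
  fix I i j k
  let ?c = "if harm_at a b i j k then 0 else 1 :: real"
  have "lead_diff a b (contraction a b F) (I, i, j, k) + contraction a b (lead_diff a b F) (I, i, j, k) = ?c * F (I, i, j, k)"
    unfolding th_dual [symmetric] by (cases I; simp add: lead_diff_eqs contraction_eqs; simp add: algebra_simps)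
  moreover have "(if (I, i, j, k) \<in> harm a b then F (I, i, j, k) else 0) = (1 - ?c) * F (I, i, j, k)"
    using supported_onD [OF F, of "(I, i, j, k)"] by (auto simp: harm_def)
  ultimately show "((\<lambda>t. if t \<in> harm a b then F t else 0) + lead_diff a b (contraction a b F) + contraction a b (lead_diff a b F)) (I, i, j, k) = F (I, i, j, k)"
    by (simp add: algebra_simps)
qed

text \<open>A term with factor v_l comes from a component without Y_l. If v_l is nonzero, the
  exponent of x_l is 0 and such a component is not allowed.\<close>

lemma harm_at_lead_diff:
  assumes "F \<in> supported_on allowed" "harm_at a b i j k"
  shows "lead_diff a b F (I, i, j, k) = 0"
proof -
  have "i = 0 \<or> dV1 a b i j k = 0" "j = 0 \<or> dV2 a b i j k = 0" "k = 0 \<or> dV3 a b i j k = 0"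
    using assms(2) by (auto simp: harm_at_def)
  then have z1: "dV1 a b i j k * F (J, i, j, k) = 0" if "o1 J = 1" for J
    using allowedD(1) [OF assms(1), of i J] that by auto
  have z2: "dV2 a b i j k * F (J, i, j, k) = 0" if "o2 J = 1" for J
    using allowedD(2) [OF assms(1), of j J] that \<open>j = 0 \<or> dV2 a b i j k = 0\<close> by auto
  have z3: "dV3 a b i j k * F (J, i, j, k) = 0" if "o3 J = 1" for J
    using allowedD(3) [OF assms(1), of k J] that \<open>k = 0 \<or> dV3 a b i j k = 0\<close> by auto
  show ?thesis
    by (cases I) (simp_all add: lead_diff_eqs z1 z2 z3 del: mult_eq_0_iff)
qed

lemma harm_at_contraction: "harm_at a b i j k \<Longrightarrow> contraction a b F (I, i, j, k) = 0"
  by (cases I) (simp_all add: contraction_eqs th_harm)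

lemma harm_zero:
  assumes "F \<in> supported_on allowed" "t \<in> harm a b"
  shows "lead_diff a b F t = 0" "contraction a b F t = 0"
  using assms harm_at_lead_diff harm_at_contraction by (auto simp: harm_def)

lemma harm_supported:
  assumes F: "F \<in> supported_on (harm a b)"
  shows "lead_diff a b F = 0" "contraction a b F = 0"
proof -
  have *: "F \<in> supported_on allowed"
    using F by (auto simp: supported_on_def harm_def)
  have 0: "F (J, i, j, k) = 0" if "\<not> harm_at a b i j k" for J i j k
    using F that by (auto simp: supported_on_def harm_def)
  show "lead_diff a b F = 0"
  proof (rule idx_eqI)
    fix I i j k
    show "lead_diff a b F (I, i, j, k) = 0 (I, i, j, k)"
    proof (cases "harm_at a b i j k")
      case False
      then show ?thesis
        by (cases I) (simp_all add: lead_diff_eqs 0)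
    qed (simp add: harm_at_lead_diff [OF *])
  qed
  show "contraction a b F = 0"
  proof (rule idx_eqI)
    fix I i j k
    show "contraction a b F (I, i, j, k) = 0 (I, i, j, k)"
    proof (cases "harm_at a b i j k")
      case False
      then show ?thesis
        by (cases I) (simp_all add: contraction_eqs 0)
    qed (simp add: harm_at_contraction)
  qed
qed

text \<open>The exponent of z grows by two, hence \<open>flev\<close> by at least 4 - 1, so the
  half-step refinement cannot undo the gain.\<close>

lemma corr_leading:
  assumes "vanish_below flev p F"
  shows "vanish_below flev (Suc p) (diff a b (contraction a b F) - lead_diff a b (contraction a b F))"
proof -
  have F: "F (J, i, j, k) = 0" if "2 * k + 1 < p" for J i j k
    using assms that by (auto simp: vanish_below_def flev_def)
  have "corr_diff (contraction a b F) (I, i, j, k) = 0" if "flev (I, i, j, k) < Suc p" for I i j k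
  proof (cases "k < 2")
    case False
    have "2 * (k - 2) + 1 < p"
      using that False by (auto simp: flev_def split: if_splits)
    then show ?thesis
      by (cases I) (auto simp: corr_diff_def contraction_eqs F)
  qed (cases I; simp add: corr_diff_def)
  then show ?thesis
    by (auto simp: vanish_below_def diff_def)
qed

lemma finite_cdeg: "finite {t \<in> allowed. cdeg t = n}"
proof (rule finite_subset)
  show "{t \<in> allowed. cdeg t = n} \<subseteq> {B0, B1, B2, B3, B12, B13, B23, B123} \<times> {..n} \<times> {..n} \<times> {..n}"
  proof
    fix t assume "t \<in> {t \<in> allowed. cdeg t = n}"
    moreover obtain I i j k where t: "t = (I, i, j, k)"
      by (metis prod_cases4)
    ultimately show "t \<in> {B0, B1, B2, B3, B12, B13, B23, B123} \<times> {..n} \<times> {..n} \<times> {..n}"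
      by (cases I) (auto simp: cdeg_def)
  qed
qed simp

text \<open>If i and j are both positive, the conditions on v_1 and v_2 force i = j. If exactly one
  of them is zero, v_3 is nonzero, so k = 0, and the remaining condition reads a = b.\<close>

lemma harm_cases:
  assumes a: "a \<noteq> 0" and b: "b \<noteq> 0"
  shows "(I, i, j, k) \<in> harm a b \<longleftrightarrow> (I, i, j, k) \<in> allowed \<and>
    ((0 < i \<and> i = j \<and> b * (real i - 1) = a * (real k - 1)) \<or> (i = 0 \<and> j = 0) \<or>
     (a = b \<and> k = 0 \<and> (i = 0 \<or> j = 0)))"
proof -
  have v3: "dV3 a b i j k = 0 \<longleftrightarrow> i = j"
    using a by (auto simp: dV3_def)
  have v: "dV1 a b i j k = 0 \<longleftrightarrow> b * (real j - 1) = a * (real k - 1)"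
    "dV2 a b i j k = 0 \<longleftrightarrow> b * (real i - 1) = a * (real k - 1)"
    by (auto simp: dV1_def dV2_def)
  have ij: "i = j" if "b * (real j - 1) = c" "b * (real i - 1) = c" for c
    using that b by (metis diff_add_cancel mult_left_cancel of_nat_eq_iff)
  show ?thesis
    unfolding harm_def harm_at_def mem_Collect_eq prod.case v v3
  proof (cases "i = 0 \<or> j = 0")
    case True
    then show "((I, i, j, k) \<in> allowed \<and> (i = 0 \<or> b * (real j - 1) = a * (real k - 1)) \<and>
       (j = 0 \<or> b * (real i - 1) = a * (real k - 1)) \<and> (k = 0 \<or> i = j)) =
      ((I, i, j, k) \<in> allowed \<and> (0 < i \<and> i = j \<and> b * (real i - 1) = a * (real k - 1) \<or>
       i = 0 \<and> j = 0 \<or> a = b \<and> k = 0 \<and> (i = 0 \<or> j = 0)))"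
      by (cases "i = 0"; cases "j = 0"; cases "k = 0") auto
  next
    case False
    then show "((I, i, j, k) \<in> allowed \<and> (i = 0 \<or> b * (real j - 1) = a * (real k - 1)) \<and>
       (j = 0 \<or> b * (real i - 1) = a * (real k - 1)) \<and> (k = 0 \<or> i = j)) =
      ((I, i, j, k) \<in> allowed \<and> (0 < i \<and> i = j \<and> b * (real i - 1) = a * (real k - 1) \<or>
       i = 0 \<and> j = 0 \<or> a = b \<and> k = 0 \<and> (i = 0 \<or> j = 0)))"
      using ij by blast
  qed
qed

section \<open>Cochains with harmonic leading term\<close>

text \<open>With \<kappa> = 1 / (2a + b) and b n = a m these are Casimirs of \<open>Lambda4\<close>;
  with \<kappa> = 0 they are the Casimirs of its leading part.\<close>

definition cas :: "real \<Rightarrow> nat \<Rightarrow> nat \<Rightarrow> series" where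
  "cas \<kappa> n m = (vx * vy + cst \<kappa> * vz ^ 2) ^ n * vz ^ m"

lemma monomial_nth:
  "(vx ^ p * vy ^ q * vz ^ r) $ i $ j $ k = (if i = p \<and> j = q \<and> k = r then 1 else 0)"
proof -
  have z: "(vz ^ r) $ i $ j $ k = (if i = 0 \<and> j = 0 \<and> k = r then 1 else 0)" for i j k
  proof (induction r arbitrary: i j k)
    case 0
    then show ?case
      using cst_nth [of 1 i j k] by (simp add: cst_simps)
  next
    case (Suc r)
    then show ?case
      unfolding power_Suc vars_mult_nth by auto
  qed
  have yz: "(vy ^ q * vz ^ r) $ i $ j $ k = (if i = 0 \<and> j = q \<and> k = r then 1 else 0)" for i j k
  proof (induction q arbitrary: i j k)
    case 0
    then show ?case
      by (simp add: z)
  next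
    case (Suc q)
    then show ?case
      unfolding power_Suc mult.assoc vars_mult_nth by (cases j) (simp_all del: fps_mult_nth_0)
  qed
  show ?thesis
  proof (induction p arbitrary: i j k)
    case 0
    then show ?case
      by (simp add: yz)
  next
    case (Suc p)
    then show ?case
      unfolding power_Suc mult.assoc vars_mult_nth by (cases i) (simp_all del: fps_mult_nth_0)
  qed
qed

lemma cas_nth:
  "cas \<kappa> n m $ i $ j $ k =
     (if i = j \<and> i \<le> n \<and> k = m + 2 * (n - i) then real (n choose i) * \<kappa> ^ (n - i) else 0)"
proof -
  have term_eq: "of_nat (n choose l) * (vx * vy) ^ l * (cst \<kappa> * vz ^ 2) ^ (n - l) * vz ^ m =
      cst (real (n choose l) * \<kappa> ^ (n - l)) * (vx ^ l * vy ^ l * vz ^ (m + 2 * (n - l)))" for l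
  proof -
    have "vz ^ (m + 2 * (n - l)) = vz ^ m * (vz ^ 2) ^ (n - l)"
      by (simp only: power_add power_mult)
    then show ?thesis
      by (simp only: cst_simps cst_of_nat power_mult_distrib ac_simps)
  qed
  have "cas \<kappa> n m = (\<Sum>l\<le>n. cst (real (n choose l) * \<kappa> ^ (n - l)) * (vx ^ l * vy ^ l * vz ^ (m + 2 * (n - l))))"
    unfolding cas_def binomial_ring sum_distrib_right term_eq ..
  then have "cas \<kappa> n m $ i $ j $ k =
      (\<Sum>l\<le>n. real (n choose l) * \<kappa> ^ (n - l) * (if i = l \<and> j = l \<and> k = m + 2 * (n - l) then 1 else 0))"
    by (simp only: fps_sum_nth cst_mult_nth monomial_nth)
  also have "\<dots> = (\<Sum>l\<le>n. if l = i then (if i = j \<and> k = m + 2 * (n - i) then real (n choose i) * \<kappa> ^ (n - i) else 0) else 0)"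
    by (rule sum.cong) auto
  also have "\<dots> = (if i = j \<and> i \<le> n \<and> k = m + 2 * (n - i) then real (n choose i) * \<kappa> ^ (n - i) else 0)"
    by simp
  finally show ?thesis .
qed

section \<open>Functions whose Hamiltonian field is a multiple of Y_1 - Y_2\<close>

lemmas zero_one_simps = mult_zero_left mult_zero_right mult_1_left mult_1_right add_0_left add_0_right
  diff_zero diff_0 minus_zero add_0

text \<open>
  \<open>good a b f c\<close>: the Hamiltonian field \<open>[Lambda4, f]\<close> is \<open>c f (Y\<^sub>1 - Y\<^sub>2)\<close>. The function \<open>z\<close> satisfies
  it with \<open>c = - a\<close>, and \<open>xy + z\<^sup>2 / (2a + b)\<close> with \<open>c = b\<close>.
\<close>

definition good :: "real \<Rightarrow> real \<Rightarrow> series \<Rightarrow> real \<Rightarrow> bool" where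
  "good a b f c \<longleftrightarrow>
     vx * partial_deriv 1 f = vy * partial_deriv 2 f \<and>
     (cst b * vx * vy + vz * vz) * partial_deriv 2 f - cst a * vx * vz * partial_deriv 3 f = cst c * vx * f \<and>
     (cst b * vx * vy + vz * vz) * partial_deriv 1 f - cst a * vy * vz * partial_deriv 3 f = cst c * vy * f"

lemma good_one: "good a b 1 0"
  by (simp add: good_def cst_simps)

text \<open>The Hamiltonian field is a derivation in the function, so the factors \<open>c\<close>
  add up like logarithmic derivatives.\<close>

lemma good_mult: "good a b f c \<Longrightarrow> good a b g c' \<Longrightarrow> good a b (f * g) (c + c')"
proof -
  assume f: "good a b f c" and g: "good a b g c'"
  let ?L = "cst b * vx * vy + vz * vz"
  have "vx * partial_deriv 1 (f * g) = vy * partial_deriv 2 (f * g)"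
    using f g unfolding good_def partial_deriv_mult by algebra
  moreover have "?L * partial_deriv 2 (f * g) - cst a * vx * vz * partial_deriv 3 (f * g) = cst (c + c') * vx * (f * g)"
    using f g unfolding good_def partial_deriv_mult cst_simps by algebra
  moreover have "?L * partial_deriv 1 (f * g) - cst a * vy * vz * partial_deriv 3 (f * g) = cst (c + c') * vy * (f * g)"
    using f g unfolding good_def partial_deriv_mult cst_simps by algebra
  ultimately show ?thesis
    by (simp add: good_def)
qed

lemma good_power: "good a b f c \<Longrightarrow> good a b (f ^ n) (real n * c)"
proof (induction n)
  case (Suc n)
  then show ?case
    using good_mult [of a b f c "f ^ n" "real n * c"] by (simp add: algebra_simps)
qed (simp add: good_one)

lemma good_vz: "good a b vz (- a)"
  unfolding good_def partial_deriv_vars cst_simps by (intro conjI; algebra)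

lemma good_w:
  assumes "\<kappa> * (2 * a + b) = 1"
  shows "good a b (vx * vy + cst \<kappa> * vz ^ 2) b"
proof -
  have k: "cst \<kappa> * (2 * cst a + cst b) = 1"
    using arg_cong [OF assms, of cst] by (simp add: cst_simps cst_numeral)
  let ?w = "vx * vy + cst \<kappa> * vz ^ 2" and ?L = "cst b * vx * vy + vz * vz"
  have D: "partial_deriv 1 ?w = vy" "partial_deriv 2 ?w = vx" "partial_deriv 3 ?w = cst \<kappa> * (2 * vz)"
    unfolding power2_eq_square partial_deriv_simps partial_deriv_cst partial_deriv_vars by simp_all
  \<comment> \<open>The defect is a multiple of 1 - \<kappa> (2a + b), which is the origin of the
    constant 1 / (2a + b).\<close>
  have "?L * vx - cst a * vx * vz * (cst \<kappa> * (2 * vz)) - cst b * vx * ?w =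
      vx * (vz * vz) * (1 - cst \<kappa> * (2 * cst a + cst b))"
    by (simp add: power2_eq_square algebra_simps)
  moreover have "?L * vy - cst a * vy * vz * (cst \<kappa> * (2 * vz)) - cst b * vy * ?w =
      vy * (vz * vz) * (1 - cst \<kappa> * (2 * cst a + cst b))"
    by (simp add: power2_eq_square algebra_simps)
  ultimately show ?thesis
    unfolding good_def D k by (simp add: mult.commute)
qed

lemma good_cas:
  assumes "n = 0 \<or> \<kappa> * (2 * a + b) = 1"
  shows "good a b (cas \<kappa> n m) (b * real n - a * real m)"
proof -
  have "good a b ((vx * vy + cst \<kappa> * vz ^ 2) ^ n) (real n * b)"
    using assms good_power [OF good_w] good_one by auto
  from good_mult [OF this good_power [OF good_vz, of a b m]] show ?thesis
    by (simp add: cas_def algebra_simps)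
qed

definition pv :: "(bas \<Rightarrow> series) \<Rightarrow> polyvec" where
  "pv f I = (if \<exists>b. I = st b then f (THE b. I = st b) else 0)"

lemma pv_st [simp]: "pv f (st b) = f b"
proof -
  have "(THE c. st b = st c) = b"
    by (auto simp: st_inject)
  then show ?thesis
    by (auto simp: pv_def)
qed

lemma pv_polyvecs: "pv f \<in> polyvecs"
proof -
  have "pv f I = 0" if "\<not> I \<subseteq> {1, 2, 3}" for I
    using that unfolding pv_def subset_123 by (rule if_not_P)
  then show ?thesis
    unfolding polyvecs_def mem_Collect_eq by iprover
qed

lemma mult_left_cancel_vy: "vy * f = vy * g \<Longrightarrow> f = g"
  by (simp add: vy_def)

lemmas sch_simps = schouten_st pv_st bas.case partial_deriv_zero partial_deriv_simps partial_deriv_vars partial_deriv_cst zero_one_simps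

section \<open>Differentials of the explicit cochains\<close>

context
  fixes a b :: real
begin

lemma sch_cas0:
  assumes "good a b f 0"
  shows "schouten (Lambda4 a b) (pv (\<lambda>J. case J of B0 \<Rightarrow> f | _ \<Rightarrow> 0)) (st I) = 0"
proof -
  have B1: "schouten (Lambda4 a b) (pv (\<lambda>J. case J of B0 \<Rightarrow> f | _ \<Rightarrow> 0)) (st B1) = 0"
    by (simp only: sch_simps) (use assms [unfolded good_def cst_simps] in algebra)
  have B2: "schouten (Lambda4 a b) (pv (\<lambda>J. case J of B0 \<Rightarrow> f | _ \<Rightarrow> 0)) (st B2) = 0"
    by (simp only: sch_simps) (use assms [unfolded good_def cst_simps] in algebra)
  have B3: "schouten (Lambda4 a b) (pv (\<lambda>J. case J of B0 \<Rightarrow> f | _ \<Rightarrow> 0)) (st B3) = 0"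
    by (simp only: sch_simps) (use assms [unfolded good_def cst_simps] in algebra)
  show ?thesis
    by (cases I; simp only: B1 B2 B3; simp only: sch_simps)
qed

text \<open>All Y_l preserve the leading part. Under Y_1 + Y_3 / 2 the weight -1 of
  \<open>\<partial>\<^sub>1\<close> cancels half the weight 2 of z^2, so z^2
  \<open>\<partial>\<^sub>1\<^sub>2\<close> is preserved too, and the field may be multiplied by a
  Casimir.\<close>

lemma sch_cas1:
  assumes "good a b f 0"
  shows "schouten (Lambda4 a b) (pv (\<lambda>J. case J of B1 \<Rightarrow> vx * f | B3 \<Rightarrow> cst (1/2) * vz * f | _ \<Rightarrow> 0)) (st I) = 0"
proof -
  have h: "2 * cst (1/2) = 1"
    using cst_simps(4) [of 2 "1/2"] by (simp add: cst_simps cst_numeral)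
  have B12: "schouten (Lambda4 a b) (pv (\<lambda>J. case J of B1 \<Rightarrow> vx * f | B3 \<Rightarrow> cst (1/2) * vz * f | _ \<Rightarrow> 0)) (st B12) = 0"
    by (simp only: sch_simps) (use h assms [unfolded good_def cst_simps] in algebra)
  have B13: "schouten (Lambda4 a b) (pv (\<lambda>J. case J of B1 \<Rightarrow> vx * f | B3 \<Rightarrow> cst (1/2) * vz * f | _ \<Rightarrow> 0)) (st B13) = 0"
    by (simp only: sch_simps) (use h assms [unfolded good_def cst_simps] in algebra)
  have B23: "schouten (Lambda4 a b) (pv (\<lambda>J. case J of B1 \<Rightarrow> vx * f | B3 \<Rightarrow> cst (1/2) * vz * f | _ \<Rightarrow> 0)) (st B23) = 0"
    by (simp only: sch_simps) (use h assms [unfolded good_def cst_simps] in algebra)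
  show ?thesis
    by (cases I; simp only: B12 B13 B23; simp only: sch_simps)
qed

lemma sch_cas2:
  assumes "good a b f 0"
  shows "schouten (Lambda4 a b) (pv (\<lambda>J. case J of B2 \<Rightarrow> vy * f | B3 \<Rightarrow> cst (1/2) * vz * f | _ \<Rightarrow> 0)) (st I) = 0"
proof -
  have h: "2 * cst (1/2) = 1"
    using cst_simps(4) [of 2 "1/2"] by (simp add: cst_simps cst_numeral)
  have B12: "schouten (Lambda4 a b) (pv (\<lambda>J. case J of B2 \<Rightarrow> vy * f | B3 \<Rightarrow> cst (1/2) * vz * f | _ \<Rightarrow> 0)) (st B12) = 0"
    by (simp only: sch_simps) (use h assms [unfolded good_def cst_simps] in algebra)
  have B13: "schouten (Lambda4 a b) (pv (\<lambda>J. case J of B2 \<Rightarrow> vy * f | B3 \<Rightarrow> cst (1/2) * vz * f | _ \<Rightarrow> 0)) (st B13) = 0"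
    by (simp only: sch_simps) (use h assms [unfolded good_def cst_simps] in algebra)
  have B23: "schouten (Lambda4 a b) (pv (\<lambda>J. case J of B2 \<Rightarrow> vy * f | B3 \<Rightarrow> cst (1/2) * vz * f | _ \<Rightarrow> 0)) (st B23) = 0"
    by (simp only: sch_simps) (use h assms [unfolded good_def cst_simps] in algebra)
  show ?thesis
    by (cases I; simp only: B12 B13 B23; simp only: sch_simps)
qed

text \<open>All terms cancel except a multiple of y f_y - x f_x. Therefore the Casimirs of the
  leading part serve uncorrected as coefficients of these bivector fields.\<close>

lemma sch_23:
  assumes "vx * partial_deriv 1 f = vy * partial_deriv 2 f"
  shows "schouten (Lambda4 a b) (pv (\<lambda>J. case J of B23 \<Rightarrow> vy * f | B13 \<Rightarrow> - (vx * f) | _ \<Rightarrow> 0)) (st I) = 0"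
proof -
  have B123: "schouten (Lambda4 a b) (pv (\<lambda>J. case J of B23 \<Rightarrow> vy * f | B13 \<Rightarrow> - (vx * f) | _ \<Rightarrow> 0)) (st B123) = 0"
    by (simp only: sch_simps) (use assms in algebra)
  show ?thesis
    by (cases I; simp only: B123; simp only: sch_simps)
qed

lemma sch_12:
  assumes "vx * partial_deriv 1 f = vy * partial_deriv 2 f"
  shows "schouten (Lambda4 a b) (pv (\<lambda>J. case J of B12 \<Rightarrow> f | _ \<Rightarrow> 0)) (st I) = 0"
proof -
  have B123: "schouten (Lambda4 a b) (pv (\<lambda>J. case J of B12 \<Rightarrow> f | _ \<Rightarrow> 0)) (st B123) = 0"
    by (simp only: sch_simps) (use assms in algebra)
  show ?thesis
    by (cases I; simp only: B123; simp only: sch_simps)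
qed

text \<open>\<open>p\<close> is known through \<open>vy * p\<close>, so both identities are checked
  after multiplication by y, which can be cancelled. In the application f = w^n z^k, c = \<kappa>^n
  and q is the power of z that makes z f - c q divisible by xy.\<close>

lemma sch_3_aux:
  assumes f: "good a b f (- a)" and g: "vy * p = - (2 * cst \<kappa> * (vz * f - cst c * q))"
    and q: "good a b q (- d)" and \<kappa>: "\<kappa> * (2 * a + b) = 1"
  shows "(cst b * vx * vy + vz * vz) * partial_deriv 1 p - cst a * vy * vz * partial_deriv 3 p - cst b * vy * p =
      2 * vz * f - cst (2 * \<kappa> * c * (d + b)) * q" (is ?A)
    and "cst a * vy * vz * partial_deriv 2 p - cst a * vx * vz * partial_deriv 1 p + cst a * vz * p = 0" (is ?B)
proof -
  let ?k = "cst \<kappa>" and ?c = "cst c" and ?L = "cst b * vx * vy + vz * vz"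
  have k: "?k * (2 * cst a + cst b) = 1"
    using arg_cong [OF \<kappa>, of cst] by (simp add: cst_simps cst_numeral)
  have two: "partial_deriv l 2 = 0" for l
    using partial_deriv_cst [of l 2] by (simp add: cst_numeral)
  have D: "partial_deriv l vy * p + vy * partial_deriv l p =
      - (2 * ?k * (partial_deriv l vz * f + vz * partial_deriv l f - ?c * partial_deriv l q))" for l
    using arg_cong [OF g, of "partial_deriv l"]
    by (simp only: partial_deriv_simps partial_deriv_cst two zero_one_simps)
  have P1: "vy * partial_deriv 1 p = - (2 * ?k * (vz * partial_deriv 1 f - ?c * partial_deriv 1 q))"
    using D [of 1] by (simp only: partial_deriv_vars zero_one_simps)
  have P2: "p + vy * partial_deriv 2 p = - (2 * ?k * (vz * partial_deriv 2 f - ?c * partial_deriv 2 q))"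
    using D [of 2] by (simp only: partial_deriv_vars zero_one_simps)
  have P3: "vy * partial_deriv 3 p = - (2 * ?k * (f + vz * partial_deriv 3 f - ?c * partial_deriv 3 q))"
    using D [of 3] by (simp only: partial_deriv_vars zero_one_simps)
  note F = f [unfolded good_def cst_simps] and Q = q [unfolded good_def cst_simps]
  show ?B
  proof (rule mult_left_cancel_vy)
    show "vy * (cst a * vy * vz * partial_deriv 2 p - cst a * vx * vz * partial_deriv 1 p + cst a * vz * p) = vy * 0"
      using F Q g P1 P2 by algebra
  qed
  show ?A
  proof (rule mult_left_cancel_vy)
    have "vy * (?L * partial_deriv 1 p - cst a * vy * vz * partial_deriv 3 p - cst b * vy * p) =
        ?L * (vy * partial_deriv 1 p) - cst a * vy * vz * (vy * partial_deriv 3 p) - cst b * vy * (vy * p)"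
      by (simp only: right_diff_distrib ac_simps)
    also have "\<dots> = - (2 * ?k * (vz * (?L * partial_deriv 1 f - cst a * vy * vz * partial_deriv 3 f)
        - ?c * (?L * partial_deriv 1 q - cst a * vy * vz * partial_deriv 3 q)
        - cst a * vy * vz * f - cst b * vy * (vz * f - ?c * q)))"
      unfolding P1 P3 g by algebra
    also have "\<dots> = 2 * (?k * (2 * cst a + cst b)) * vy * vz * f - 2 * ?k * ?c * (cst d + cst b) * vy * q"
      using F Q by algebra
    also have "\<dots> = vy * (2 * vz * f - cst (2 * \<kappa> * c * (d + b)) * q)"
      unfolding k cst_simps cst_numeral by algebra
    finally show "vy * (?L * partial_deriv 1 p - cst a * vy * vz * partial_deriv 3 p - cst b * vy * p) =
        vy * (2 * vz * f - cst (2 * \<kappa> * c * (d + b)) * q)" .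
  qed
qed

text \<open>The field is p \<open>\<partial>\<^sub>1\<close> + f \<open>\<partial>\<^sub>3\<close>.
  Its third component contributes -2 z f by differentiating z^2, and the first is chosen to
  compensate this up to \<open>r\<close>.\<close>

lemma sch_3:
  assumes f: "good a b f (- a)"
    and E: "(cst b * vx * vy + vz * vz) * partial_deriv 1 p - cst a * vy * vz * partial_deriv 3 p - cst b * vy * p =
      2 * vz * f + r"
    and E': "cst a * vy * vz * partial_deriv 2 p - cst a * vx * vz * partial_deriv 1 p + cst a * vz * p = 0"
  shows "schouten (Lambda4 a b) (pv (\<lambda>J. case J of B1 \<Rightarrow> p | B3 \<Rightarrow> f | _ \<Rightarrow> 0)) (st I) =
      (case I of B12 \<Rightarrow> r | _ \<Rightarrow> 0)"
proof -
  note F = f [unfolded good_def cst_simps]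
  let ?P = "pv (\<lambda>J. case J of B1 \<Rightarrow> p | B3 \<Rightarrow> f | _ \<Rightarrow> 0)"
  have B12: "schouten (Lambda4 a b) ?P (st B12) = r"
    by (simp only: sch_simps) (use E in algebra)
  have B13: "schouten (Lambda4 a b) ?P (st B13) = 0"
    by (simp only: sch_simps) (use E' F in algebra)
  have B23: "schouten (Lambda4 a b) ?P (st B23) = 0"
    by (simp only: sch_simps) (use F in algebra)
  show ?thesis
    by (cases I; simp only: B12 B13 B23 bas.case; simp only: sch_simps)
qed

text \<open>This bivector field is (Y_1 + Y_3 / 2) wedged with p \<open>\<partial>\<^sub>1\<close> +
  f \<open>\<partial>\<^sub>3\<close>. The first factor is a cocycle, so the differential is minus
  the first factor wedged with r \<open>\<partial>\<^sub>1\<^sub>2\<close>, which explains -z r /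
  2.\<close>

lemma sch_13:
  assumes f: "good a b f (- a)"
    and E: "(cst b * vx * vy + vz * vz) * partial_deriv 1 p - cst a * vy * vz * partial_deriv 3 p - cst b * vy * p =
      2 * vz * f + r"
  shows "schouten (Lambda4 a b) (pv (\<lambda>J. case J of B13 \<Rightarrow> vx * f - cst (1/2) * vz * p | _ \<Rightarrow> 0)) (st I) =
      (case I of B123 \<Rightarrow> - (cst (1/2) * vz * r) | _ \<Rightarrow> 0)"
proof -
  have h: "2 * cst (1/2) = 1"
    using cst_simps(4) [of 2 "1/2"] by (simp add: cst_simps cst_numeral)
  note F = f [unfolded good_def cst_simps]
  let ?P = "pv (\<lambda>J. case J of B13 \<Rightarrow> vx * f - cst (1/2) * vz * p | _ \<Rightarrow> 0)"
  have B123: "schouten (Lambda4 a b) ?P (st B123) = - (cst (1/2) * vz * r)"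
    by (simp only: sch_simps) (use E F h in algebra)
  show ?thesis
    by (cases I; simp only: B123 bas.case; simp only: sch_simps)
qed

lemma sch_123: "schouten (Lambda4 a b) (pv (\<lambda>J. case J of B123 \<Rightarrow> f | _ \<Rightarrow> 0)) (st I) = 0"
  by (cases I; simp only: sch_simps)

lemma sch_13_equal:
  assumes "a = b" "partial_deriv 1 f = 0" "partial_deriv 3 f = 0"
  shows "schouten (Lambda4 a b) (pv (\<lambda>J. case J of B13 \<Rightarrow> f | _ \<Rightarrow> 0)) (st I) = 0"
  by (cases I; simp only: sch_simps assms diff_self)

lemma sch_23_equal:
  assumes "a = b" "partial_deriv 2 f = 0" "partial_deriv 3 f = 0"
  shows "schouten (Lambda4 a b) (pv (\<lambda>J. case J of B23 \<Rightarrow> f | _ \<Rightarrow> 0)) (st I) = 0"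
  by (cases I; simp only: sch_simps assms diff_self)

end

lemma cas_nz:
  assumes "cas \<kappa> n m $ i $ j $ k \<noteq> 0"
  shows "i = j \<and> i \<le> n \<and> k = m + 2 * (n - i)"
  using assms unfolding cas_nth by (auto split: if_splits)

text \<open>
  With \<open>w = xy + \<kappa> z\<^sup>2\<close>, \<open>tail\<close> is \<open>- 2 \<kappa> x z\<^bsup>p+1\<^esup> (w\<^sup>n - (\<kappa> z\<^sup>2)\<^sup>n) / (xy)\<close>. The field
  \<open>w\<^sup>n z\<^sup>p \<partial>\<^sub>3 + tail \<partial>\<^sub>1\<close> solves the recursion that pushes the differential of \<open>w\<^sup>n z\<^sup>p \<partial>\<^sub>3\<close> to
  the highest possible power of \<open>z\<close>.
\<close>

definition tail :: "real \<Rightarrow> nat \<Rightarrow> nat \<Rightarrow> series" where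
  "tail \<kappa> n p = vx * (cst (- 2 * \<kappa>) * (\<Sum>t<n. cst (\<kappa> ^ t) * cas \<kappa> (n - Suc t) (Suc p + 2 * t)))"

lemma tail_nz:
  assumes "tail \<kappa> n p $ i $ j $ k \<noteq> 0"
  shows "i = Suc j \<and> i \<le> n \<and> k = Suc p + 2 * (n - i)"
proof -
  have "0 < i" and nz: "(\<Sum>t<n. cst (\<kappa> ^ t) * cas \<kappa> (n - Suc t) (Suc p + 2 * t)) $ (i - 1) $ j $ k \<noteq> 0"
    using assms by (auto simp: tail_def vars_mult_nth cst_mult_nth simp del: One_nat_def split: if_splits)
  then have "(\<Sum>t<n. (cst (\<kappa> ^ t) * cas \<kappa> (n - Suc t) (Suc p + 2 * t)) $ (i - 1) $ j $ k) \<noteq> 0"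
    by (simp only: fps_sum_nth not_False_eq_True)
  then obtain t where t: "t < n" "(cst (\<kappa> ^ t) * cas \<kappa> (n - Suc t) (Suc p + 2 * t)) $ (i - 1) $ j $ k \<noteq> 0"
    by (meson lessThan_iff sum.not_neutral_contains_not_neutral)
  then have "cas \<kappa> (n - Suc t) (Suc p + 2 * t) $ (i - 1) $ j $ k \<noteq> 0"
    by (simp add: cst_mult_nth)
  from cas_nz [OF this] \<open>0 < i\<close> t(1) show ?thesis
    by auto
qed

text \<open>The sum is geometric: w = xy + \<kappa> z^2 and u = \<kappa> z^2 differ by xy, so w^n -
  u^n is xy times the sum.\<close>

lemma vy_tail: "vy * tail \<kappa> n p = - (2 * cst \<kappa> * (vz * cas \<kappa> n p - cst (\<kappa> ^ n) * vz ^ (p + 1 + 2 * n)))"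
proof -
  let ?w = "vx * vy + cst \<kappa> * vz ^ 2" and ?u = "cst \<kappa> * vz ^ 2"
  have "cst (\<kappa> ^ t) * cas \<kappa> (n - Suc t) (Suc p + 2 * t) = vz ^ Suc p * (?w ^ (n - Suc t) * ?u ^ t)" for t
  proof -
    have "vz ^ (Suc p + 2 * t) = vz ^ Suc p * (vz ^ 2) ^ t"
      by (simp only: power_add power_mult)
    then show ?thesis
      unfolding cas_def by (simp only: cst_simps power_mult_distrib ac_simps)
  qed
  then have "(\<Sum>t<n. cst (\<kappa> ^ t) * cas \<kappa> (n - Suc t) (Suc p + 2 * t)) = vz ^ Suc p * (\<Sum>t<n. ?w ^ (n - Suc t) * ?u ^ t)"
    by (simp only: sum_distrib_left)
  then have "vy * tail \<kappa> n p = cst (- 2 * \<kappa>) * vz ^ Suc p * ((vx * vy) * (\<Sum>t<n. ?w ^ (n - Suc t) * ?u ^ t))"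
    unfolding tail_def by (simp only: ac_simps)
  also have "(vx * vy) * (\<Sum>t<n. ?w ^ (n - Suc t) * ?u ^ t) = ?w ^ n - ?u ^ n"
    using power_diff_sumr2 [of ?u n ?w] by (simp add: algebra_simps)
  also have "?u ^ n = cst (\<kappa> ^ n) * vz ^ (2 * n)"
    by (simp only: cst_simps power_mult_distrib power_mult)
  also have "cst (- 2 * \<kappa>) = - (2 * cst \<kappa>)"
    by (simp add: cst_simps cst_numeral)
  finally show ?thesis
    by (simp add: cas_def power_add algebra_simps)
qed

text \<open>For 2a + b = 0 this is 0 by convention; then only the power n = 0 of w occurs among
  harmonic terms, as \<open>kap_main\<close> shows.\<close>

definition kap :: "real \<Rightarrow> real \<Rightarrow> real" where
  "kap a b = 1 / (2 * a + b)"

lemma euler_eqI: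
  assumes "\<And>i j k. f $ i $ j $ k \<noteq> 0 \<Longrightarrow> i = j"
  shows "vx * partial_deriv 1 f = vy * partial_deriv 2 f"
proof (intro fps_ext)
  fix i j k
  have "(vx * partial_deriv 1 f) $ i $ j $ k = real i * f $ i $ j $ k"
    by (cases i) (simp_all add: vars_mult_nth partial_deriv_nth del: fps_mult_nth_0)
  moreover have "(vy * partial_deriv 2 f) $ i $ j $ k = real j * f $ i $ j $ k"
    by (cases j) (simp_all add: vars_mult_nth partial_deriv_nth del: fps_mult_nth_0)
  ultimately show "(vx * partial_deriv 1 f) $ i $ j $ k = (vy * partial_deriv 2 f) $ i $ j $ k"
    using assms [of i j k] by (cases "f $ i $ j $ k = 0") auto
qed

definition mon :: "nat \<Rightarrow> nat \<Rightarrow> nat \<Rightarrow> series" where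
  "mon p q r = vx ^ p * vy ^ q * vz ^ r"

lemma mon_nth: "mon p q r $ i $ j $ k = (if i = p \<and> j = q \<and> k = r then 1 else 0)"
  by (simp only: mon_def monomial_nth)

text \<open>With i and j positive a harmonic index has i = j and stands for D'^(i-1) z^(k-1). In
  components containing 3 the factor z of Y_3 is absorbed, so z^k appears and k = 0 makes sense. The
  branches i = 0 and j = 0 are the monomials that are special to a = b.\<close>

definition elt :: "real \<Rightarrow> real \<Rightarrow> idx \<Rightarrow> polyvec" where
  "elt a b = (\<lambda>(I, i, j, k).
     let f = cas (kap a b) (i - 1) (k - 1); f' = cas (kap a b) (i - 1) k; g = tail (kap a b) (i - 1) k;
       mono = mon (i - o1 I) (j - o2 I) (k - o3 I)
     in case I of
       B0 \<Rightarrow> pv (\<lambda>J. case J of B0 \<Rightarrow> f | _ \<Rightarrow> 0)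
     | B1 \<Rightarrow> pv (\<lambda>J. case J of B1 \<Rightarrow> vx * f | B3 \<Rightarrow> cst (1/2) * vz * f | _ \<Rightarrow> 0)
     | B2 \<Rightarrow> pv (\<lambda>J. case J of B2 \<Rightarrow> vy * f | B3 \<Rightarrow> cst (1/2) * vz * f | _ \<Rightarrow> 0)
     | B3 \<Rightarrow> pv (\<lambda>J. case J of B1 \<Rightarrow> g | B3 \<Rightarrow> f' | _ \<Rightarrow> 0)
     | B12 \<Rightarrow> pv (\<lambda>J. case J of B12 \<Rightarrow> mono | _ \<Rightarrow> 0)
     | B13 \<Rightarrow> if i = 0 then pv (\<lambda>J. case J of B13 \<Rightarrow> mono | _ \<Rightarrow> 0)
         else pv (\<lambda>J. case J of B13 \<Rightarrow> vx * f' - cst (1/2) * vz * g | _ \<Rightarrow> 0)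
     | B23 \<Rightarrow> if j = 0 then pv (\<lambda>J. case J of B23 \<Rightarrow> mono | _ \<Rightarrow> 0)
         else pv (\<lambda>J. case J of B23 \<Rightarrow> vy * cas 0 (i - 1) k | B13 \<Rightarrow> - (vx * cas 0 (i - 1) k) | _ \<Rightarrow> 0)
     | B123 \<Rightarrow> pv (\<lambda>J. case J of B123 \<Rightarrow> mono | _ \<Rightarrow> 0))"

lemma elt_eqs:
  "elt a b (B0, i, j, k) = pv (\<lambda>J. case J of B0 \<Rightarrow> cas (kap a b) (i - 1) (k - 1) | _ \<Rightarrow> 0)"
  "elt a b (B1, i, j, k) = pv (\<lambda>J. case J of B1 \<Rightarrow> vx * cas (kap a b) (i - 1) (k - 1)
     | B3 \<Rightarrow> cst (1/2) * vz * cas (kap a b) (i - 1) (k - 1) | _ \<Rightarrow> 0)"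
  "elt a b (B2, i, j, k) = pv (\<lambda>J. case J of B2 \<Rightarrow> vy * cas (kap a b) (i - 1) (k - 1)
     | B3 \<Rightarrow> cst (1/2) * vz * cas (kap a b) (i - 1) (k - 1) | _ \<Rightarrow> 0)"
  "elt a b (B3, i, j, k) = pv (\<lambda>J. case J of B1 \<Rightarrow> tail (kap a b) (i - 1) k | B3 \<Rightarrow> cas (kap a b) (i - 1) k | _ \<Rightarrow> 0)"
  "elt a b (B12, i, j, k) = pv (\<lambda>J. case J of B12 \<Rightarrow> mon i j (k - 1) | _ \<Rightarrow> 0)"
  "elt a b (B13, 0, j, k) = pv (\<lambda>J. case J of B13 \<Rightarrow> mon 0 (j - 1) k | _ \<Rightarrow> 0)"
  "0 < i \<Longrightarrow> elt a b (B13, i, j, k) = pv (\<lambda>J. case J of B13 \<Rightarrow>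
     vx * cas (kap a b) (i - 1) k - cst (1/2) * vz * tail (kap a b) (i - 1) k | _ \<Rightarrow> 0)"
  "elt a b (B23, i, 0, k) = pv (\<lambda>J. case J of B23 \<Rightarrow> mon (i - 1) 0 k | _ \<Rightarrow> 0)"
  "0 < j \<Longrightarrow> elt a b (B23, i, j, k) = pv (\<lambda>J. case J of B23 \<Rightarrow> vy * cas 0 (i - 1) k
     | B13 \<Rightarrow> - (vx * cas 0 (i - 1) k) | _ \<Rightarrow> 0)"
  "elt a b (B123, i, j, k) = pv (\<lambda>J. case J of B123 \<Rightarrow> mon i j k | _ \<Rightarrow> 0)"
  by (simp_all add: elt_def Let_def del: One_nat_def)

lemma co_supported: "co P \<in> supported_on allowed"
proof (rule supported_onI)
  fix t assume "t \<notin> allowed"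
  then show "co P t = 0"
    by (cases t rule: prod_cases4) (simp add: co_coeff)
qed

lemma elt_polyvecs: "elt a b t \<in> polyvecs"
proof -
  obtain I i j k where t: "t = (I, i, j, k)"
    by (metis prod_cases4)
  show ?thesis
    unfolding t by (cases I) (simp_all add: elt_def Let_def pv_polyvecs)
qed

text \<open>The differential of a member of \<open>killers\<close> is a nonzero multiple of the member \<open>kill\<close> assigns to it.\<close>

definition killers :: "real \<Rightarrow> real \<Rightarrow> idx set" where
  "killers a b = {(I, i, j, k). (I, i, j, k) \<in> harm a b \<and> 0 < i \<and> (I = B3 \<or> I = B13)}"

definition kill :: "idx \<Rightarrow> idx" where
  "kill = (\<lambda>(I, i, j, k). (if I = B3 then B12 else B123, 0, 0, k + 2 * i))"

text \<open>The factor for \<open>B13\<close> is -1/2 times the one for \<open>B3\<close>, by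
  \<open>sch_13\<close>.\<close>

definition kill_coeff :: "real \<Rightarrow> real \<Rightarrow> idx \<Rightarrow> real" where
  "kill_coeff a b = (\<lambda>(I, i, j, k). (if I = B3 then - 2 else 1) * (real i * kap a b ^ (i - 1)))"

lemma cdeg_simps:
  "cdeg (B0, i, j, k) = i + j + k" "cdeg (B1, i, j, k) = i + j + k + 1" "cdeg (B2, i, j, k) = i + j + k + 1"
  "cdeg (B3, i, j, k) = i + j + k + 1" "cdeg (B12, i, j, k) = i + j + k + 2" "cdeg (B13, i, j, k) = i + j + k + 2"
  "cdeg (B23, i, j, k) = i + j + k + 2" "cdeg (B123, i, j, k) = i + j + k + 3"
  by (simp_all add: cdeg_def)

declare st.simps [simp del]

context
  fixes a b :: real
  assumes a: "a \<noteq> 0" and b: "b \<noteq> 0"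
begin

text \<open>If 2a + b = 0, the equation becomes 2 (i - 1) + (k - 1) = 0, which for natural k leaves
  only i = 1. A positive power of w is thus only met when \<kappa> is a genuine inverse.\<close>

lemma kap_main:
  assumes "b * (real i - 1) = a * (real k - 1)" "0 < i"
  shows "i - 1 = 0 \<or> kap a b * (2 * a + b) = 1"
proof (cases "2 * a + b = 0")
  case True
  then have "b = - 2 * a"
    by simp
  with assms(1) have "a * (2 * (real i - 1) + (real k - 1)) = 0"
    by (simp add: algebra_simps)
  with a have "2 * (real i - 1) + (real k - 1) = 0"
    by simp
  with assms(2) show ?thesis
    by (cases i) auto
qed (simp add: kap_def)

lemma main_index:
  assumes "(I, i, j, k) \<in> harm a b" "0 < i" "0 < j"
  shows "i = j" "b * (real i - 1) = a * (real k - 1)"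
  using assms harm_cases [OF a b] by auto

text \<open>Correction terms trade xy for z^2, which keeps the degree and raises the level. Only the
  summands with Y_3 / 2 and Y_31 share the exponent of z with the leading term; \<open>flev\<close>
  places them half a step higher.\<close>

lemma elt_support:
  assumes "t \<in> harm a b" and "co (elt a b t) s \<noteq> 0"
  shows "cdeg s = cdeg t \<and> (s = t \<or> flev t < flev s)"
proof -
  obtain I i j k where t: "t = (I, i, j, k)"
    by (metis prod_cases4)
  obtain J i' j' k' where s: "s = (J, i', j', k')"
    by (metis prod_cases4)
  have h: "(I, i, j, k) \<in> harm a b"
    using assms(1) t by simp
  then have al: "(I, i, j, k) \<in> allowed"
    by (auto simp: harm_def)
  have nz: "co (elt a b (I, i, j, k)) (J, i', j', k') \<noteq> 0"
    using assms(2) s t by simp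
  have al': "(J, i', j', k') \<in> allowed"
    using nz unfolding co_coeff by meson
  have main: "i = j" if "0 < i" "0 < j"
    using main_index [OF h] that by blast
  have pos: "0 < i \<longleftrightarrow> 0 < j" if "0 < k"
    using h that unfolding harm_cases [OF a b] by auto
  note simps = co_coeff elt_def Let_def cdeg_simps flev_def allowed_def mon_nth mult.assoc cst_mult_nth vars_mult_nth
  note [simp del] = st.simps
  have "cdeg (J, i', j', k') = cdeg (I, i, j, k) \<and> ((J, i', j', k') = (I, i, j, k) \<or> flev (I, i, j, k) < flev (J, i', j', k'))"
  proof (cases I)
    case B0
    then show ?thesis
      using nz al al' main pos by (cases J) (auto simp: simps split: if_splits dest!: cas_nz)
  next
    case B1
    then show ?thesis
      using nz al al' main pos by (cases J) (auto simp: simps split: if_splits dest!: cas_nz)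
  next
    case B2
    then show ?thesis
      using nz al al' main pos by (cases J) (auto simp: simps split: if_splits dest!: cas_nz)
  next
    case B3
    then show ?thesis
      using nz al al' main pos by (cases J) (auto simp: simps split: if_splits dest!: cas_nz tail_nz)
  next
    case B12
    then show ?thesis
      using nz al al' by (cases J) (auto simp: simps split: if_splits)
  next
    case B123
    then show ?thesis
      using nz al al' by (cases J) (auto simp: simps split: if_splits)
  next
    case B23
    then show ?thesis
      using nz al al' main pos by (cases J) (auto simp: simps split: if_splits dest!: cas_nz)
  next
    case B13
    show ?thesis
    proof (cases "i = 0")
      case True
      then show ?thesis
        using nz al al' B13 by (cases J) (auto simp: simps split: if_splits)
    next
      case False
      let ?f = "vx * cas (kap a b) (i - 1) k" and ?g = "vz * tail (kap a b) (i - 1) k"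
      have J: "J = B13" and "?f $ i' $ (j' - 1) $ k' \<noteq> 0 \<or> ?g $ i' $ (j' - 1) $ k' \<noteq> 0"
        using nz al' B13 False by (cases J; auto simp: co_coeff elt_def Let_def mult.assoc cst_mult_nth)+
      then show ?thesis
        using False al al' B13 main
        by (auto simp: vars_mult_nth cdeg_simps flev_def allowed_def split: if_splits dest!: cas_nz tail_nz)
    qed
  qed
  then show ?thesis
    unfolding s t .
qed

lemma elt_lead:
  assumes "t \<in> harm a b"
  shows "co (elt a b t) t = 1"
proof -
  obtain I i j k where t: "t = (I, i, j, k)"
    by (metis prod_cases4)
  have h: "(I, i, j, k) \<in> harm a b"
    using assms t by simp
  then have al: "(I, i, j, k) \<in> allowed"
    by (auto simp: harm_def)
  have main: "i = j" if "0 < i" "0 < j"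
    using main_index [OF h] that by blast
  have pos: "0 < i \<longleftrightarrow> 0 < j" if "0 < k"
    using h that unfolding harm_cases [OF a b] by auto
  have g: "tail (kap a b) (i - 1) k $ i $ (j - 1) $ (k - 1) = 0"
    using tail_nz [of "kap a b" "i - 1" k i "j - 1" "k - 1"] by (cases i) auto
  note [simp del] = st.simps
  show ?thesis
    unfolding t using al main pos g
    by (cases I) (auto simp: co_coeff elt_def Let_def allowed_def mon_nth mult.assoc cst_mult_nth vars_mult_nth cas_nth)
qed

text \<open>With n = i - 1 and m = k - 1 the equation says b n = a m, so w^n z^m is a Casimir; one
  more factor z contributes -a.\<close>

lemma good_main:
  assumes "b * (real i - 1) = a * (real k - 1)" "0 < i"
  shows "0 < k \<Longrightarrow> good a b (cas (kap a b) (i - 1) (k - 1)) 0" "good a b (cas (kap a b) (i - 1) k) (- a)"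
proof -
  have i: "real (i - 1) = real i - 1"
    using assms(2) by simp
  show "good a b (cas (kap a b) (i - 1) k) (- a)"
  proof -
    have "b * real (i - 1) - a * real k = - a"
      unfolding i using assms(1) by (simp add: algebra_simps)
    then show ?thesis
      using good_cas [OF kap_main [OF assms], of k] by simp
  qed
  assume "0 < k"
  then have "real (k - 1) = real k - 1"
    by simp
  then show "good a b (cas (kap a b) (i - 1) (k - 1)) 0"
    using good_cas [OF kap_main [OF assms], of "k - 1"] assms(1) unfolding i by simp
qed

lemma tail_main:
  assumes main: "b * (real i - 1) = a * (real k - 1)" "0 < i"
  defines "p \<equiv> tail (kap a b) (i - 1) k" and "f \<equiv> cas (kap a b) (i - 1) k"
    and "r \<equiv> - cst (2 * (real i * kap a b ^ (i - 1))) * vz ^ (k + 2 * i - 1)"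
  shows "(cst b * vx * vy + vz * vz) * partial_deriv 1 p - cst a * vy * vz * partial_deriv 3 p - cst b * vy * p =
      2 * vz * f + r"
    and "cst a * vy * vz * partial_deriv 2 p - cst a * vx * vz * partial_deriv 1 p + cst a * vz * p = 0"
proof -
  let ?q = "vz ^ (k + 1 + 2 * (i - 1))"
  have e: "k + 1 + 2 * (i - 1) = k + 2 * i - 1" and i: "real (i - 1) = real i - 1"
    using main(2) by auto
  have "(cst b * vx * vy + vz * vz) * partial_deriv 1 p - cst a * vy * vz * partial_deriv 3 p - cst b * vy * p =
      2 * vz * f + r \<and> cst a * vy * vz * partial_deriv 2 p - cst a * vx * vz * partial_deriv 1 p + cst a * vz * p = 0"
  \<comment> \<open>Here the tail is an empty sum and f = z^k, so no property of \<kappa> enters;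
    this covers 2a + b = 0.\<close>
  proof (cases "i = 1")
    case True
    then have "p = 0" and "r = - 2 * ?q" "f = vz ^ k"
      by (simp_all add: p_def tail_def r_def f_def cas_def cst_numeral cst_simps)
    then show ?thesis
      using True by simp
  next
    case False
    then have k: "kap a b * (2 * a + b) = 1"
      using kap_main [OF main] main(2) by auto
    let ?d = "a * real (k + 1 + 2 * (i - 1))"
    have q: "good a b ?q (- ?d)"
      using good_power [OF good_vz, of a b "k + 1 + 2 * (i - 1)"] by (simp add: mult.commute)
    have "a * real k = b * (real i - 1) + a"
      using main(1) by (simp add: algebra_simps)
    \<comment> \<open>The harmonic equation turns the factor d + b of the remainder into i (2a + b),
      and \<kappa> cancels 2a + b. This is where the nonzero constant 2 i \<kappa>^(i-1) comes
      from.\<close>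
    then have "?d + b = real i * (2 * a + b)"
      unfolding of_nat_add of_nat_mult i by (simp add: algebra_simps)
    then have "2 * kap a b * kap a b ^ (i - 1) * (?d + b) = 2 * (real i * kap a b ^ (i - 1)) * (kap a b * (2 * a + b))"
      by (simp only: ac_simps)
    then have c: "2 * kap a b * kap a b ^ (i - 1) * (?d + b) = 2 * (real i * kap a b ^ (i - 1))"
      by (simp only: k mult_1_right)
    have r: "2 * vz * f - cst (2 * kap a b * kap a b ^ (i - 1) * (?d + b)) * ?q = 2 * vz * f + r"
      unfolding c unfolding r_def e by (simp only: diff_conv_add_uminus mult_minus_left)
    have "(cst b * vx * vy + vz * vz) * partial_deriv 1 p - cst a * vy * vz * partial_deriv 3 p - cst b * vy * p =
        2 * vz * f - cst (2 * kap a b * kap a b ^ (i - 1) * (?d + b)) * ?q"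
      unfolding p_def f_def by (rule sch_3_aux(1) [OF good_main(2) [OF main] vy_tail q k])
    moreover have "cst a * vy * vz * partial_deriv 2 p - cst a * vx * vz * partial_deriv 1 p + cst a * vz * p = 0"
      unfolding p_def by (rule sch_3_aux(2) [OF good_main(2) [OF main] vy_tail q k])
    ultimately show ?thesis
      unfolding r by blast
  qed
  then show "(cst b * vx * vy + vz * vz) * partial_deriv 1 p - cst a * vy * vz * partial_deriv 3 p - cst b * vy * p =
      2 * vz * f + r"
    "cst a * vy * vz * partial_deriv 2 p - cst a * vx * vz * partial_deriv 1 p + cst a * vz * p = 0"
    by blast+
qed

lemma elt_cocycle:
  assumes "t \<in> harm a b" "t \<notin> killers a b"
  shows "schouten (Lambda4 a b) (elt a b t) (st J) = 0"
proof -
  obtain I i j k where t: "t = (I, i, j, k)"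
    by (metis prod_cases4)
  have h: "(I, i, j, k) \<in> harm a b"
    using assms t by simp
  then have al: "o1 I \<le> i" "o2 I \<le> j" "o3 I \<le> k"
    by (auto simp: harm_def allowed_def)
  have main: "i = j" "b * (real i - 1) = a * (real k - 1)" if "0 < i" "0 < j"
    using main_index [OF h] that by blast+
  have pos: "0 < i \<longleftrightarrow> 0 < j" if "0 < k"
    using h that unfolding harm_cases [OF a b] by auto
  have eq: "a = b \<and> k = 0" if "i = 0 \<longleftrightarrow> 0 < j"
    using h that unfolding harm_cases [OF a b] by auto
  have nk: "I \<noteq> B3" "I = B13 \<Longrightarrow> i = 0"
    using assms(2) h al unfolding t killers_def by (cases I; simp)+
  have "schouten (Lambda4 a b) (elt a b (I, i, j, k)) (st J) = 0"
  proof (cases I)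
    case B0
    then show ?thesis
      unfolding B0 elt_eqs by (intro sch_cas0 good_main(1) main(2)) (use al B0 in auto)
  next
    case B1
    then have "0 < k" "0 < i" "0 < j"
      using al pos by auto
    then show ?thesis
      unfolding B1 elt_eqs by (intro sch_cas1 good_main(1) main(2))
  next
    case B2
    then have "0 < k" "0 < i" "0 < j"
      using al pos by auto
    then show ?thesis
      unfolding B2 elt_eqs by (intro sch_cas2 good_main(1) main(2))
  next
    case B12
    then have "i = j"
      using al pos main by auto
    then have "vx * partial_deriv 1 (mon i j (k - 1)) = vy * partial_deriv 2 (mon i j (k - 1))"
      by (intro euler_eqI) (simp add: mon_nth split: if_splits)
    then show ?thesis
      unfolding B12 elt_eqs by (rule sch_12)
  next
    case B13
    then have "i = 0" "a = b" "k = 0"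
      using nk al eq by auto
    moreover have "partial_deriv 1 (mon 0 (j - 1) 0) = 0" "partial_deriv 3 (mon 0 (j - 1) 0) = 0"
      by (simp_all add: fps_eq_iff partial_deriv_nth mon_nth)
    ultimately show ?thesis
      unfolding B13 \<open>i = 0\<close> \<open>k = 0\<close> elt_eqs by (intro sch_13_equal)
  next
    case B23
    show ?thesis
    proof (cases "j = 0")
      case True
      then have "a = b" "k = 0"
        using B23 al eq by auto
      moreover have "partial_deriv 2 (mon (i - 1) 0 0) = 0" "partial_deriv 3 (mon (i - 1) 0 0) = 0"
        by (simp_all add: fps_eq_iff partial_deriv_nth mon_nth)
      ultimately show ?thesis
        unfolding B23 True \<open>k = 0\<close> elt_eqs by (intro sch_23_equal)
    next
      case False
      have "vx * partial_deriv 1 (cas 0 (i - 1) k) = vy * partial_deriv 2 (cas 0 (i - 1) k)"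
        by (intro euler_eqI) (use cas_nz in blast)
      then show ?thesis
        unfolding B23 elt_eqs(9) [OF False [unfolded neq0_conv]] by (rule sch_23)
    qed
  next
    case B123
    then show ?thesis
      by (simp only: elt_eqs sch_123)
  qed (use nk in simp)
  then show ?thesis
    unfolding t .
qed

lemma elt_killer:
  assumes "t \<in> killers a b"
  shows "schouten (Lambda4 a b) (elt a b t) (st J) = cst (kill_coeff a b t) * elt a b (kill t) (st J)"
proof -
  obtain I i j k where t: "t = (I, i, j, k)"
    by (metis prod_cases4)
  have h: "(I, i, j, k) \<in> harm a b" "0 < i" "I = B3 \<or> I = B13"
    using assms t by (auto simp: killers_def)
  then have "0 < j"
    by (auto simp: harm_def allowed_def)
  then have main: "b * (real i - 1) = a * (real k - 1)"
    using main_index h by blast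
  let ?c = "real i * kap a b ^ (i - 1)"
  have half: "cst (1/2) * cst (2 * x) = cst x" for x
    by (simp add: cst_simps(4) [symmetric])
  have pw: "vz * vz ^ (k + 2 * i - 1) = vz ^ (k + 2 * i)"
    using h(2) by (simp flip: power_Suc)
  show ?thesis
    using h(3)
  proof
    assume I: "I = B3"
    show ?thesis
      unfolding t I elt_eqs sch_3 [OF good_main(2) [OF main h(2)] tail_main [OF main h(2)], of J]
      by (cases J) (simp_all add: elt_eqs kill_def kill_coeff_def mon_def cst_simps(5))
  next
    assume I: "I = B13"
    have "- (cst (1/2) * vz * (- cst (2 * ?c) * vz ^ (k + 2 * i - 1))) = (cst (1/2) * cst (2 * ?c)) * (vz * vz ^ (k + 2 * i - 1))"
      by (simp only: mult_minus_left mult_minus_right minus_minus ac_simps)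
    then have r: "- (cst (1/2) * vz * (- cst (2 * ?c) * vz ^ (k + 2 * i - 1))) = cst ?c * vz ^ (k + 2 * i)"
      unfolding half pw .
    show ?thesis
      unfolding t I elt_eqs(7) [OF h(2)] sch_13 [OF good_main(2) [OF main h(2)] tail_main(1) [OF main h(2)], of J] r
      by (cases J) (simp_all add: elt_eqs kill_def kill_coeff_def mon_def)
  qed
qed

lemma co_scaled:
  assumes "\<And>J. P (st J) = cst c * Q (st J)"
  shows "co P = (\<lambda>s. c * co Q s)"
  by (rule idx_eqI) (simp add: co_coeff assms cst_mult_nth)

text \<open>The exponent k + 2i and the harmonic equation are two linear equations for (i, k) with
  determinant 2a + b up to sign; if it vanishes, i = 1 on both sides.\<close>

lemma kill_inj: "inj_on kill (killers a b)"
proof (rule inj_onI)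
  fix t s assume t: "t \<in> killers a b" and s: "s \<in> killers a b" and eq: "kill t = kill s"
  obtain I i j k where t': "t = (I, i, j, k)"
    by (metis prod_cases4)
  obtain I' i' j' k' where s': "s = (I', i', j', k')"
    by (metis prod_cases4)
  have 1: "(I, i, j, k) \<in> harm a b" "0 < i" "I = B3 \<or> I = B13" "0 < j"
    using t unfolding t' by (auto simp: killers_def harm_def allowed_def)
  have 2: "(I', i', j', k') \<in> harm a b" "0 < i'" "I' = B3 \<or> I' = B13" "0 < j'"
    using s unfolding s' by (auto simp: killers_def harm_def allowed_def)
  have II: "I = I'" and kk: "k + 2 * i = k' + 2 * i'"
    using eq 1(3) 2(3) unfolding t' s' kill_def by auto
  have m1: "i = j" "b * (real i - 1) = a * (real k - 1)"
    using main_index [OF 1(1,2,4)] .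
  have m2: "i' = j'" "b * (real i' - 1) = a * (real k' - 1)"
    using main_index [OF 2(1,2,4)] .
  have kk': "real k = real k' + 2 * real i' - 2 * real i"
    using kk by linarith
  have "(2 * a + b) * (real i - real i') = 0"
    using m1(2) m2(2) unfolding kk' by (simp add: algebra_simps)
  moreover have "i = 1 \<and> i' = 1" if "2 * a + b = 0"
    using kap_main [OF m1(2) 1(2)] kap_main [OF m2(2) 2(2)] 1(2) 2(2) that by (auto simp: kap_def)
  ultimately have "i = i'"
    by auto
  then show "t = s"
    unfolding t' s' using II kk m1 m2 by simp
qed

lemma kill_harm: "kill ` killers a b \<subseteq> harm a b - killers a b"
  unfolding harm_cases [OF a b] kill_def killers_def
  by (auto simp: harm_cases [OF a b] allowed_def killers_def)

lemma harm_allowed: "harm a b \<subseteq> allowed"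
  by (auto simp: harm_def)

lemma killers_harm: "killers a b \<subseteq> harm a b"
  by (auto simp: killers_def)

lemma lambda4_complex:
  "matched_complex allowed cdeg flev (diff a b) (lead_diff a b) (contraction a b) (harm a b) (killers a b)
     (\<lambda>t. co (elt a b t)) kill (kill_coeff a b)"
proof
  show "cdeg (kill t) = Suc (cdeg t)" if "t \<in> killers a b" for t
  proof -
    obtain I i j k where t: "t = (I, i, j, k)"
      by (metis prod_cases4)
    then have "(I, i, j, k) \<in> harm a b" "0 < i" "I = B3 \<or> I = B13" "0 < j"
      using that by (auto simp: killers_def harm_def allowed_def)
    then show ?thesis
      using main_index(1) unfolding t by (auto simp: kill_def cdeg_simps)
  qed
  show "kill_coeff a b t \<noteq> 0" if "t \<in> killers a b" for t
  proof -
    obtain I i j k where t: "t = (I, i, j, k)"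
      by (metis prod_cases4)
    then have h: "(I, i, j, k) \<in> harm a b" "0 < i" "0 < j"
      using that by (auto simp: killers_def harm_def allowed_def)
    show ?thesis
      using kap_main [OF main_index(2) [OF h] h(2)] h(2) unfolding t kill_coeff_def by auto
  qed
  show "diff a b (co (elt a b t)) = 0" if "t \<in> harm a b" "t \<notin> killers a b" for t
    using co_scaled [of "schouten (Lambda4 a b) (elt a b t)" 0 "elt a b t"] elt_cocycle [OF that]
    by (simp add: co_schouten [symmetric] cst_simps zero_fun_def)
  show "diff a b (co (elt a b t)) = (\<lambda>s. kill_coeff a b t * co (elt a b (kill t)) s)" if "t \<in> killers a b" for t
    using co_scaled elt_killer [OF that] by (simp add: co_schouten [symmetric])
qed (use kill_harm harm_allowed killers_harm in \<open>auto intro: co_supported finite_cdeg diff_linear lead_diff_linear contraction_linear diff_closed lead_diff_closed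
    contraction_closed diff_local corr_leading elt_lead kill_inj
    simp: diff_diff contraction_contraction lead_diff_lead_diff harm_supported harm_zero homotopy_formula
    dest: elt_support\<close>)

end

section \<open>Classes of adapted families\<close>

lemma scale_apply: "scale c P I = cst c * P I"
  by (simp add: scale_def mul_def)

lemma scale_nth: "scale c P I $ i $ j $ k = c * P I $ i $ j $ k"
  by (simp add: scale_apply cst_mult_nth)

lemma scale_minus_one: "scale (- 1) P = - P"
  by (rule ext) (simp add: scale_apply cst_simps fun_Compl_def)

definition subspace_pv :: "polyvec set \<Rightarrow> bool" where
  "subspace_pv W \<longleftrightarrow> 0 \<in> W \<and> (\<forall>P\<in>W. \<forall>Q\<in>W. P + Q \<in> W) \<and> (\<forall>c. \<forall>P\<in>W. scale c P \<in> W)"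

lemma subspace_pvD:
  assumes "subspace_pv W"
  shows "0 \<in> W" "P \<in> W \<Longrightarrow> Q \<in> W \<Longrightarrow> P + Q \<in> W" "P \<in> W \<Longrightarrow> scale c P \<in> W"
    "P \<in> W \<Longrightarrow> - P \<in> W" "P \<in> W \<Longrightarrow> Q \<in> W \<Longrightarrow> P - Q \<in> W"
proof -
  show 1: "0 \<in> W" "P \<in> W \<Longrightarrow> Q \<in> W \<Longrightarrow> P + Q \<in> W" "P \<in> W \<Longrightarrow> scale c P \<in> W" for P Q c
    using assms by (auto simp: subspace_pv_def)
  show 2: "P \<in> W \<Longrightarrow> - P \<in> W" for P
    using 1(3) [of P "- 1"] by (simp only: scale_minus_one)
  show "P \<in> W \<Longrightarrow> Q \<in> W \<Longrightarrow> P - Q \<in> W"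
    using 1(2) [of P "- Q"] 2 by simp
qed

lemma subspace_pv_Int: "subspace_pv V \<Longrightarrow> subspace_pv W \<Longrightarrow> subspace_pv (V \<inter> W)"
  by (auto simp: subspace_pv_def)

lemma scale_add: "scale c (P + Q) = scale c P + scale c Q"
  by (rule ext) (simp add: scale_apply distrib_left)

lemma scale_zero: "scale c 0 = 0"
  by (rule ext) (simp add: scale_apply)

lemma scale_diff: "scale c (P - Q) = scale c P - scale c Q"
  by (rule ext) (simp add: scale_apply right_diff_distrib)

lemma subspace_pv_plus:
  assumes V: "subspace_pv V" and W: "subspace_pv W"
  shows "subspace_pv (V + W)"
  unfolding subspace_pv_def
proof (intro conjI allI ballI)
  show "0 \<in> V + W"
    using set_plus_intro [OF subspace_pvD(1) [OF V] subspace_pvD(1) [OF W]] by simp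
  fix P Q c assume "P \<in> V + W"
  then obtain v w where P: "P = v + w" "v \<in> V" "w \<in> W"
    by (auto elim: set_plus_elim)
  show "scale c P \<in> V + W"
    unfolding P(1) scale_add by (intro set_plus_intro subspace_pvD(3) V W P)
  assume "Q \<in> V + W"
  then obtain v' w' where Q: "Q = v' + w'" "v' \<in> V" "w' \<in> W"
    by (auto elim: set_plus_elim)
  have "P + Q = (v + v') + (w + w')"
    unfolding P(1) Q(1) by (simp only: ac_simps)
  also have "\<dots> \<in> V + W"
    by (intro set_plus_intro subspace_pvD(2) V W P Q)
  finally show "P + Q \<in> V + W" .
qed

lemma coset_mem: "(Q \<in> P +o W) = (Q - P \<in> (W :: polyvec set))"
proof
  assume "Q \<in> P +o W"
  then obtain w where "Q = P + w" "w \<in> W"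
    by (auto simp: elt_set_plus_def)
  then show "Q - P \<in> W"
    by simp
next
  assume "Q - P \<in> W"
  then have "P + (Q - P) \<in> P +o W"
    by (rule set_plus_intro2)
  then show "Q \<in> P +o W"
    by simp
qed

lemma coset_eq_iff:
  assumes W: "subspace_pv W"
  shows "P +o W = Q +o W \<longleftrightarrow> P - Q \<in> W"
proof
  assume eq: "P +o W = Q +o W"
  have "P \<in> P +o W"
    unfolding coset_mem using subspace_pvD(1) [OF W] by simp
  then show "P - Q \<in> W"
    unfolding eq coset_mem .
next
  assume d: "P - Q \<in> W"
  show "P +o W = Q +o W"
  proof (rule set_eqI)
    fix R
    have 1: "R - Q = (R - P) + (P - Q)" and 2: "R - P = (R - Q) - (P - Q)"
      by simp_all
    show "R \<in> P +o W \<longleftrightarrow> R \<in> Q +o W"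
      unfolding coset_mem using subspace_pvD(2,5) [OF W _ d] 1 2 by metis
  qed
qed

lemma coset_add:
  assumes W: "subspace_pv W"
  shows "(P +o W) + (Q +o W) = (P + Q) +o W"
proof -
  have "W + W = W"
  proof
    show "W + W \<subseteq> W"
      using subspace_pvD(2) [OF W] by (auto elim: set_plus_elim)
    show "W \<subseteq> W + W"
    proof
      fix w assume "w \<in> W"
      then have "0 + w \<in> W + W"
        by (intro set_plus_intro subspace_pvD(1) [OF W])
      then show "w \<in> W + W"
        by simp
    qed
  qed
  then show ?thesis
    by (simp only: set_plus_rearrange)
qed

lemma coset_scale_eq:
  assumes W: "subspace_pv W"
  shows "coset_scale scale W c (P +o W) = scale c P +o W"
proof (rule set_eqI)
  fix R
  show "R \<in> coset_scale scale W c (P +o W) \<longleftrightarrow> R \<in> scale c P +o W"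
  proof
    assume "R \<in> coset_scale scale W c (P +o W)"
    then obtain w w' where "R = scale c (P + w) + w'" "w \<in> W" "w' \<in> W"
      unfolding coset_scale_def by (auto elim!: set_plus_elim simp: elt_set_plus_def)
    then have "R - scale c P = scale c w + w'"
      unfolding \<open>R = _\<close> scale_add by simp
    then show "R \<in> scale c P +o W"
      unfolding coset_mem using subspace_pvD(2,3) [OF W] \<open>w \<in> W\<close> \<open>w' \<in> W\<close> by simp
  next
    assume "R \<in> scale c P +o W"
    then have r: "R - scale c P \<in> W"
      unfolding coset_mem .
    have "P \<in> P +o W"
      unfolding coset_mem using subspace_pvD(1) [OF W] by simp
    then have "scale c P + (R - scale c P) \<in> scale c ` (P +o W) + W"
      using r by (intro set_plus_intro) auto
    then show "R \<in> coset_scale scale W c (P +o W)"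
      unfolding coset_scale_def by simp
  qed
qed

text \<open>Two linear surjections from the same space with the same kernel. It is applied to
  cocycles for E_inf and G, and to coefficient functions for G and the cohomology.\<close>

lemma transport_iso:
  fixes f1 :: "'z::plus \<Rightarrow> 'a::plus" and f2 :: "'z \<Rightarrow> 'b::plus"
  assumes U: "U = f1 ` Z" and V: "V = f2 ` Z"
    and ker: "\<And>x y. x \<in> Z \<Longrightarrow> y \<in> Z \<Longrightarrow> f1 x = f1 y \<longleftrightarrow> f2 x = f2 y"
    and add: "\<And>x y. x \<in> Z \<Longrightarrow> y \<in> Z \<Longrightarrow> x + y \<in> Z \<and> f1 (x + y) = f1 x + f1 y \<and> f2 (x + y) = f2 x + f2 y"
    and scl: "\<And>c x. x \<in> Z \<Longrightarrow> m c x \<in> Z \<and> f1 (m c x) = s c (f1 x) \<and> f2 (m c x) = t c (f2 x)"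
  shows "\<exists>\<phi>. linear_iso s t U V \<phi> \<and> (\<forall>x\<in>Z. \<phi> (f1 x) = f2 x)"
proof -
  define \<phi> where "\<phi> u = f2 (SOME x. x \<in> Z \<and> f1 x = u)" for u
  have \<phi>: "\<phi> (f1 x) = f2 x" if "x \<in> Z" for x
  proof -
    have "(SOME y. y \<in> Z \<and> f1 y = f1 x) \<in> Z \<and> f1 (SOME y. y \<in> Z \<and> f1 y = f1 x) = f1 x"
      by (rule someI [of _ x]) (use that in simp)
    then show ?thesis
      unfolding \<phi>_def using ker that by blast
  qed
  have "bij_betw \<phi> U V"
    unfolding bij_betw_def inj_on_def U V
    by (auto simp: \<phi> ker image_image intro!: image_eqI)
  moreover have "\<phi> (u + v) = \<phi> u + \<phi> v" if uv: "u \<in> U" "v \<in> U" for u v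
  proof -
    obtain x y where "x \<in> Z" "y \<in> Z" "u = f1 x" "v = f1 y"
      using uv unfolding U by blast
    then show ?thesis
      using add [of x y] \<phi> by metis
  qed
  moreover have "\<phi> (s c u) = t c (\<phi> u)" if u: "u \<in> U" for c u
  proof -
    obtain x where "x \<in> Z" "u = f1 x"
      using u unfolding U by blast
    then show ?thesis
      using scl [of x c] \<phi> by metis
  qed
  ultimately show ?thesis
    unfolding linear_iso_def using \<phi> by blast
qed

section \<open>Bidegrees, the filtration and formal sums\<close>

lemma supported_iff:
  "P \<in> supported A \<longleftrightarrow> P \<in> polyvecs \<and>
     (\<forall>b i j k. co P (b, i, j, k) \<noteq> 0 \<longrightarrow> (int (i + j + card (st b)), int k) \<in> A)"
  unfolding supported_def subset_123 co_def by auto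

lemma co_add: "co (P + Q) t = co P t + co Q t"
  by (cases t rule: prod_cases4) (simp add: co_coeff)

lemma co_scale: "co (scale c P) t = c * co P t"
  by (cases t rule: prod_cases4) (simp add: co_coeff scale_nth)

lemma polyvecs_subspace: "subspace_pv polyvecs"
  by (auto simp: subspace_pv_def polyvecs_def scale_apply)

lemma supported_subspace: "subspace_pv (supported A)"
proof -
  have "co 0 t = 0" for t
    by (cases t rule: prod_cases4) (simp add: co_coeff)
  moreover have "P + Q \<in> supported A" if PQ: "P \<in> supported A" "Q \<in> supported A" for P Q
    unfolding supported_iff co_add
  proof (intro conjI allI impI)
    show "P + Q \<in> polyvecs"
      using PQ subspace_pvD(2) [OF polyvecs_subspace] unfolding supported_iff by blast
    fix b i j k assume "co P (b, i, j, k) + co Q (b, i, j, k) \<noteq> 0"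
    then have "co P (b, i, j, k) \<noteq> 0 \<or> co Q (b, i, j, k) \<noteq> 0"
      by linarith
    then show "(int (i + j + card (st b)), int k) \<in> A"
      using PQ unfolding supported_iff by blast
  qed
  moreover have "scale c P \<in> supported A" if P: "P \<in> supported A" for c P
    unfolding supported_iff co_scale
  proof (intro conjI allI impI)
    show "scale c P \<in> polyvecs"
      using P subspace_pvD(3) [OF polyvecs_subspace] unfolding supported_iff by blast
    fix b i j k assume "c * co P (b, i, j, k) \<noteq> 0"
    then have "co P (b, i, j, k) \<noteq> 0"
      by auto
    then show "(int (i + j + card (st b)), int k) \<in> A"
      using P unfolding supported_iff by blast
  qed
  ultimately show ?thesis
    using subspace_pvD(1) [OF polyvecs_subspace] by (simp add: subspace_pv_def supported_iff [of 0])
qed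

lemma supported_mono: "A \<subseteq> A' \<Longrightarrow> supported A \<subseteq> supported A'"
  unfolding subset_iff supported_iff by blast

lemma K_filt_mono: "p \<le> p' \<Longrightarrow> K_filt p' \<subseteq> K_filt p"
  unfolding K_filt_def by (rule supported_mono) auto

lemma formal_sum_nth:
  "formal_sum c B I $ i $ j $ k = (\<Sum>v\<in>{v \<in> B. v I $ i $ j $ k \<noteq> 0}. c v * v I $ i $ j $ k)"
  by (simp add: formal_sum_def)

lemma polyvec_nth_eqI: "(\<And>I i j k. P I $ i $ j $ k = Q I $ i $ j $ k) \<Longrightarrow> P = (Q :: polyvec)"
  by (intro ext fps_ext)

lemma formal_sum_add: "formal_sum (c + c') B = formal_sum c B + formal_sum c' B"
  by (rule polyvec_nth_eqI) (simp add: formal_sum_nth distrib_right sum.distrib)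

lemma formal_sum_scale: "formal_sum (\<lambda>v. r * c v) B = scale r (formal_sum c B)"
  by (rule polyvec_nth_eqI) (simp add: formal_sum_nth scale_nth sum_distrib_left mult.assoc)

lemma formal_sum_diff: "formal_sum (\<lambda>v. c v - c' v) B = formal_sum c B - formal_sum c' B"
  by (rule polyvec_nth_eqI) (simp add: formal_sum_nth left_diff_distrib sum_subtractf)

lemma formal_sum_cong: "(\<And>v. v \<in> B \<Longrightarrow> c v = c' v) \<Longrightarrow> formal_sum c B = formal_sum c' B"
  by (rule polyvec_nth_eqI) (auto simp: formal_sum_nth intro!: sum.cong)

lemma formal_sum_restrict:
  assumes "\<And>I i j k. finite {v \<in> B. v I $ i $ j $ k \<noteq> 0}" "B' \<subseteq> B"
  shows "formal_sum c B' = formal_sum (\<lambda>v. if v \<in> B' then c v else 0) B"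
  by (rule polyvec_nth_eqI, unfold formal_sum_nth, rule sum.mono_neutral_cong_left) (use assms in auto)

lemma formal_sum_supported:
  assumes "B \<subseteq> supported A"
  shows "formal_sum c B \<in> supported A"
  unfolding supported_iff
proof (intro conjI allI impI)
  have "formal_sum c B I = 0" if "\<not> I \<subseteq> {1, 2, 3}" for I
  proof (intro fps_ext)
    fix i j k
    have vI: "v I = 0" if "v \<in> B" for v
      using assms that \<open>\<not> I \<subseteq> {1, 2, 3}\<close> unfolding supported_def polyvecs_def by blast
    then have "v I $ i $ j $ k = 0" if "v \<in> B" for v
    proof -
      have "v I = 0"
        by (rule vI [OF that])
      then show ?thesis
        by simp
    qed
    then have "{v \<in> B. v I $ i $ j $ k \<noteq> 0} = {}"
      by blast
    then show "formal_sum c B I $ i $ j $ k = 0 $ i $ j $ k"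
      unfolding formal_sum_nth by simp
  qed
  then show "formal_sum c B \<in> polyvecs"
    unfolding polyvecs_def mem_Collect_eq by iprover
  fix b i j k
  assume nz: "co (formal_sum c B) (b, i, j, k) \<noteq> 0"
  then have al: "(b, i, j, k) \<in> allowed"
    unfolding co_coeff by (rule contrapos_np) (rule if_not_P)
  let ?n = "\<lambda>v. v (st b) $ (i - o1 b) $ (j - o2 b) $ (k - o3 b)"
  have "(\<Sum>v\<in>{v \<in> B. ?n v \<noteq> 0}. c v * ?n v) \<noteq> 0"
    using nz unfolding co_coeff if_P [OF al] formal_sum_nth .
  then have "{v \<in> B. ?n v \<noteq> 0} \<noteq> {}"
    by (intro notI) (simp only: sum.empty)
  then obtain v where v: "v \<in> B" "?n v \<noteq> 0"
    by blast
  then have "v \<in> supported A" "co v (b, i, j, k) \<noteq> 0"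
    unfolding co_coeff if_P [OF al] using assms by blast+
  then show "(int (i + j + card (st b)), int k) \<in> A"
    unfolding supported_iff by blast
qed


text \<open>The strong hypothesis is \<open>span\<close>: a homogeneous cocycle in a filtration step
  is cohomologous to a combination of those members of \<open>B\<close> that lie in the same step
  and degree. Together with independence it settles E_inf, G and the cohomology.\<close>

locale adapted_family =
  fixes L :: polyvec and B :: "polyvec set"
  assumes d_add: "schouten L (P + Q) = schouten L P + schouten L Q"
    and d_scale: "schouten L (scale r P) = scale r (schouten L P)"
    and locfin: "finite {v \<in> B. v I $ i $ j $ k \<noteq> 0}"
    and homog: "v \<in> B \<Longrightarrow> \<exists>p q. v \<in> part_at B p q"
    and cocyc: "formal_sum c B \<in> cocycles L"
    and span: "P \<in> cocycles L \<Longrightarrow> P \<in> K_filt p \<Longrightarrow> P \<in> K_deg n \<Longrightarrow>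
      \<exists>c. P - formal_sum c (B \<inter> K_filt p \<inter> K_deg n) \<in> coboundaries L"
    and span_all: "P \<in> cocycles L \<Longrightarrow> \<exists>c. P - formal_sum c B \<in> coboundaries L"
    and indep: "formal_sum c B \<in> coboundaries L \<Longrightarrow> v \<in> B \<Longrightarrow> c v = 0"
begin

lemma d_zero: "schouten L 0 = 0"
  using d_add [of 0 0] by simp

lemma cocycles_subspace: "subspace_pv (cocycles L)"
  using polyvecs_subspace by (auto simp: subspace_pv_def cocycles_def d_add d_scale d_zero scale_zero)

lemma coboundaries_subspace: "subspace_pv (coboundaries L)"
  unfolding subspace_pv_def coboundaries_def
proof (intro conjI allI ballI)
  show "0 \<in> schouten L ` polyvecs"
    using d_zero subspace_pvD(1) [OF polyvecs_subspace] by (metis imageI)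
next
  fix P Q assume "P \<in> schouten L ` polyvecs" "Q \<in> schouten L ` polyvecs"
  then show "P + Q \<in> schouten L ` polyvecs"
    using subspace_pvD(2) [OF polyvecs_subspace] by (auto simp: d_add [symmetric])
next
  fix c P assume "P \<in> schouten L ` polyvecs"
  then show "scale c P \<in> schouten L ` polyvecs"
    using subspace_pvD(3) [OF polyvecs_subspace] by (auto simp: d_scale [symmetric])
qed

lemma formal_sum_sub:
  assumes "B' \<subseteq> B"
  shows "formal_sum c B' = formal_sum (\<lambda>v. if v \<in> B' then c v else 0) B"
  by (rule formal_sum_restrict [OF locfin assms])

lemma formal_sum_cocycle: "B' \<subseteq> B \<Longrightarrow> formal_sum c B' \<in> cocycles L"
  unfolding formal_sum_sub by (rule cocyc)

lemma coeff_eq: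
  assumes "formal_sum c B - formal_sum c' B \<in> coboundaries L" "v \<in> B"
  shows "c v = c' v"
  using indep [of "\<lambda>v. c v - c' v" v] assms by (simp add: formal_sum_diff)

lemma independent: "formally_independent B"
  unfolding formally_independent_def
proof (intro conjI allI impI ballI)
  fix c v assume "formal_sum c B = 0" "v \<in> B"
  then show "c v = 0"
    using indep [of c v] subspace_pvD(1) [OF coboundaries_subspace] by simp
qed (rule locfin)

definition Zinf :: "int \<Rightarrow> int \<Rightarrow> polyvec set" where
  "Zinf p q = Z_page L \<infinity> p q"

text \<open>Common kernel of the class maps of E_inf and G on the cocycles of bidegree (p,
  q).\<close>

definition N :: "int \<Rightarrow> int \<Rightarrow> polyvec set" where
  "N p q = Zinf (p + 1) (q - 1) + coboundaries L"

lemma Zinf_mem: "P \<in> Zinf p q \<longleftrightarrow> P \<in> K_filt p \<and> P \<in> cocycles L \<and> P \<in> K_deg (p + q)"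
  by (auto simp: Zinf_def)

lemma Zinf_next: "P \<in> Zinf (p + 1) (q - 1) \<longleftrightarrow> P \<in> K_filt (p + 1) \<and> P \<in> cocycles L \<and> P \<in> K_deg (p + q)"
  by (simp add: Zinf_mem)

lemma Zinf_subspace: "subspace_pv (Zinf p q)"
  unfolding Zinf_def Z_page.simps K_filt_def K_deg_def
  by (intro subspace_pv_Int supported_subspace cocycles_subspace)

lemma N_subspace: "subspace_pv (N p q)"
  unfolding N_def by (intro subspace_pv_plus Zinf_subspace coboundaries_subspace)

lemma K_filt_Suc: "K_filt (p + 1) \<subseteq> K_filt p"
  by (rule K_filt_mono) simp

lemma Zinf_Suc: "Zinf (p + 1) (q - 1) \<subseteq> Zinf p q"
proof
  fix P assume "P \<in> Zinf (p + 1) (q - 1)"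
  then show "P \<in> Zinf p q"
    unfolding Zinf_next unfolding Zinf_mem using subsetD [OF K_filt_Suc] by blast
qed

lemma E_denom_eq: "E_denom L \<infinity> p q = Zinf (p + 1) (q - 1) + (K_filt p \<inter> coboundaries L \<inter> K_deg (p + q))"
proof -
  have "(\<infinity> :: enat) - 1 = \<infinity>"
    by simp
  then show ?thesis
    unfolding E_denom_def Zinf_def by (simp only: B_page.simps)
qed

lemma E_denom_subspace: "subspace_pv (E_denom L \<infinity> p q)"
  unfolding E_denom_eq K_filt_def K_deg_def
  by (intro subspace_pv_plus Zinf_subspace subspace_pv_Int supported_subspace coboundaries_subspace)

text \<open>The coboundary in a decomposition of \<open>P\<close> is a difference of two elements of
  \<open>Zinf p q\<close>, so the filtration and degree conditions imposed on it in
  \<open>E_denom\<close> hold automatically.\<close>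

lemma E_denom_Zinf:
  assumes "P \<in> Zinf p q"
  shows "P \<in> E_denom L \<infinity> p q \<longleftrightarrow> P \<in> N p q"
proof
  show "P \<in> E_denom L \<infinity> p q \<Longrightarrow> P \<in> N p q"
    unfolding E_denom_eq N_def by (auto elim!: set_plus_elim intro: set_plus_intro)
  assume "P \<in> N p q"
  then obtain z w where P: "P = z + w" "z \<in> Zinf (p + 1) (q - 1)" "w \<in> coboundaries L"
    unfolding N_def by (auto elim: set_plus_elim)
  have "w = P - z"
    by (simp add: P(1))
  then have "w \<in> Zinf p q"
    using subspace_pvD(5) [OF Zinf_subspace assms] P(2) Zinf_Suc by blast
  then show "P \<in> E_denom L \<infinity> p q"
    unfolding E_denom_eq P(1) using P by (intro set_plus_intro) (auto simp: Zinf_mem)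
qed

lemma coh_class_eq: "coh_class L P = coh_class L Q \<longleftrightarrow> P - Q \<in> coboundaries L"
  unfolding coh_class_def by (rule coset_eq_iff [OF coboundaries_subspace])

lemma coh_class_add: "coh_class L (P + Q) = coh_class L P + coh_class L Q"
  unfolding coh_class_def by (rule coset_add [OF coboundaries_subspace, symmetric])

lemma coh_class_scale: "coh_scale L c (coh_class L P) = coh_class L (scale c P)"
  unfolding coh_class_def coh_scale_def by (rule coset_scale_eq [OF coboundaries_subspace])

lemma E_class_eq:
  assumes "P \<in> Zinf p q" "Q \<in> Zinf p q"
  shows "E_inf_class L p q P = E_inf_class L p q Q \<longleftrightarrow> P - Q \<in> N p q"
  unfolding E_inf_class_def coset_eq_iff [OF E_denom_subspace]
  by (rule E_denom_Zinf [OF subspace_pvD(5) [OF Zinf_subspace assms]])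

lemma coh_filt_eq: "coh_filt L (p + 1) (p + q) = coh_class L ` Zinf (p + 1) (q - 1)"
  unfolding coh_filt_def by (rule arg_cong [of _ _ "(`) _"]) (auto simp: Zinf_next)

lemma coh_filt_eq': "coh_filt L p (p + q) = coh_class L ` Zinf p q"
  unfolding coh_filt_def by (rule arg_cong [of _ _ "(`) _"]) (auto simp: Zinf_mem)

text \<open>A coset of cosets becomes the image of one coset of polyvector fields, so computations
  in G reduce to computations with cocycles.\<close>

lemma G_class_image: "G_class L p q P = coh_class L ` (P +o Zinf (p + 1) (q - 1))"
  unfolding G_class_def coh_filt_eq by (auto simp: elt_set_plus_def coh_class_add [symmetric])

lemma coh_class_image_add: "coh_class L ` S + coh_class L ` S' = coh_class L ` (S + S')"
proof
  show "coh_class L ` S + coh_class L ` S' \<subseteq> coh_class L ` (S + S')"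
    by (auto elim!: set_plus_elim simp: coh_class_add [symmetric] intro!: imageI set_plus_intro)
  show "coh_class L ` (S + S') \<subseteq> coh_class L ` S + coh_class L ` S'"
    by (auto elim!: set_plus_elim simp: coh_class_add intro!: imageI set_plus_intro)
qed

lemma G_class_eq: "G_class L p q P = G_class L p q Q \<longleftrightarrow> P - Q \<in> N p q"
proof
  assume eq: "G_class L p q P = G_class L p q Q"
  have "P \<in> P +o Zinf (p + 1) (q - 1)"
    unfolding coset_mem using subspace_pvD(1) [OF Zinf_subspace] by simp
  then have "coh_class L P \<in> G_class L p q Q"
    unfolding eq [symmetric] unfolding G_class_image by (rule imageI)
  then obtain z where z: "z \<in> Zinf (p + 1) (q - 1)" "coh_class L P = coh_class L (Q + z)"
    unfolding G_class_image by (auto simp: elt_set_plus_def)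
  have "P - Q = z + (P - (Q + z))"
    by simp
  also have "\<dots> \<in> N p q"
    unfolding N_def using z by (intro set_plus_intro) (simp_all only: coh_class_eq)
  finally show "P - Q \<in> N p q" .
next
  have *: "G_class L p q P \<subseteq> G_class L p q Q" if PQ: "P - Q \<in> N p q" for P Q
  proof
    fix A assume "A \<in> G_class L p q P"
    then obtain y where y: "y \<in> Zinf (p + 1) (q - 1)" "A = coh_class L (P + y)"
      unfolding G_class_image by (auto simp: elt_set_plus_def)
    obtain z w where zw: "P - Q = z + w" "z \<in> Zinf (p + 1) (q - 1)" "w \<in> coboundaries L"
      using PQ unfolding N_def by (auto elim: set_plus_elim)
    have "(P + y) - (Q + (z + y)) = (P - Q) - z"
      by simp
    also have "\<dots> = w"
      unfolding zw(1) by simp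
    finally have "A = coh_class L (Q + (z + y))"
      unfolding y(2) coh_class_eq using zw(3) by (simp only:)
    moreover have "Q + (z + y) \<in> Q +o Zinf (p + 1) (q - 1)"
      using subspace_pvD(2) [OF Zinf_subspace] zw(2) y(1) by (intro set_plus_intro2)
    ultimately show "A \<in> G_class L p q Q"
      unfolding G_class_image by blast
  qed
  assume "P - Q \<in> N p q"
  moreover from this have "Q - P \<in> N p q"
    using subspace_pvD(4) [OF N_subspace, of "P - Q"] by simp
  ultimately show "G_class L p q P = G_class L p q Q"
    using * by blast
qed

lemma G_class_add: "G_class L p q (P + Q) = G_class L p q P + G_class L p q Q"
  unfolding G_class_image coh_class_image_add coset_add [OF Zinf_subspace] ..

lemma G_class_scale: "G_scale L p q c (G_class L p q P) = G_class L p q (scale c P)"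
proof -
  let ?Z = "Zinf (p + 1) (q - 1)"
  have 1: "coh_scale L c ` coh_class L ` S = coh_class L ` (scale c ` S)" for S
    by (auto simp: image_image coh_class_scale)
  show ?thesis
    unfolding G_scale_def coset_scale_def coh_filt_eq G_class_image 1 coh_class_image_add
    using coset_scale_eq [OF Zinf_subspace, unfolded coset_scale_def] by (simp only:)
qed

lemma part_sub: "part_at B p q \<subseteq> B"
  by (auto simp: part_at_def)

lemma part_sum_Zinf: "formal_sum c (part_at B p q) \<in> Zinf p q"
  unfolding Zinf_mem
proof (intro conjI)
  show "formal_sum c (part_at B p q) \<in> K_filt p"
    unfolding K_filt_def by (rule formal_sum_supported) (auto simp: part_at_def K_filt_def)
  show "formal_sum c (part_at B p q) \<in> K_deg (p + q)"
    unfolding K_deg_def by (rule formal_sum_supported) (auto simp: part_at_def K_deg_def)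
  show "formal_sum c (part_at B p q) \<in> cocycles L"
    by (rule formal_sum_cocycle [OF part_sub])
qed

text \<open>Of the members spanning the class of \<open>P\<close>, those in step p + 1 sum to an
  element of \<open>N\<close>; those of level exactly p remain.\<close>

lemma part_span:
  assumes P: "P \<in> Zinf p q"
  shows "\<exists>c. P - formal_sum c (part_at B p q) \<in> N p q"
proof -
  let ?n = "p + q"
  obtain c where c: "P - formal_sum c (B \<inter> K_filt p \<inter> K_deg ?n) \<in> coboundaries L"
    using P span unfolding Zinf_mem by metis
  let ?S = "B \<inter> K_filt (p + 1) \<inter> K_deg ?n"
  let ?s1 = "formal_sum c (part_at B p q)" and ?s2 = "formal_sum c ?S"
  have "formal_sum c (B \<inter> K_filt p \<inter> K_deg ?n) = ?s1 + ?s2"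
  proof -
    have "formal_sum c (B \<inter> K_filt p \<inter> K_deg ?n) = formal_sum ((\<lambda>v. if v \<in> part_at B p q then c v else 0) + (\<lambda>v. if v \<in> ?S then c v else 0)) B"
      unfolding formal_sum_sub [of "B \<inter> K_filt p \<inter> K_deg ?n", OF Int_assoc [THEN equalityD1, THEN order_trans, OF Int_lower1]]
      by (rule formal_sum_cong) (use K_filt_Suc [of p] in \<open>auto simp: part_at_def\<close>)
    also have "\<dots> = ?s1 + ?s2"
      unfolding formal_sum_add formal_sum_sub [OF part_sub, symmetric]
      by (subst formal_sum_sub [of ?S]) auto
    finally show ?thesis .
  qed
  then have "P - ?s1 = ?s2 + (P - formal_sum c (B \<inter> K_filt p \<inter> K_deg ?n))"
    by simp
  moreover have "?s2 \<in> Zinf (p + 1) (q - 1)"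
    unfolding Zinf_next
  proof (intro conjI)
    show "?s2 \<in> K_filt (p + 1)"
      unfolding K_filt_def by (rule formal_sum_supported) (auto simp: K_filt_def)
    show "?s2 \<in> K_deg ?n"
      unfolding K_deg_def by (rule formal_sum_supported) (auto simp: K_deg_def)
    show "?s2 \<in> cocycles L"
      by (rule formal_sum_cocycle) auto
  qed
  ultimately show ?thesis
    unfolding N_def using c by (metis set_plus_intro)
qed

text \<open>A cocycle of step p + 1 is spanned by members of that step, which are disjoint from
  those of level exactly p. Independence then compares the coefficients.\<close>

lemma part_coeff_zero:
  assumes N: "formal_sum c (part_at B p q) \<in> N p q" and v: "v \<in> part_at B p q"
  shows "c v = 0"
proof -
  let ?n = "p + q" and ?S = "B \<inter> K_filt (p + 1) \<inter> K_deg (p + q)"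
  obtain z w where zw: "formal_sum c (part_at B p q) = z + w" "z \<in> Zinf (p + 1) (q - 1)" "w \<in> coboundaries L"
    using N unfolding N_def by (auto elim: set_plus_elim)
  obtain c' where c': "z - formal_sum c' ?S \<in> coboundaries L"
    using zw(2) span unfolding Zinf_next by metis
  let ?c1 = "\<lambda>v. if v \<in> part_at B p q then c v else 0" and ?c2 = "\<lambda>v. if v \<in> ?S then c' v else 0"
  have "formal_sum ?c1 B - formal_sum ?c2 B = (z - formal_sum c' ?S) + w"
  proof -
    have S: "?S \<subseteq> B"
      by blast
    show ?thesis
      unfolding formal_sum_sub [OF part_sub, symmetric] formal_sum_sub [OF S, symmetric] zw(1) by simp
  qed
  then have "formal_sum ?c1 B - formal_sum ?c2 B \<in> coboundaries L"
    using subspace_pvD(2) [OF coboundaries_subspace c' zw(3)] by simp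
  then have "?c1 v = ?c2 v"
    by (rule coeff_eq) (use v part_sub in auto)
  then show ?thesis
    using v by (auto simp: part_at_def)
qed

lemma part_coeff_eq:
  assumes "formal_sum c (part_at B p q) - formal_sum c' (part_at B p q) \<in> N p q" "v \<in> part_at B p q"
  shows "c v = c' v"
  using part_coeff_zero [of "\<lambda>v. c v - c' v" p q v] assms by (simp add: formal_sum_diff)

text \<open>E_inf and G enter only through their common kernel \<open>N\<close>, so one argument
  serves both.\<close>

lemma part_class:
  assumes "\<And>P Q. P \<in> Zinf p q \<Longrightarrow> Q \<in> Zinf p q \<Longrightarrow> cls P = cls Q \<longleftrightarrow> P - Q \<in> N p q"
  shows "represents (part_at B p q) cls (Zinf p q) (cls ` Zinf p q)"
  unfolding represents_def bij_betw_def
proof (intro conjI)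
  show sub: "formal_span (part_at B p q) \<subseteq> Zinf p q"
    using part_sum_Zinf by (auto simp: formal_span_def)
  show "inj_on cls (formal_span (part_at B p q))"
  proof (rule inj_onI)
    fix P Q assume PQ: "P \<in> formal_span (part_at B p q)" "Q \<in> formal_span (part_at B p q)" "cls P = cls Q"
    obtain c c' where c: "P = formal_sum c (part_at B p q)" "Q = formal_sum c' (part_at B p q)"
      using PQ(1,2) by (auto simp: formal_span_def)
    have "P - Q \<in> N p q"
      using assms PQ sub by blast
    then have "c v = c' v" if "v \<in> part_at B p q" for v
      using part_coeff_eq that unfolding c by blast
    then show "P = Q"
      unfolding c by (rule formal_sum_cong)
  qed
  show "cls ` formal_span (part_at B p q) = cls ` Zinf p q"
  proof
    show "cls ` formal_span (part_at B p q) \<subseteq> cls ` Zinf p q"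
      using sub by blast
    show "cls ` Zinf p q \<subseteq> cls ` formal_span (part_at B p q)"
    proof
      fix A assume "A \<in> cls ` Zinf p q"
      then obtain P where P: "P \<in> Zinf p q" "A = cls P"
        by blast
      obtain c where "P - formal_sum c (part_at B p q) \<in> N p q"
        using part_span [OF P(1)] by blast
      then have "A = cls (formal_sum c (part_at B p q))"
        using assms [OF P(1) part_sum_Zinf] P(2) by simp
      then show "A \<in> cls ` formal_span (part_at B p q)"
        by (auto simp: formal_span_def)
    qed
  qed
qed

lemma E_page_eq: "E_page L \<infinity> p q = E_inf_class L p q ` Zinf p q"
  unfolding E_page_def quot_def E_inf_class_def Zinf_def ..

lemma G_eq: "G L p q = G_class L p q ` Zinf p q"
  unfolding G_def quot_def coh_filt_eq' image_image G_class_def ..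

lemma cohomology_eq: "cohomology L = coh_class L ` cocycles L"
  unfolding cohomology_def quot_def coh_class_def ..

theorem system_of_representatives: "system_of_representatives L B"
  unfolding system_of_representatives_def
proof (intro conjI allI)
  show "formally_independent B"
    by (rule independent)
  show "represents (part_at B p q) (E_inf_class L p q) (Z_page L \<infinity> p q) (E_page L \<infinity> p q)" for p q
    unfolding E_page_eq Zinf_def [symmetric] by (rule part_class [OF E_class_eq])
  show "represents (part_at B p q) (G_class L p q) (Z_page L \<infinity> p q) (G L p q)" for p q
    unfolding G_eq Zinf_def [symmetric] by (rule part_class [OF G_class_eq])
  show "represents B (coh_class L) (cocycles L) (cohomology L)"
    unfolding represents_def bij_betw_def cohomology_eq
  proof (intro conjI)
    show sub: "formal_span B \<subseteq> cocycles L"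
      using cocyc by (auto simp: formal_span_def)
    show "inj_on (coh_class L) (formal_span B)"
    proof (rule inj_onI)
      fix P Q assume PQ: "P \<in> formal_span B" "Q \<in> formal_span B" "coh_class L P = coh_class L Q"
      obtain c c' where c: "P = formal_sum c B" "Q = formal_sum c' B"
        using PQ(1,2) by (auto simp: formal_span_def)
      have "c v = c' v" if "v \<in> B" for v
        using PQ(3) coeff_eq that unfolding c coh_class_eq by blast
      then show "P = Q"
        unfolding c by (rule formal_sum_cong)
    qed
    have "\<exists>c. coh_class L P = coh_class L (formal_sum c B)" if "P \<in> cocycles L" for P
      using span_all [OF that] by (simp add: coh_class_eq)
    then show "coh_class L ` formal_span B = coh_class L ` cocycles L"
      using sub by (auto simp: formal_span_def image_iff)
  qed
qed

lemma part_at_unique: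
  assumes "v \<in> part_at B p q" "v \<in> part_at B p' q'"
  shows "p = p' \<and> q = q'"
proof -
  have v: "v \<in> K_filt p" "v \<notin> K_filt (p + 1)" "v \<in> K_filt p'" "v \<notin> K_filt (p' + 1)"
    "v \<in> K_deg (p + q)" "v \<in> K_deg (p' + q')"
    using assms by (auto simp: part_at_def)
  have "p = p'"
    proof (rule ccontr)
    assume "p \<noteq> p'"
    then consider "p + 1 \<le> p'" | "p' + 1 \<le> p"
      by linarith
    then show False
      by cases (use v K_filt_mono in blast)+
  qed
  \<comment> \<open>Being outside step p + 1, \<open>v\<close> has a nonzero coefficient, and this
    coefficient fixes the degree.\<close>
  moreover have "p + q = p' + q'"
    using v(2,5,6) unfolding K_filt_def K_deg_def supported_iff by auto
  ultimately show ?thesis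
    by simp
qed

theorem limit_isomorphic: "limit_isomorphic L B"
  unfolding limit_isomorphic_def
proof (intro conjI allI)
  fix p q
  have "\<exists>\<phi>. linear_iso (E_inf_scale L p q) (G_scale L p q) (E_page L \<infinity> p q) (G L p q) \<phi> \<and>
      (\<forall>P\<in>Zinf p q. \<phi> (E_inf_class L p q P) = G_class L p q P)"
  proof (rule transport_iso [OF E_page_eq G_eq, where m = scale])
    fix P Q assume PQ: "P \<in> Zinf p q" "Q \<in> Zinf p q"
    show "E_inf_class L p q P = E_inf_class L p q Q \<longleftrightarrow> G_class L p q P = G_class L p q Q"
      unfolding E_class_eq [OF PQ] G_class_eq ..
    show "P + Q \<in> Zinf p q \<and> E_inf_class L p q (P + Q) = E_inf_class L p q P + E_inf_class L p q Q \<and>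
        G_class L p q (P + Q) = G_class L p q P + G_class L p q Q"
      using subspace_pvD(2) [OF Zinf_subspace PQ] G_class_add coset_add [OF E_denom_subspace]
      by (simp add: E_inf_class_def)
  next
    fix c P assume P: "P \<in> Zinf p q"
    show "scale c P \<in> Zinf p q \<and> E_inf_class L p q (scale c P) = E_inf_scale L p q c (E_inf_class L p q P) \<and>
        G_class L p q (scale c P) = G_scale L p q c (G_class L p q P)"
      using subspace_pvD(3) [OF Zinf_subspace P] G_class_scale coset_scale_eq [OF E_denom_subspace]
      by (simp add: E_inf_class_def E_inf_scale_def)
  qed
  then show "\<exists>\<phi>. linear_iso (E_inf_scale L p q) (G_scale L p q) (E_page L \<infinity> p q) (G L p q) \<phi> \<and>
      (\<forall>c. \<phi> (E_inf_class L p q (formal_sum c (part_at B p q))) = G_class L p q (formal_sum c (part_at B p q)))"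
    using part_sum_Zinf by meson
next
  let ?g = "\<lambda>c p q. G_class L p q (formal_sum c (part_at B p q))" and ?h = "\<lambda>c. coh_class L (formal_sum c B)"
  \<comment> \<open>Both spaces are parametrised by all coefficient functions on \<open>B\<close>,
    with the functions vanishing on \<open>B\<close> as kernel.\<close>
  have "\<exists>\<psi>. linear_iso (G_total_scale L) (coh_scale L) (G_total L) (cohomology L) \<psi> \<and> (\<forall>c\<in>UNIV. \<psi> (?g c) = ?h c)"
  proof (rule transport_iso [where m = "\<lambda>r c v. r * c v"])
    show "G_total L = range ?g"
    proof
      show "range ?g \<subseteq> G_total L"
        using part_sum_Zinf by (auto simp: G_total_def G_eq)
      show "G_total L \<subseteq> range ?g"
      proof
        fix g assume g: "g \<in> G_total L"
        have "\<exists>c. g p q = G_class L p q (formal_sum c (part_at B p q))" for p q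
        proof -
          obtain P where "P \<in> Zinf p q" "g p q = G_class L p q P"
            using g unfolding G_total_def G_eq by blast
          then show ?thesis
            using part_span [of P p q] by (simp add: G_class_eq)
        qed
        then obtain C where C: "g p q = G_class L p q (formal_sum (C p q) (part_at B p q))" for p q
          by metis
        \<comment> \<open>The coefficients chosen bidegree by bidegree glue, since a member of
          \<open>B\<close> belongs to exactly one part.\<close>
        define c where "c v = (let (p, q) = (SOME (p, q). v \<in> part_at B p q) in C p q v)" for v
        have "c v = C p q v" if v: "v \<in> part_at B p q" for p q v
        proof -
          have "(SOME (p, q). v \<in> part_at B p q) = (p, q)"
            by (rule some_equality) (use v part_at_unique in auto)
          then show ?thesis
            by (simp add: c_def)
        qed
        then have "formal_sum c (part_at B p q) = formal_sum (C p q) (part_at B p q)" for p q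
          by (rule formal_sum_cong)
        then have "g = ?g c"
          using C by (intro ext) simp
        then show "g \<in> range ?g"
          by (simp only: image_iff) blast
      qed
    qed
    show "cohomology L = range ?h"
      unfolding cohomology_eq using cocyc span_all by (auto simp: coh_class_eq image_iff)
  next
    fix c c' :: "polyvec \<Rightarrow> real"
    have "?h c = ?h c' \<longleftrightarrow> (\<forall>v\<in>B. c v = c' v)"
    proof
      show "?h c = ?h c' \<Longrightarrow> \<forall>v\<in>B. c v = c' v"
        unfolding coh_class_eq using coeff_eq by blast
      show "\<forall>v\<in>B. c v = c' v \<Longrightarrow> ?h c = ?h c'"
        using formal_sum_cong [of B c c'] by simp
    qed
    moreover have "?g c = ?g c' \<longleftrightarrow> (\<forall>v\<in>B. c v = c' v)"
    proof
      assume eq: "?g c = ?g c'"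
      show "\<forall>v\<in>B. c v = c' v"
      proof
        fix v assume "v \<in> B"
        then obtain p q where v: "v \<in> part_at B p q"
          using homog by blast
        have "G_class L p q (formal_sum c (part_at B p q)) = G_class L p q (formal_sum c' (part_at B p q))"
          using eq by (simp add: fun_eq_iff)
        then show "c v = c' v"
          unfolding G_class_eq using part_coeff_eq v by blast
      qed
    next
      assume eq: "\<forall>v\<in>B. c v = c' v"
      have "formal_sum c (part_at B p q) = formal_sum c' (part_at B p q)" for p q
        by (rule formal_sum_cong) (use eq part_sub in blast)
      then show "?g c = ?g c'"
        by simp
    qed
    ultimately show "?g c = ?g c' \<longleftrightarrow> ?h c = ?h c'"
      by simp
    show "c + c' \<in> UNIV \<and> ?g (c + c') = ?g c + ?g c' \<and> ?h (c + c') = ?h c + ?h c'"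
      by (simp only: formal_sum_add G_class_add coh_class_add) (simp add: plus_fun_def)
  next
    fix r :: real and c :: "polyvec \<Rightarrow> real"
    show "(\<lambda>v. r * c v) \<in> UNIV \<and> ?g (\<lambda>v. r * c v) = G_total_scale L r (?g c) \<and> ?h (\<lambda>v. r * c v) = coh_scale L r (?h c)"
      by (simp add: formal_sum_scale G_total_scale_def G_class_scale coh_class_scale)
  qed
  then show "\<exists>\<psi>. linear_iso (G_total_scale L) (coh_scale L) (G_total L) (cohomology L) \<psi> \<and>
      (\<forall>c. \<psi> (\<lambda>p q. G_class L p q (formal_sum c (part_at B p q))) = coh_class L (formal_sum c B))"
    by simp
qed

end

section \<open>The systems of representatives\<close>

lemma wedge_add:
  "wedge (P + P') Q = wedge P Q + wedge P' Q" "wedge P (Q + Q') = wedge P Q + wedge P Q'"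
  by (rule ext, simp add: wedge_def distrib_left distrib_right sum.distrib)+

lemma wedge_scale: "wedge P (scale c Q) = scale c (wedge P Q)"
  by (rule ext) (simp add: wedge_def scale_apply sum_distrib_left ac_simps)

lemma deriv_add:
  "odd_deriv_left l (P + Q) = odd_deriv_left l P + odd_deriv_left l Q"
  "even_deriv l (P + Q) = even_deriv l P + even_deriv l Q"
  by (rule ext, simp add: odd_deriv_left_def even_deriv_def partial_deriv_add distrib_left)+

lemma deriv_scale:
  "odd_deriv_left l (scale c P) = scale c (odd_deriv_left l P)"
  "even_deriv l (scale c P) = scale c (even_deriv l P)"
  by (rule ext, simp add: odd_deriv_left_def even_deriv_def scale_apply partial_deriv_mult)+

lemma schouten_add: "schouten L (P + Q) = schouten L P + schouten L Q"
  unfolding schouten_def deriv_add wedge_add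
  by (simp only: sum.distrib [symmetric] add_diff_add)

lemma scale_sum: "scale c (sum f S) = (\<Sum>x\<in>S. scale c (f x))"
proof (induction S rule: infinite_finite_induct)
  case (insert x F)
  then show ?case
    by (simp only: sum.insert scale_add not_False_eq_True)
qed (simp_all only: sum.infinite sum.empty scale_zero not_False_eq_True)

lemma schouten_scale: "schouten L (scale c P) = scale c (schouten L P)"
  unfolding schouten_def deriv_scale wedge_scale scale_sum scale_diff ..

lemma polyvecs_zero: "P \<in> polyvecs \<Longrightarrow> \<not> I \<subseteq> {1, 2, 3} \<Longrightarrow> P I = 0"
  unfolding polyvecs_def by blast

lemma polyvecsI: "(\<And>I. \<not> I \<subseteq> {1, 2, 3} \<Longrightarrow> P I = 0) \<Longrightarrow> P \<in> polyvecs"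
  unfolding polyvecs_def by blast

lemma wedge_polyvecs:
  assumes "P \<in> polyvecs" "Q \<in> polyvecs"
  shows "wedge P Q \<in> polyvecs"
proof (rule polyvecsI)
  fix K :: "nat set" assume K: "\<not> K \<subseteq> {1, 2, 3}"
  show "wedge P Q K = 0"
    unfolding wedge_def
  proof (rule sum.neutral, rule ballI)
    fix I assume "I \<in> Pow K"
    with K have "\<not> I \<subseteq> {1, 2, 3} \<or> \<not> K - I \<subseteq> {1, 2, 3}"
      by blast
    then show "shuffle_sign I (K - I) * P I * Q (K - I) = 0"
    proof
      assume "\<not> I \<subseteq> {1, 2, 3}"
      then have "P I = 0"
        by (rule polyvecs_zero [OF assms(1)])
      then show ?thesis
        by simp
    next
      assume "\<not> K - I \<subseteq> {1, 2, 3}"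
      then have "Q (K - I) = 0"
        by (rule polyvecs_zero [OF assms(2)])
      then show ?thesis
        by simp
    qed
  qed
qed

lemma deriv_polyvecs:
  assumes "P \<in> polyvecs"
  shows "odd_deriv_left l P \<in> polyvecs" "odd_deriv_right l P \<in> polyvecs" "even_deriv l P \<in> polyvecs"
proof -
  have 1: "P (insert l I) = 0" if "\<not> I \<subseteq> {1, 2, 3}" for I
    by (rule polyvecs_zero [OF assms]) (use that in blast)
  show "odd_deriv_left l P \<in> polyvecs" "odd_deriv_right l P \<in> polyvecs"
    by (rule polyvecsI, simp only: odd_deriv_left_def odd_deriv_right_def 1 mult_zero_right if_cancel not_False_eq_True)+
  show "even_deriv l P \<in> polyvecs"
    by (rule polyvecsI) (simp only: even_deriv_def polyvecs_zero [OF assms] partial_deriv_zero not_False_eq_True)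
qed

lemma mul_polyvecs: "P \<in> polyvecs \<Longrightarrow> f \<odot> P \<in> polyvecs"
  by (rule polyvecsI) (simp only: mul_def polyvecs_zero mult_zero_right not_False_eq_True)

lemma pd_polyvecs: "l \<in> {1, 2, 3} \<Longrightarrow> pd l \<in> polyvecs"
proof (rule polyvecsI)
  fix I :: "nat set" assume "l \<in> {1, 2, 3}" "\<not> I \<subseteq> {1, 2, 3}"
  then have "I \<noteq> {l}"
    by blast
  then show "pd l I = 0"
    unfolding pd_def by (rule if_not_P)
qed

lemma Lambda4_polyvecs: "Lambda4 a b \<in> polyvecs"
  unfolding Lambda4_def
  by (intro subspace_pvD(2) [OF polyvecs_subspace] mul_polyvecs wedge_polyvecs pd_polyvecs) simp_all

lemma schouten_polyvecs:
  assumes "L \<in> polyvecs" "P \<in> polyvecs"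
  shows "schouten L P \<in> polyvecs"
proof -
  have "odd_deriv_right l L \<^bold>\<and> even_deriv l P - even_deriv l L \<^bold>\<and> odd_deriv_left l P \<in> polyvecs" for l
    by (intro subspace_pvD(5) [OF polyvecs_subspace] wedge_polyvecs deriv_polyvecs assms)
  then show ?thesis
    unfolding schouten_def
    by (simp only: sum.insert finite.intros sum.empty insert_iff empty_iff numeral_eq_one_iff
        num.distinct numeral_eq_iff num.inject one_eq_numeral_iff simp_thms not_False_eq_True
        subspace_pvD(1,2) [OF polyvecs_subspace])
qed

lemma polyvec_co_eqI: "P \<in> polyvecs \<Longrightarrow> Q \<in> polyvecs \<Longrightarrow> co P = co Q \<Longrightarrow> P = Q"
  by (metis mk_co)

lemma polyvecs_supported: "polyvecs = supported UNIV"
  unfolding supported_def by blast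

text \<open>\<open>y\<^sup>k \<partial>\<^sub>3\<^sub>1\<close> is stored as \<open>- y\<^sup>k\<close> times the increasing product \<open>\<partial>\<^sub>1\<^sub>3\<close>.\<close>

definition sgn_at :: "idx \<Rightarrow> real" where
  "sgn_at = (\<lambda>(I, i, j, k). if I = B13 \<and> i = 0 then - 1 else 1)"

definition rep :: "real \<Rightarrow> real \<Rightarrow> idx \<Rightarrow> polyvec" where
  "rep a b t = scale (sgn_at t) (elt a b t)"

lemma sgn_at_square: "sgn_at t * sgn_at t = 1"
  by (cases t rule: prod_cases4) (simp add: sgn_at_def)

lemma sgn_at_nz: "sgn_at t \<noteq> 0"
  using sgn_at_square [of t] by auto

lemma co_rep: "co (rep a b t) s = sgn_at t * co (elt a b t) s"
  by (simp add: rep_def co_scale)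

lemma rep_polyvecs: "rep a b t \<in> polyvecs"
  unfolding rep_def by (rule subspace_pvD(3) [OF polyvecs_subspace elt_polyvecs])

context
  fixes a b :: real
  assumes a: "a \<noteq> 0" and b: "b \<noteq> 0"
begin

interpretation M: matched_complex allowed cdeg flev "diff a b" "lead_diff a b" "contraction a b" "harm a b"
  "killers a b" "\<lambda>t. co (elt a b t)" kill "kill_coeff a b"
  by (rule lambda4_complex [OF a b])

lemma rep_support:
  assumes "t \<in> harm a b" "co (rep a b t) s \<noteq> 0"
  shows "cdeg s = cdeg t \<and> (s = t \<or> flev t < flev s)"
proof -
  have "co (elt a b t) s \<noteq> 0"
    using assms(2) unfolding co_rep by simp
  then show ?thesis
    by (rule elt_support [OF a b assms(1)])
qed

lemma co_rep_lead: "t \<in> harm a b \<Longrightarrow> co (rep a b t) t = sgn_at t"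
  by (simp add: co_rep elt_lead [OF a b])

text \<open>If two representatives coincide, the leading index of each lies in the support of the
  other; were the indices different, each would have the larger level.\<close>

lemma rep_inj: "inj_on (rep a b) (harm a b)"
proof (rule inj_onI)
  fix t s assume ts: "t \<in> harm a b" "s \<in> harm a b" "rep a b t = rep a b s"
  have "co (rep a b s) t \<noteq> 0"
    unfolding ts(3) [symmetric] co_rep_lead [OF ts(1)] by (rule sgn_at_nz)
  moreover have "co (rep a b t) s \<noteq> 0"
    unfolding ts(3) co_rep_lead [OF ts(2)] by (rule sgn_at_nz)
  ultimately have "t = s \<or> flev s < flev t" "s = t \<or> flev t < flev s"
    using rep_support [OF ts(1)] rep_support [OF ts(2)] by blast+
  then show "t = s"
    using less_asym by blast
qed

lemma co_rep_nth:
  "rep a b t (st I) $ i $ j $ k = co (rep a b t) (I, i + o1 I, j + o2 I, k + o3 I)"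
proof -
  have "(I, i + o1 I, j + o2 I, k + o3 I) \<in> allowed"
    by (simp add: allowed_def)
  then show ?thesis
    by (simp only: co_coeff if_True add_diff_cancel_right')
qed

lemma finite_rep:
  assumes "J \<subseteq> harm a b"
  shows "finite {t \<in> J. co (rep a b t) s \<noteq> 0}"
proof (rule finite_subset)
  show "{t \<in> J. co (rep a b t) s \<noteq> 0} \<subseteq> {t \<in> allowed. cdeg t = cdeg s}"
  proof
    fix t assume t: "t \<in> {t \<in> J. co (rep a b t) s \<noteq> 0}"
    then have h: "t \<in> harm a b" and nz: "co (rep a b t) s \<noteq> 0"
      using assms by blast+
    have "cdeg t = cdeg s"
      using rep_support [OF h nz] by (simp only:)
    then show "t \<in> {t \<in> allowed. cdeg t = cdeg s}"
      using h subsetD [OF harm_allowed [OF a b]] by (simp only: mem_Collect_eq simp_thms)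
  qed
qed (rule finite_cdeg)

lemma rep_locfin:
  assumes J: "J \<subseteq> harm a b"
  shows "finite {v \<in> rep a b ` J. v I $ i $ j $ k \<noteq> 0}"
proof (cases "I \<subseteq> {1, 2, 3}")
  case True
  then obtain c where c: "I = st c"
    unfolding subset_123 by blast
  have "{v \<in> rep a b ` J. v I $ i $ j $ k \<noteq> 0} \<subseteq> rep a b ` {t \<in> J. co (rep a b t) (c, i + o1 c, j + o2 c, k + o3 c) \<noteq> 0}"
  proof
    fix v assume "v \<in> {v \<in> rep a b ` J. v I $ i $ j $ k \<noteq> 0}"
    then obtain t where t: "v = rep a b t" "t \<in> J" "rep a b t (st c) $ i $ j $ k \<noteq> 0"
      unfolding c by blast
    then show "v \<in> rep a b ` {t \<in> J. co (rep a b t) (c, i + o1 c, j + o2 c, k + o3 c) \<noteq> 0}"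
      unfolding co_rep_nth by blast
  qed
  then show ?thesis
    by (rule finite_subset) (rule finite_imageI [OF finite_rep [OF J]])
next
  case False
  have "v I $ i $ j $ k = 0" if v: "v \<in> rep a b ` J" for v
  proof -
    have "v \<in> polyvecs"
      using v rep_polyvecs by blast
    then have "v I = 0"
      using False by (rule polyvecs_zero)
    then show ?thesis
      by simp
  qed
  then have "{v \<in> rep a b ` J. v I $ i $ j $ k \<noteq> 0} = {}"
    by blast
  then show ?thesis
    by (simp only: finite.emptyI)
qed

text \<open>Formal sums run over a set of fields, \<open>\<Phi>\<close> over leading indices.
  Injectivity of \<open>rep\<close> reindexes the sum, and indices whose field has coefficient 0 at
  \<open>s\<close> are added freely.\<close>

lemma co_formal_sum:
  assumes J: "J \<subseteq> harm a b"
  shows "co (formal_sum c (rep a b ` J)) = M.\<Phi> (\<lambda>t. if t \<in> J then c (rep a b t) * sgn_at t else 0)"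
proof
  fix s :: idx
  obtain I i j k where s: "s = (I, i, j, k)"
    by (metis prod_cases4)
  let ?c = "\<lambda>t. if t \<in> J then c (rep a b t) * sgn_at t else 0"
  show "co (formal_sum c (rep a b ` J)) s = M.\<Phi> ?c s"
  proof (cases "s \<in> allowed")
    case False
    show ?thesis
      unfolding supported_onD [OF co_supported False] supported_onD [OF M.\<Phi>_closed False] ..
  next
    case True
    let ?n = "\<lambda>v::polyvec. v (st I) $ (i - o1 I) $ (j - o2 I) $ (k - o3 I)"
    have n: "?n (rep a b t) = co (rep a b t) s" for t
      using True unfolding s co_coeff by (simp only: if_True)
    have "co (formal_sum c (rep a b ` J)) s = (\<Sum>v\<in>{v \<in> rep a b ` J. ?n v \<noteq> 0}. c v * ?n v)"
      using True unfolding s co_coeff formal_sum_nth by (simp only: if_True)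
    also have "{v \<in> rep a b ` J. ?n v \<noteq> 0} = rep a b ` {t \<in> J. co (rep a b t) s \<noteq> 0}"
      unfolding n [symmetric] by blast
    also have "(\<Sum>v\<in>rep a b ` {t \<in> J. co (rep a b t) s \<noteq> 0}. c v * ?n v) =
        (\<Sum>t\<in>{t \<in> J. co (rep a b t) s \<noteq> 0}. c (rep a b t) * co (rep a b t) s)"
    proof -
      have "inj_on (rep a b) {t \<in> J. co (rep a b t) s \<noteq> 0}"
        by (rule inj_on_subset [OF rep_inj]) (use J in blast)
      then show ?thesis
        by (simp only: sum.reindex o_def n)
    qed
    also have "\<dots> = (\<Sum>t | t \<in> harm a b \<and> cdeg t = cdeg s. ?c t * co (elt a b t) s)"
    proof (rule sum.mono_neutral_cong_left)
      show "finite {t. t \<in> harm a b \<and> cdeg t = cdeg s}"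
        by (rule M.finH)
      show "{t \<in> J. co (rep a b t) s \<noteq> 0} \<subseteq> {t. t \<in> harm a b \<and> cdeg t = cdeg s}"
      proof
        fix t assume "t \<in> {t \<in> J. co (rep a b t) s \<noteq> 0}"
        then have h: "t \<in> harm a b" and nz: "co (rep a b t) s \<noteq> 0"
          using J by blast+
        then show "t \<in> {t. t \<in> harm a b \<and> cdeg t = cdeg s}"
          using rep_support [OF h nz] by (simp only: mem_Collect_eq simp_thms)
      qed
      show "\<forall>t\<in>{t. t \<in> harm a b \<and> cdeg t = cdeg s} - {t \<in> J. co (rep a b t) s \<noteq> 0}. ?c t * co (elt a b t) s = 0"
        by (simp add: co_rep)
      show "c (rep a b t) * co (rep a b t) s = ?c t * co (elt a b t) s" if "t \<in> {t \<in> J. co (rep a b t) s \<noteq> 0}" for t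
        using that by (simp add: co_rep)
    qed
    finally show ?thesis
      unfolding M.\<Phi>_def .
  qed
qed

lemma free_harm: "M.free \<subseteq> harm a b"
  by (auto simp: M.free_def)

lemma formal_sum_polyvecs: "formal_sum c (rep a b ` J) \<in> polyvecs"
  unfolding polyvecs_supported
  by (rule formal_sum_supported) (use rep_polyvecs polyvecs_supported in auto)

lemma cocycle_co: "P \<in> cocycles (Lambda4 a b) \<Longrightarrow> P \<in> polyvecs \<and> diff a b (co P) = 0"
proof -
  assume "P \<in> cocycles (Lambda4 a b)"
  then have "P \<in> polyvecs" "schouten (Lambda4 a b) P = 0"
    by (auto simp: cocycles_def)
  moreover have "co 0 = 0"
    by (rule idx_eqI) (simp add: co_coeff)
  ultimately show ?thesis
    using co_schouten [of a b P] by simp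
qed

text \<open>Turns coefficients on indices into coefficients on fields; the sign is its own
  inverse.\<close>

definition rep_coeff :: "(idx \<Rightarrow> real) \<Rightarrow> polyvec \<Rightarrow> real" where
  "rep_coeff c v = (let t = inv_into M.free (rep a b) v in sgn_at t * c t)"

lemma rep_coeff_rep: "t \<in> M.free \<Longrightarrow> rep_coeff c (rep a b t) = sgn_at t * c t"
  using inv_into_f_f [OF inj_on_subset [OF rep_inj free_harm]] by (simp add: rep_coeff_def Let_def)

lemma co_formal_sum_rep_coeff:
  assumes "c \<in> supported_on M.free"
  shows "co (formal_sum (rep_coeff c) (rep a b ` M.free)) = M.\<Phi> c"
proof -
  have "(\<lambda>t. if t \<in> M.free then rep_coeff c (rep a b t) * sgn_at t else 0) = c"
    using assms by (auto simp: rep_coeff_rep supported_on_def fun_eq_iff mult.commute mult.left_commute sgn_at_square)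
  then show ?thesis
    unfolding co_formal_sum [OF free_harm] by simp
qed

lemma coboundaryI:
  assumes "P \<in> polyvecs" "S \<in> polyvecs" "Q \<in> supported_on allowed" "co P = co S + diff a b Q"
  shows "P - S \<in> coboundaries (Lambda4 a b)"
proof -
  have "co (P - S) t = co P t - co S t" for t
    using co_add [of "P - S" S t] by simp
  then have "co (P - S) = diff a b Q"
    using assms(4) by (simp add: fun_eq_iff)
  also have "\<dots> = co (schouten (Lambda4 a b) (mk Q))"
    unfolding co_schouten co_mk [OF assms(3)] ..
  finally have "P - S = schouten (Lambda4 a b) (mk Q)"
    by (intro polyvec_co_eqI subspace_pvD(5) [OF polyvecs_subspace] assms schouten_polyvecs Lambda4_polyvecs mk_polyvecs)
  then show ?thesis
    unfolding coboundaries_def using mk_polyvecs by blast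
qed

lemma rep_K:
  assumes t: "(I, i, j, k) \<in> harm a b"
  shows "rep a b (I, i, j, k) \<in> K_deg (int (cdeg (I, i, j, k)))" "rep a b (I, i, j, k) \<in> K_filt p \<longleftrightarrow> p \<le> int k"
proof -
  have *: "cdeg s = cdeg (I, i, j, k) \<and> k \<le> (case s of (I', i', j', k') \<Rightarrow> k')" if "co (rep a b (I, i, j, k)) s \<noteq> 0" for s
    using rep_support [OF t that] by (cases s rule: prod_cases4) (auto simp: flev_def split: if_splits)
  show "rep a b (I, i, j, k) \<in> K_deg (int (cdeg (I, i, j, k)))"
    unfolding K_deg_def supported_iff using rep_polyvecs * by (force simp: cdeg_def)
  show "rep a b (I, i, j, k) \<in> K_filt p \<longleftrightarrow> p \<le> int k"
  proof
    assume "rep a b (I, i, j, k) \<in> K_filt p"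
    moreover have "co (rep a b (I, i, j, k)) (I, i, j, k) \<noteq> 0"
      using co_rep_lead [OF t] sgn_at_nz by simp
    ultimately show "p \<le> int k"
      unfolding K_filt_def supported_iff by blast
  next
    assume "p \<le> int k"
    then show "rep a b (I, i, j, k) \<in> K_filt p"
      unfolding K_filt_def supported_iff using rep_polyvecs * by force
  qed
qed

lemma lambda4_family: "adapted_family (Lambda4 a b) (rep a b ` (harm a b - killers a b - kill ` killers a b))"
  unfolding M.free_def [symmetric]
proof
  let ?L = "Lambda4 a b" and ?B = "rep a b ` M.free"
  show "schouten ?L (P + Q) = schouten ?L P + schouten ?L Q" for P Q
    by (rule schouten_add)
  show "schouten ?L (scale r P) = scale r (schouten ?L P)" for r P
    by (rule schouten_scale)
  show "finite {v \<in> ?B. v I $ i $ j $ k \<noteq> 0}" for I i j k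
    by (rule rep_locfin [OF free_harm])
  show "\<exists>p q. v \<in> part_at ?B p q" if v: "v \<in> ?B" for v
  proof -
    obtain I i j k where t: "(I, i, j, k) \<in> M.free" "v = rep a b (I, i, j, k)"
      using v by auto
    then have "v \<in> part_at ?B (int k) (int (cdeg (I, i, j, k)) - int k)"
      using v rep_K [of I i j k] free_harm by (auto simp: part_at_def)
    then show ?thesis
      by blast
  qed
  show "formal_sum c ?B \<in> cocycles ?L" for c
  proof -
    let ?c = "\<lambda>t. if t \<in> M.free then c (rep a b t) * sgn_at t else 0"
    have "?c \<in> supported_on M.free"
      by (simp add: supported_on_def)
    then have "co (schouten ?L (formal_sum c ?B)) = 0"
      unfolding co_schouten co_formal_sum [OF free_harm] by (rule M.\<Phi>_cocycle)
    moreover have "co 0 = 0"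
      by (rule idx_eqI) (simp add: co_coeff)
    ultimately have "schouten ?L (formal_sum c ?B) = 0"
      using subspace_pvD(1) [OF polyvecs_subspace]
      by (intro polyvec_co_eqI schouten_polyvecs Lambda4_polyvecs formal_sum_polyvecs) simp_all
    then show ?thesis
      by (simp add: cocycles_def formal_sum_polyvecs)
  qed
  show "\<exists>c. P - formal_sum c ?B \<in> coboundaries ?L" if P: "P \<in> cocycles ?L" for P
  proof -
    have "vanish_below flev 0 (co P)"
      by (simp add: vanish_below_def)
    from M.spanning_classes [OF co_supported this conjunct2 [OF cocycle_co [OF P]]] obtain c Q where
      *: "c \<in> supported_on M.free" "Q \<in> supported_on allowed" "co P = M.\<Phi> c + diff a b Q"
      by metis
    have "P - formal_sum (rep_coeff c) ?B \<in> coboundaries ?L"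
      using cocycle_co [OF P] * by (intro coboundaryI formal_sum_polyvecs) (auto simp: co_formal_sum_rep_coeff)
    then show ?thesis
      by (rule exI [of _ "rep_coeff c"])
  qed
  show "\<exists>c. P - formal_sum c (?B \<inter> K_filt p \<inter> K_deg n) \<in> coboundaries ?L"
    if P: "P \<in> cocycles ?L" "P \<in> K_filt p" "P \<in> K_deg n" for P p n
  proof -
    \<comment> \<open>An exponent k of z at least p means \<open>flev\<close> at least 2p, as the
      half step is never negative; \<open>nat\<close> takes care of p < 0.\<close>
    have 1: "vanish_below flev (2 * nat p) (co P)"
      unfolding vanish_below_def
    proof (intro allI impI)
      fix s assume s: "flev s < 2 * nat p"
      obtain I i j k where t: "s = (I, i, j, k)"
        by (metis prod_cases4)
      show "co P s = 0"
      proof (rule ccontr)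
        assume "co P s \<noteq> 0"
        then have "p \<le> int k"
          using P(2) unfolding K_filt_def supported_iff t by blast
        then show False
          using s by (auto simp: t flev_def)
      qed
    qed
    have 2: "co P s = 0" if "cdeg s \<noteq> nat n" for s
    proof (rule ccontr)
      assume nz: "co P s \<noteq> 0"
      obtain I i j k where t: "s = (I, i, j, k)"
        by (metis prod_cases4)
      have "int (i + j + card (st I)) + int k = n"
        using P(3) nz unfolding K_deg_def supported_iff t by blast
      then show False
        using that by (auto simp: t cdeg_def)
    qed
    obtain c Q where
      *: "c \<in> supported_on M.free" "vanish_below flev (2 * nat p) c" "\<And>s. cdeg s \<noteq> nat n \<Longrightarrow> c s = 0"
      "Q \<in> supported_on allowed" "co P = M.\<Phi> c + diff a b Q"
    proof (rule M.spanning_classes_deg [OF co_supported 1 2 conjunct2 [OF cocycle_co [OF P(1)]]])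
      fix c Q
      assume h: "c \<in> supported_on M.free" "vanish_below flev (2 * nat p) c" "\<And>s. cdeg s \<noteq> nat n \<Longrightarrow> c s = 0"
        "Q \<in> supported_on allowed" "co P = M.\<Phi> c + diff a b Q"
      show thesis
        by (rule that [OF h])
    qed
    \<comment> \<open>Members with nonzero coefficient already satisfy the restrictions, so the sum
      over all of \<open>?B\<close> equals the restricted one.\<close>
    have "v \<in> K_filt p \<and> v \<in> K_deg n" if v: "v \<in> ?B" "rep_coeff c v \<noteq> 0" for v
    proof -
      obtain I i j k where t: "(I, i, j, k) \<in> M.free" "v = rep a b (I, i, j, k)"
        using v by auto
      have nz: "c (I, i, j, k) \<noteq> 0"
        using v(2) rep_coeff_rep [OF t(1)] by (auto simp: t(2))
      then have "\<not> flev (I, i, j, k) < 2 * nat p" "cdeg (I, i, j, k) = nat n"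
        using *(2,3) unfolding vanish_below_def by blast+
      \<comment> \<open>For negative n, \<open>nat n\<close> is 0; a positive degree rules this
        out.\<close>
      moreover have "0 < cdeg (I, i, j, k)"
        using t(1) free_harm by (cases I) (auto simp: cdeg_simps harm_def allowed_def)
      ultimately have "p \<le> int k" "int (cdeg (I, i, j, k)) = n"
        by (auto simp: flev_def split: if_splits)
      then show ?thesis
        using rep_K [of I i j k] t free_harm by auto
    qed
    then have z: "(if v \<in> ?B \<inter> K_filt p \<inter> K_deg n then rep_coeff c v else 0) = rep_coeff c v" if "v \<in> ?B" for v
      using that by (cases "rep_coeff c v = 0") (simp_all only: if_cancel Int_iff simp_thms if_True)
    have "formal_sum (rep_coeff c) (?B \<inter> K_filt p \<inter> K_deg n) =
        formal_sum (\<lambda>v. if v \<in> ?B \<inter> K_filt p \<inter> K_deg n then rep_coeff c v else 0) ?B"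
      by (rule formal_sum_restrict [OF rep_locfin [OF free_harm]]) blast
    also have "\<dots> = formal_sum (rep_coeff c) ?B"
      by (rule formal_sum_cong) (rule z)
    finally have "formal_sum (rep_coeff c) (?B \<inter> K_filt p \<inter> K_deg n) = formal_sum (rep_coeff c) ?B" .
    moreover have "P - formal_sum (rep_coeff c) ?B \<in> coboundaries ?L"
      using cocycle_co [OF P(1)] * by (intro coboundaryI formal_sum_polyvecs) (auto simp: co_formal_sum_rep_coeff)
    ultimately show ?thesis
      by (intro exI [of _ "rep_coeff c"]) (simp only:)
  qed
  show "c v = 0" if fs: "formal_sum c ?B \<in> coboundaries ?L" and v: "v \<in> ?B" for c v
  proof -
    let ?c = "\<lambda>t. if t \<in> M.free then c (rep a b t) * sgn_at t else 0"
    obtain Q where "formal_sum c ?B = schouten ?L Q"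
      using fs unfolding coboundaries_def by blast
    then have "M.\<Phi> ?c = diff a b (co Q)"
      unfolding co_formal_sum [OF free_harm, symmetric] co_schouten [symmetric] by (rule arg_cong)
    moreover have "?c \<in> supported_on M.free"
      by (simp add: supported_on_def)
    ultimately have "?c = 0"
      by (intro M.independent_classes [OF _ co_supported])
    obtain t where t: "t \<in> M.free" "v = rep a b t"
      using v by blast
    have "c (rep a b t) * sgn_at t = 0"
      using fun_cong [OF \<open>?c = 0\<close>, of t] t(1) by (simp only: if_True zero_fun_apply)
    then show ?thesis
      unfolding t(2) using sgn_at_nz [of t] by simp
  qed
qed

end

section \<open>Identification with the listed generators\<close>

lemma pd_st:
  "pd 1 (st I) = (if I = B1 then 1 else 0)" "pd 2 (st I) = (if I = B2 then 1 else 0)"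
  "pd 3 (st I) = (if I = B3 then 1 else 0)"
  by (cases I; simp add: pd_def st.simps doubleton_eq_iff)+

lemma Y_st:
  "Y 1 (st I) = (if I = B1 then vx else 0)" "Y 2 (st I) = (if I = B2 then vy else 0)"
  "Y 3 (st I) = (if I = B3 then vz else 0)"
  by (simp_all add: Y_def mul_def pd_st coord_def vx_def vy_def vz_def del: One_nat_def)

lemma unit_pv_st: "unit_pv (st I) = (if I = B0 then 1 else 0)"
  by (cases I) (simp_all add: unit_pv_def st.simps)

lemma Y_polyvecs: "l \<in> {1, 2, 3} \<Longrightarrow> Y l \<in> polyvecs"
  unfolding Y_def by (intro mul_polyvecs pd_polyvecs)

lemma unit_pv_polyvecs: "unit_pv \<in> polyvecs"
proof -
  have "unit_pv I = 0" if "\<not> I \<subseteq> {1, 2, 3}" for I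
    using that unfolding unit_pv_def by (intro if_not_P) blast
  then show ?thesis
    unfolding polyvecs_def by blast
qed

lemmas gen_polyvecs = mul_polyvecs wedge_polyvecs pd_polyvecs Y_polyvecs unit_pv_polyvecs
  subspace_pvD(2,3) [OF polyvecs_subspace] rep_polyvecs

lemmas gen_st = mul_def plus_fun_apply scale_apply unit_pv_st pd_st Y_st

lemma rep_eqI:
  assumes "Q \<in> polyvecs" "rep a b t (st B0) = Q (st B0)" "rep a b t (st B1) = Q (st B1)"
    "rep a b t (st B2) = Q (st B2)" "rep a b t (st B3) = Q (st B3)" "rep a b t (st B12) = Q (st B12)"
    "rep a b t (st B13) = Q (st B13)" "rep a b t (st B23) = Q (st B23)" "rep a b t (st B123) = Q (st B123)"
  shows "rep a b t = Q"
proof (rule polyvec_eqI [OF rep_polyvecs assms(1)])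
  show "rep a b t (st I) = Q (st I)" for I
    by (cases I) (simp_all only: assms)
qed

lemma cas_zero: "cas 0 n m = (vx * vy) ^ n * vz ^ m"
  by (simp add: cas_def cst_simps)

lemma rep_main:
  assumes "0 < i"
  shows "rep a b (B0, i, i, k) = cas (kap a b) (i - 1) (k - 1) \<odot> unit_pv"
    "rep a b (B1, i, i, k) = cas (kap a b) (i - 1) (k - 1) \<odot> (Y 1 + scale (1/2) (Y 3))"
    "rep a b (B2, i, i, k) = cas (kap a b) (i - 1) (k - 1) \<odot> (Y 2 + scale (1/2) (Y 3))"
    "0 < k \<Longrightarrow> rep a b (B23, i, i, k) = cas 0 (i - 1) (k - 1) \<odot> (Y 2 \<^bold>\<and> Y 3 + Y 3 \<^bold>\<and> Y 1)"
    "rep a b (B12, i, i, k) = cas 0 (i - 1) (k - 1) \<odot> (Y 1 \<^bold>\<and> Y 2)"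
    "0 < k \<Longrightarrow> rep a b (B123, i, i, k) = cas 0 (i - 1) (k - 1) \<odot> (Y 1 \<^bold>\<and> Y 2 \<^bold>\<and> Y 3)"
    "rep a b (B23, i, i, 0) = (vx * vy) ^ (i - 1) \<odot> (Y 2 \<^bold>\<and> pd 3 + pd 3 \<^bold>\<and> Y 1)"
    "rep a b (B123, i, i, 0) = (vx * vy) ^ (i - 1) \<odot> (Y 1 \<^bold>\<and> Y 2 \<^bold>\<and> pd 3)"
proof -
  note [simp del] = One_nat_def
  obtain n where i: "i = Suc n"
    using assms gr0_implies_Suc by blast
  have n: "i - 1 = n"
    by (simp add: i)
  have s: "sgn_at (I, i, j, k) = 1" for I j k
    by (simp add: sgn_at_def i)
  have s': "sgn_at (I, Suc m, j, k) = 1" for I m j k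
    by (simp add: sgn_at_def)
  show "rep a b (B0, i, i, k) = cas (kap a b) (i - 1) (k - 1) \<odot> unit_pv"
    by (rule rep_eqI, (intro gen_polyvecs)[1])
      (simp_all add: rep_def s s' elt_eqs gen_st cst_simps)
  show "rep a b (B1, i, i, k) = cas (kap a b) (i - 1) (k - 1) \<odot> (Y 1 + scale (1/2) (Y 3))"
    by (rule rep_eqI, (intro gen_polyvecs; simp)[1])
      (simp_all add: rep_def s s' elt_eqs gen_st cst_simps mult.commute mult.left_commute)
  show "rep a b (B2, i, i, k) = cas (kap a b) (i - 1) (k - 1) \<odot> (Y 2 + scale (1/2) (Y 3))"
    by (rule rep_eqI, (intro gen_polyvecs; simp)[1])
      (simp_all add: rep_def s s' elt_eqs gen_st cst_simps mult.commute mult.left_commute)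
  show "rep a b (B12, i, i, k) = cas 0 (i - 1) (k - 1) \<odot> (Y 1 \<^bold>\<and> Y 2)"
    by (rule rep_eqI, (intro gen_polyvecs; simp)[1])
      (simp_all add: rep_def s s' elt_eqs gen_st wedge_st cst_simps cas_zero mon_def i power_mult_distrib ac_simps)
  show "rep a b (B23, i, i, k) = cas 0 (i - 1) (k - 1) \<odot> (Y 2 \<^bold>\<and> Y 3 + Y 3 \<^bold>\<and> Y 1)" if "0 < k"
    using gr0_implies_Suc [OF that]
    by (elim exE, intro rep_eqI) ((intro gen_polyvecs; simp)[1],
      simp_all add: rep_def s s' elt_eqs(9) [OF assms] gen_st wedge_st cst_simps cas_zero n ac_simps)
  show "rep a b (B123, i, i, k) = cas 0 (i - 1) (k - 1) \<odot> (Y 1 \<^bold>\<and> Y 2 \<^bold>\<and> Y 3)" if "0 < k"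
    using gr0_implies_Suc [OF that]
    by (elim exE, intro rep_eqI) ((intro gen_polyvecs; simp)[1],
      simp_all add: rep_def s s' elt_eqs gen_st wedge_st cst_simps cas_zero mon_def i power_mult_distrib ac_simps)
  show "rep a b (B23, i, i, 0) = (vx * vy) ^ (i - 1) \<odot> (Y 2 \<^bold>\<and> pd 3 + pd 3 \<^bold>\<and> Y 1)"
    by (rule rep_eqI, (intro gen_polyvecs; simp)[1])
      (simp_all add: rep_def s s' elt_eqs(9) [OF assms] gen_st wedge_st cst_simps cas_zero n ac_simps)
  show "rep a b (B123, i, i, 0) = (vx * vy) ^ (i - 1) \<odot> (Y 1 \<^bold>\<and> Y 2 \<^bold>\<and> pd 3)"
    by (rule rep_eqI, (intro gen_polyvecs; simp)[1])
      (simp_all add: rep_def s s' elt_eqs gen_st wedge_st cst_simps mon_def i power_mult_distrib ac_simps)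
qed

lemma rep_boundary:
  "rep a b (B12, 0, 0, k) = vz ^ (k - 1) \<odot> (pd 1 \<^bold>\<and> pd 2)"
  "rep a b (B123, 0, 0, k) = vz ^ k \<odot> (pd 1 \<^bold>\<and> pd 2 \<^bold>\<and> pd 3)"
  "rep a b (B23, i, 0, 0) = vx ^ (i - 1) \<odot> (pd 2 \<^bold>\<and> pd 3)"
  "rep a b (B13, 0, j, 0) = vy ^ (j - 1) \<odot> (pd 3 \<^bold>\<and> pd 1)"
  "rep a b (B123, i, 0, 0) = vx ^ i \<odot> (pd 1 \<^bold>\<and> pd 2 \<^bold>\<and> pd 3)"
  "rep a b (B123, 0, j, 0) = vy ^ j \<odot> (pd 1 \<^bold>\<and> pd 2 \<^bold>\<and> pd 3)"
proof -
  note [simp del] = One_nat_def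
  show "rep a b (B12, 0, 0, k) = vz ^ (k - 1) \<odot> (pd 1 \<^bold>\<and> pd 2)"
    by (rule rep_eqI, (intro gen_polyvecs; simp)[1])
      (simp_all add: rep_def sgn_at_def elt_eqs gen_st wedge_st cst_simps mon_def)
  show "rep a b (B123, 0, 0, k) = vz ^ k \<odot> (pd 1 \<^bold>\<and> pd 2 \<^bold>\<and> pd 3)"
    by (rule rep_eqI, (intro gen_polyvecs; simp)[1])
      (simp_all add: rep_def sgn_at_def elt_eqs gen_st wedge_st cst_simps mon_def)
  show "rep a b (B23, i, 0, 0) = vx ^ (i - 1) \<odot> (pd 2 \<^bold>\<and> pd 3)"
    by (rule rep_eqI, (intro gen_polyvecs; simp)[1])
      (simp_all add: rep_def sgn_at_def elt_eqs gen_st wedge_st cst_simps mon_def)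
  show "rep a b (B13, 0, j, 0) = vy ^ (j - 1) \<odot> (pd 3 \<^bold>\<and> pd 1)"
    by (rule rep_eqI, (intro gen_polyvecs; simp)[1])
      (simp_all add: rep_def sgn_at_def elt_eqs gen_st wedge_st cst_simps mon_def)
  show "rep a b (B123, i, 0, 0) = vx ^ i \<odot> (pd 1 \<^bold>\<and> pd 2 \<^bold>\<and> pd 3)"
    by (rule rep_eqI, (intro gen_polyvecs; simp)[1])
      (simp_all add: rep_def sgn_at_def elt_eqs gen_st wedge_st cst_simps mon_def)
  show "rep a b (B123, 0, j, 0) = vy ^ j \<odot> (pd 1 \<^bold>\<and> pd 2 \<^bold>\<and> pd 3)"
    by (rule rep_eqI, (intro gen_polyvecs; simp)[1])
      (simp_all add: rep_def sgn_at_def elt_eqs gen_st wedge_st cst_simps mon_def)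
qed

text \<open>
  \<open>(i, k) \<in> mains a b\<close> encodes the Casimir \<open>D'\<^bsup>i-1\<^esup> z\<^bsup>k-1\<^esup>\<close> of the leading part of \<open>Lambda4\<close>, and
  \<open>k = 0\<close> the exceptional function \<open>D'\<^sup>\<alpha> z\<^sup>-\<^sup>1\<close>.
\<close>

definition mains :: "real \<Rightarrow> real \<Rightarrow> (nat \<times> nat) set" where
  "mains a b = {(i, k). 0 < i \<and> b * (real i - 1) = a * (real k - 1)}"

text \<open>These are exponents of numerators. For \<open>\<partial>\<^sub>1\<^sub>2\<^sub>3\<close>
  they are exponents of the coefficient as well; for \<open>\<partial>\<^sub>1\<^sub>2\<close> the
  numerator carries an extra z, hence \<open>Suc m\<close> below.\<close>

definition killed :: "real \<Rightarrow> real \<Rightarrow> nat set" where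
  "killed a b = {k + 2 * i | i k. (i, k) \<in> mains a b}"

definition main_cas :: "real \<Rightarrow> real \<Rightarrow> real \<Rightarrow> series set" where
  "main_cas \<kappa> a b = {cas \<kappa> (i - 1) (k - 1) | i k. (i, k) \<in> mains a b \<and> 0 < k}"

definition edge_part :: "real \<Rightarrow> real \<Rightarrow> polyvec set" where
  "edge_part a b = (\<Union>(i, k)\<in>{(i, k). (i, k) \<in> mains a b \<and> k = 0}.
     {(vx * vy) ^ (i - 1) \<odot> (Y 2 \<^bold>\<and> pd 3 + pd 3 \<^bold>\<and> Y 1), (vx * vy) ^ (i - 1) \<odot> (Y 1 \<^bold>\<and> Y 2 \<^bold>\<and> pd 3)})"

lemma multiples_iff: "P \<in> multiples F Q \<longleftrightarrow> (\<exists>f\<in>F. P = f \<odot> Q)"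
  by (auto simp: multiples_def)

context
  fixes a b :: real
  assumes a: "a \<noteq> 0" and b: "b \<noteq> 0"
begin

lemma free_iff:
  "(I, i, j, k) \<in> harm a b - killers a b - kill ` killers a b \<longleftrightarrow>
     (I, i, j, k) \<in> allowed \<and>
     ((i = j \<and> (i, k) \<in> mains a b \<and> I \<noteq> B3 \<and> I \<noteq> B13) \<or>
      (i = 0 \<and> j = 0 \<and> k \<notin> killed a b) \<or>
      (a = b \<and> k = 0 \<and> (i = 0 \<or> j = 0)))"
proof -
  have kill: "(I, i, j, k) \<in> kill ` killers a b \<longleftrightarrow> (I = B12 \<or> I = B123) \<and> i = 0 \<and> j = 0 \<and> k \<in> killed a b"
  proof
    assume "(I, i, j, k) \<in> kill ` killers a b"
    then obtain I' i' j' k' where "(I', i', j', k') \<in> killers a b" "(I, i, j, k) = kill (I', i', j', k')"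
      by auto
    moreover from this have "(i', k') \<in> mains a b"
      by (auto simp: killers_def harm_cases [OF a b] mains_def allowed_def)
    ultimately show "(I = B12 \<or> I = B123) \<and> i = 0 \<and> j = 0 \<and> k \<in> killed a b"
      unfolding killed_def by (auto simp: kill_def split: if_splits)
  next
    assume h: "(I = B12 \<or> I = B123) \<and> i = 0 \<and> j = 0 \<and> k \<in> killed a b"
    then obtain i' k' where m: "(i', k') \<in> mains a b" "k = k' + 2 * i'"
      by (auto simp: killed_def)
    let ?J = "if I = B12 then B3 else B13"
    have "(?J, i', i', k') \<in> killers a b"
      using m by (auto simp: killers_def harm_cases [OF a b] mains_def allowed_def)
    moreover have "(I, i, j, k) = kill (?J, i', i', k')"
      using h m by (auto simp: kill_def)
    ultimately show "(I, i, j, k) \<in> kill ` killers a b"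
      by (rule image_eqI [rotated])
  qed
  \<comment> \<open>So the constant multiple of \<open>\<partial>\<^sub>1\<^sub>2\<^sub>3\<close>,
    which for a = b is shared by the singular family and both power series families, is never
    removed.\<close>
  have zero: "0 \<notin> killed a' b'" for a' b'
    by (auto simp: killed_def mains_def)
  show ?thesis
    unfolding Diff_iff kill
    by (cases I) (auto simp: killers_def harm_cases [OF a b] mains_def allowed_def zero)
qed

lemma rep_free_subset:
  "rep a b ` (harm a b - killers a b - kill ` killers a b) \<subseteq>
     casimir_part (main_cas (kap a b) a b) (main_cas 0 a b) \<union> edge_part a b \<union>
     singular_part {m. Suc m \<in> killed a b} (killed a b) \<union> (if b = a then equal_part else {})"
    (is "_ \<subseteq> ?C \<union> ?E \<union> ?S \<union> ?Q")
proof
  fix v assume "v \<in> rep a b ` (harm a b - killers a b - kill ` killers a b)"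
  then obtain I i j k where "v = rep a b (I, i, j, k)"
    and "(I, i, j, k) \<in> harm a b - killers a b - kill ` killers a b"
    by auto
  then have v: "v = rep a b (I, i, j, k)" and al: "o1 I \<le> i" "o2 I \<le> j" "o3 I \<le> k"
    and cs: "(i = j \<and> (i, k) \<in> mains a b \<and> I \<noteq> B3 \<and> I \<noteq> B13) \<or>
      (i = 0 \<and> j = 0 \<and> k \<notin> killed a b) \<or> (a = b \<and> k = 0 \<and> (i = 0 \<or> j = 0))"
    unfolding free_iff by (simp_all add: allowed_def)
  from cs consider "i = j" "(i, k) \<in> mains a b" "I \<noteq> B3" "I \<noteq> B13" | "i = 0" "j = 0" "k \<notin> killed a b"
    | "a = b" "k = 0" "i = 0 \<or> j = 0"
    by blast
  then show "v \<in> ?C \<union> ?E \<union> ?S \<union> ?Q"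
  proof cases
    case 1
    then have i: "0 < i"
      by (simp add: mains_def)
    have main: "v \<in> ?C" if k: "0 < k"
    proof -
      have f: "cas \<kappa> (i - 1) (k - 1) \<in> main_cas \<kappa> a b" for \<kappa>
        using 1 k unfolding main_cas_def by blast
      show ?thesis
        unfolding v 1(1) [symmetric] casimir_part_def Un_iff multiples_iff
        using 1(3,4) f i k by (cases I) (simp_all only: rep_main simp_thms, blast+)
    qed
    show ?thesis
    proof (cases "k = 0")
      case True
      then have "I = B23 \<or> I = B123"
        using al 1 by (cases I) auto
      then have "v \<in> ?E"
        unfolding edge_part_def v 1(1) [symmetric] True
        using 1(2) True by (auto simp: rep_main [OF i])
      then show ?thesis
        by blast
    qed (use main in blast)
  next
    case 2
    then have "I = B123 \<or> I = B12 \<and> 0 < k"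
      using al by (cases I) auto
    then have "v \<in> ?S"
    proof
      assume "I = B123"
      then show ?thesis
        unfolding v 2(1,2) singular_part_def Un_iff multiples_iff vz_def [symmetric]
        using 2(3) by (auto simp: rep_boundary)
    next
      assume I: "I = B12 \<and> 0 < k"
      then have "k - 1 \<notin> {m. Suc m \<in> killed a b}"
        using 2(3) by simp
      with I show ?thesis
        unfolding v 2(1,2) singular_part_def Un_iff multiples_iff vz_def [symmetric]
        by (intro disjI1 bexI [of _ "vz ^ (k - 1)"]) (simp_all only: rep_boundary, blast)
    qed
    then show ?thesis
      by blast
  next
    case 3
    have "v \<in> equal_part"
      using 3(3)
    proof
      assume "i = 0"
      then have "I = B13 \<or> I = B123"
        using al 3 by (cases I) auto
      then show ?thesis
        unfolding v 3(2) \<open>i = 0\<close> equal_part_def Un_iff multiples_iff vy_def [symmetric]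
        by (elim disjE) (auto simp: rep_boundary simp del: One_nat_def)
    next
      assume "j = 0"
      then have "I = B23 \<or> I = B123"
        using al 3 by (cases I) auto
      then show ?thesis
        unfolding v 3(2) \<open>j = 0\<close> equal_part_def Un_iff multiples_iff vx_def [symmetric]
        by (elim disjE) (auto simp: rep_boundary simp del: One_nat_def)
    qed
    then show ?thesis
      using 3(1) by simp
  qed
qed

lemma rep_mem:
  assumes "(I, i, j, k) \<in> allowed" "(i = j \<and> (i, k) \<in> mains a b \<and> I \<noteq> B3 \<and> I \<noteq> B13) \<or>
      (i = 0 \<and> j = 0 \<and> k \<notin> killed a b) \<or> (a = b \<and> k = 0 \<and> (i = 0 \<or> j = 0))"
  shows "rep a b (I, i, j, k) \<in> rep a b ` (harm a b - killers a b - kill ` killers a b)"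
  using assms free_iff by (intro imageI) blast

lemma rep_free_supset:
  "casimir_part (main_cas (kap a b) a b) (main_cas 0 a b) \<union> edge_part a b \<union>
     singular_part {m. Suc m \<in> killed a b} (killed a b) \<union> (if b = a then equal_part else {}) \<subseteq>
   rep a b ` (harm a b - killers a b - kill ` killers a b)" (is "?C \<union> ?E \<union> ?S \<union> ?Q \<subseteq> ?R")
proof (intro Un_least)
  have mult: "multiples (main_cas \<kappa> a b) P \<subseteq> ?R"
    if "I \<noteq> B3" "I \<noteq> B13" "\<And>i k. 0 < i \<Longrightarrow> 0 < k \<Longrightarrow> rep a b (I, i, i, k) = cas \<kappa> (i - 1) (k - 1) \<odot> P" for I \<kappa> P
  proof
    fix v assume "v \<in> multiples (main_cas \<kappa> a b) P"
    then obtain i k where ik: "(i, k) \<in> mains a b" "0 < k" "v = cas \<kappa> (i - 1) (k - 1) \<odot> P"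
      unfolding multiples_iff main_cas_def by blast
    then have i: "0 < i"
      by (simp add: mains_def)
    have "(I, i, i, k) \<in> allowed"
      using i ik(2) by (cases I) (auto simp: allowed_def)
    then show "v \<in> ?R"
      unfolding ik(3) that(3) [OF i ik(2), symmetric] using that(1,2) ik(1) by (intro rep_mem) simp_all
  qed
  show "?C \<subseteq> ?R"
    unfolding casimir_part_def
  proof (intro Un_least)
    show "multiples (main_cas (kap a b) a b) unit_pv \<subseteq> ?R"
      by (rule mult [of B0]) (simp_all only: rep_main bas.distinct simp_thms)
    show "multiples (main_cas (kap a b) a b) (Y 1 + scale (1/2) (Y 3)) \<subseteq> ?R"
      by (rule mult [of B1]) (simp_all only: rep_main bas.distinct simp_thms)
    show "multiples (main_cas (kap a b) a b) (Y 2 + scale (1/2) (Y 3)) \<subseteq> ?R"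
      by (rule mult [of B2]) (simp_all only: rep_main bas.distinct simp_thms)
    show "multiples (main_cas 0 a b) (Y 2 \<^bold>\<and> Y 3 + Y 3 \<^bold>\<and> Y 1) \<subseteq> ?R"
      by (rule mult [of B23]) (simp_all only: rep_main bas.distinct simp_thms)
    show "multiples (main_cas 0 a b) (Y 1 \<^bold>\<and> Y 2) \<subseteq> ?R"
      by (rule mult [of B12]) (simp_all only: rep_main bas.distinct simp_thms)
    show "multiples (main_cas 0 a b) (Y 1 \<^bold>\<and> Y 2 \<^bold>\<and> Y 3) \<subseteq> ?R"
      by (rule mult [of B123]) (simp_all only: rep_main bas.distinct simp_thms)
  qed
  show "?E \<subseteq> ?R"
  proof
    fix v assume "v \<in> ?E"
    then obtain i where i: "(i, 0) \<in> mains a b" and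
      "v = (vx * vy) ^ (i - 1) \<odot> (Y 2 \<^bold>\<and> pd 3 + pd 3 \<^bold>\<and> Y 1) \<or> v = (vx * vy) ^ (i - 1) \<odot> (Y 1 \<^bold>\<and> Y 2 \<^bold>\<and> pd 3)"
      unfolding edge_part_def by blast
    moreover have "0 < i"
      using i by (simp add: mains_def)
    ultimately have "v = rep a b (B23, i, i, 0) \<or> v = rep a b (B123, i, i, 0)"
      by (simp only: rep_main)
    moreover have "(B23, i, i, 0) \<in> allowed" "(B123, i, i, 0) \<in> allowed"
      using \<open>0 < i\<close> by (auto simp: allowed_def)
    ultimately show "v \<in> ?R"
      using i by (elim disjE) (simp_all only:, (intro rep_mem; simp)+)
  qed
  show "?S \<subseteq> ?R"
  proof
    fix v assume "v \<in> ?S"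
    then consider k where "Suc k \<notin> killed a b" "v = vz ^ k \<odot> (pd 1 \<^bold>\<and> pd 2)"
      | k where "k \<notin> killed a b" "v = vz ^ k \<odot> (pd 1 \<^bold>\<and> pd 2 \<^bold>\<and> pd 3)"
      unfolding singular_part_def Un_iff multiples_iff vz_def [symmetric] by blast
    then show "v \<in> ?R"
    proof cases
      case 1
      have "v = rep a b (B12, 0, 0, Suc k)"
        unfolding 1 rep_boundary diff_Suc_1 ..
      with 1(1) show ?thesis
        by (simp only:) (intro rep_mem; simp add: allowed_def)
    next
      case 2
      have "v = rep a b (B123, 0, 0, k)"
        unfolding 2 rep_boundary ..
      with 2(1) show ?thesis
        by (simp only:) (intro rep_mem; simp add: allowed_def)
    qed
  qed
  show "?Q \<subseteq> ?R"
  proof (cases "b = a")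
    case True
    have "v \<in> ?R" if "v \<in> equal_part" for v
    proof -
      from that consider k where "v = vx ^ k \<odot> (pd 2 \<^bold>\<and> pd 3)" | k where "v = vy ^ k \<odot> (pd 3 \<^bold>\<and> pd 1)"
        | k where "v = vx ^ k \<odot> (pd 1 \<^bold>\<and> pd 2 \<^bold>\<and> pd 3)" | k where "v = vy ^ k \<odot> (pd 1 \<^bold>\<and> pd 2 \<^bold>\<and> pd 3)"
        unfolding equal_part_def Un_iff multiples_iff vx_def [symmetric] vy_def [symmetric] by blast
      then show ?thesis
      proof cases
        case 1
        have "v = rep a b (B23, Suc k, 0, 0)"
          unfolding 1 rep_boundary diff_Suc_1 ..
        then show ?thesis
          by (simp only:) (intro rep_mem; simp add: allowed_def True)
      next
        case 2
        have "v = rep a b (B13, 0, Suc k, 0)"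
          unfolding 2 rep_boundary diff_Suc_1 ..
        then show ?thesis
          by (simp only:) (intro rep_mem; simp add: allowed_def True)
      next
        case 3
        have "v = rep a b (B123, k, 0, 0)"
          unfolding 3 by (rule rep_boundary(5) [symmetric])
        then show ?thesis
          by (simp only:) (intro rep_mem; simp add: allowed_def True)
      next
        case 4
        have "v = rep a b (B123, 0, k, 0)"
          unfolding 4 by (rule rep_boundary(6) [symmetric])
        then show ?thesis
          by (simp only:) (intro rep_mem; simp add: allowed_def True)
      qed
    qed
    then show ?thesis
      unfolding if_P [OF True] by (rule subsetI)
  qed (simp only: if_False empty_subsetI)
qed

lemmas rep_free = subset_antisym [OF rep_free_subset rep_free_supset]

end

section \<open>The exponents of the leading Casimirs in the three cases\<close>

lemma cas_power: "cas \<kappa> n m = (xx * yy + cst \<kappa> * zz ^ 2) ^ n * zz ^ m"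
  by (simp only: cas_def vx_def vy_def vz_def)

text \<open>The equation reads \<beta> i' = \<alpha> k' for i' = i - 1 and k' = k - 1. The left side
  is nonnegative, which excludes k = 0, and coprimality makes \<alpha> divide i'.\<close>

lemma mains_positive:
  assumes "a \<noteq> 0" "0 < \<alpha>" "0 < \<beta>" "coprime \<alpha> \<beta>" "b / a = real \<beta> / real \<alpha>"
  shows "mains a b = range (\<lambda>m. (\<alpha> * m + 1, \<beta> * m + 1))"
proof -
  have ba: "b = a * (real \<beta> / real \<alpha>)"
    using assms(1,5) by (simp add: field_simps)
  have iff: "b * (real i - 1) = a * (real k - 1) \<longleftrightarrow> real \<beta> * (real i - 1) = real \<alpha> * (real k - 1)" for i k
  proof -
    have "b * (real i - 1) = a * (real k - 1) \<longleftrightarrow> a * (real \<beta> / real \<alpha> * (real i - 1)) = a * (real k - 1)"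
      unfolding ba by (simp only: mult.assoc)
    also have "\<dots> \<longleftrightarrow> real \<beta> / real \<alpha> * (real i - 1) = real k - 1"
      by (rule mult_left_cancel [OF assms(1)])
    also have "\<dots> \<longleftrightarrow> real \<beta> * (real i - 1) = real \<alpha> * (real k - 1)"
      using assms(2) by (simp add: field_simps)
    finally show ?thesis .
  qed
  have "\<exists>m. i = \<alpha> * m + 1 \<and> k = \<beta> * m + 1" if pos: "0 < i" and "real \<beta> * (real i - 1) = real \<alpha> * (real k - 1)" for i k
  proof -
    have "0 \<le> real \<beta> * (real i - 1)"
      using that(1) by (intro mult_nonneg_nonneg) simp_all
    then have "0 \<le> real \<alpha> * (real k - 1)"
      unfolding that(2) .
    then have "0 < k"
      using assms(2) by (cases k) (simp_all add: zero_le_mult_iff)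
    then obtain k' where k': "k = Suc k'"
      by (cases k) simp_all
    obtain i' where i': "i = Suc i'"
      using pos by (cases i) simp_all
    note ik = i' k'
    then have "real (\<beta> * i') = real (\<alpha> * k')"
      using that(2) by simp
    then have eq: "\<beta> * i' = \<alpha> * k'"
      by (rule of_nat_eq_iff [THEN iffD1])
    then have "\<alpha> dvd \<beta> * i'"
      by simp
    then have "\<alpha> dvd i'"
      using assms(4) by (simp only: coprime_dvd_mult_right_iff)
    then obtain m where m: "i' = \<alpha> * m"
      by blast
    then have "k' = \<beta> * m"
      using eq assms(2) by simp
    then show ?thesis
      using ik m by auto
  qed
  then have "(i, k) \<in> mains a b \<longleftrightarrow> (\<exists>m. i = \<alpha> * m + 1 \<and> k = \<beta> * m + 1)" for i k
    unfolding mains_def iff by auto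
  then show ?thesis
    by (intro set_eqI) (simp only: split_paired_all image_iff prod.inject UNIV_I bex_simps Bex_def simp_thms)
qed

text \<open>For n = i - 1 > 0 the equation is b / a = (k - 1) / n. A value k > 1 would make the
  ratio a positive rational and k = 1 would make it zero, so only k = 0 is left.\<close>

lemma mains_other:
  assumes a: "a \<noteq> 0" and b: "b \<noteq> 0" and neg: "\<not> (b / a \<in> \<rat> \<and> 0 < b / a)"
  shows "mains a b = insert (1, 1) {(Suc \<alpha>, 0) | \<alpha>. 0 < \<alpha> \<and> b / a = - 1 / real \<alpha>}"
proof -
  have "(i, k) \<in> mains a b \<longleftrightarrow> (i, k) \<in> insert (1, 1) {(Suc \<alpha>, 0) | \<alpha>. 0 < \<alpha> \<and> b / a = - 1 / real \<alpha>}" for i k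
  proof (cases "i \<le> 1")
    case True
    then have "i = 0 \<or> i = 1"
      by auto
    then show ?thesis
      using a by (auto simp: mains_def)
  next
    case False
    then obtain n where n: "i = Suc n" "0 < n"
      by (cases i) auto
    have main: "(i, k) \<in> mains a b \<longleftrightarrow> b / a = (real k - 1) / real n"
      using a n by (simp add: mains_def field_simps)
    have big: "b / a \<noteq> (real k - 1) / real n" if "0 < k" "k \<noteq> 1"
    proof
      assume eq: "b / a = (real k - 1) / real n"
      then have "b / a \<in> \<rat>"
        by simp
      moreover have "0 < b / a"
        unfolding eq using that n by simp
      ultimately show False
        using neg by simp
    qed
    show ?thesis
    proof (cases "k = 0")
      case True
      then show ?thesis
        using main n by (simp add: True)
    next
      case False
      then have "(i, k) \<notin> mains a b"
        unfolding main using big a b by (cases "k = 1") simp_all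
      moreover have "(i, k) \<notin> insert (1, 1) {(Suc \<alpha>, 0) | \<alpha>. 0 < \<alpha> \<and> b / a = - 1 / real \<alpha>}"
        using False n by simp
      ultimately show ?thesis
        by (simp only:)
    qed
  qed
  then show ?thesis
    by (intro set_eqI) (simp only: split_paired_all)
qed

lemma main_cas_image: "main_cas \<kappa> a b = (\<lambda>(i, k). cas \<kappa> (i - 1) (k - 1)) ` {(i, k). (i, k) \<in> mains a b \<and> 0 < k}"
  unfolding main_cas_def by (auto simp del: One_nat_def)

lemma killed_image: "killed a b = (\<lambda>(i, k). k + 2 * i) ` mains a b"
  unfolding killed_def by auto

lemma cas_0_0: "cas \<kappa> 0 0 = 1"
  by (simp add: cas_def)

lemma reps_positive_eq:
  assumes "a \<noteq> 0" "b \<noteq> 0" "0 < \<alpha>" "0 < \<beta>" "coprime \<alpha> \<beta>" "b / a = real \<beta> / real \<alpha>"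
  shows "rep a b ` (harm a b - killers a b - kill ` killers a b) = reps_positive a b \<alpha> \<beta>"
proof -
  note m = mains_positive [OF assms(1,3,4,5,6)]
  have cas: "main_cas \<kappa> a b = range (\<lambda>i. cas \<kappa> (\<alpha> * i) (\<beta> * i))" for \<kappa>
  proof -
    have "{(i, k). (i, k) \<in> mains a b \<and> 0 < k} = range (\<lambda>m. (\<alpha> * m + 1, \<beta> * m + 1))"
      unfolding m by auto
    then show ?thesis
      unfolding main_cas_image by (simp only: image_image prod.case add_diff_cancel_right')
  qed
  have C: "main_cas (kap a b) a b = Cas4 a b \<alpha> \<beta>"
    unfolding cas Cas4_def cas_power kap_def ..
  have C': "main_cas 0 a b = Cas4I \<alpha> \<beta>"
    unfolding cas Cas4I_def cas_zero vx_def vy_def vz_def ..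
  have "{(i, k). (i, k) \<in> mains a b \<and> k = 0} = {}"
    unfolding m by auto
  then have E: "edge_part a b = {}"
    unfolding edge_part_def by (simp only: UN_empty)
  have N3: "killed a b = {m * (2 * \<alpha> + \<beta>) + 3 | m. True}"
  proof -
    \<comment> \<open>The exponent k + 2i at (\<alpha> m + 1, \<beta> m + 1): the period is 2
      \<alpha> + \<beta>, and the offset 3 is 1 + 2, the value for the trivial Casimir.\<close>
    have "\<beta> * i + 1 + 2 * (\<alpha> * i + 1) = i * (2 * \<alpha> + \<beta>) + 3" for i
      by (simp add: algebra_simps)
    then show ?thesis
      unfolding killed_image m image_image prod.case by (simp only: full_SetCompr_eq simp_thms)
  qed
  have N2: "{m. Suc m \<in> killed a b} = {m * (2 * \<alpha> + \<beta>) + 2 | m. True}"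
  proof -
    have "Suc n = q + 3 \<longleftrightarrow> n = q + 2" for n q :: nat
      by arith
    then show ?thesis
      unfolding N3 by (simp only: mem_Collect_eq)
  qed
  show ?thesis
    unfolding rep_free [OF assms(1,2)] reps_positive_def C C' E N2 unfolding N3 Un_empty_right ..
qed

lemma reps_exceptional_eq:
  assumes "a \<noteq> 0" "b \<noteq> 0" "0 < \<alpha>" "b / a = - 1 / real \<alpha>"
  shows "rep a b ` (harm a b - killers a b - kill ` killers a b) = reps_exceptional \<alpha>"
proof -
  have neg: "\<not> 0 < b / a"
    using assms(3,4) by simp
  have "- 1 / real \<alpha>' = - 1 / real \<alpha> \<longleftrightarrow> \<alpha>' = \<alpha>" if "0 < \<alpha>'" for \<alpha>'
    using that assms(3) by simp
  then have e: "{(Suc \<alpha>', 0 :: nat) | \<alpha>'. 0 < \<alpha>' \<and> b / a = - 1 / real \<alpha>'} = {(Suc \<alpha>, 0)}"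
    unfolding assms(4) using assms(3) by auto
  have n: "\<not> (b / a \<in> \<rat> \<and> 0 < b / a)"
    using neg by blast
  have m: "mains a b = {(1, 1), (Suc \<alpha>, 0)}"
    unfolding mains_other [OF assms(1,2) n] e ..
  have C: "main_cas \<kappa> a b = {1}" for \<kappa>
  proof -
    have "{(i, k). (i, k) \<in> mains a b \<and> 0 < k} = {(1, 1)}"
      unfolding m by auto
    then show ?thesis
      unfolding main_cas_image by (simp only: image_insert image_empty prod.case diff_self_eq_0 cas_0_0)
  qed
  have "{(i, k). (i, k) \<in> mains a b \<and> k = 0} = {(Suc \<alpha>, 0)}"
    unfolding m by auto
  then have E: "edge_part a b = exceptional_part \<alpha>"
    unfolding edge_part_def exceptional_part_def vx_def [symmetric] vy_def [symmetric]
    by (simp only: UN_insert UN_empty prod.case diff_Suc_1 Un_empty_right)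
  \<comment> \<open>The value 3 belongs to the trivial Casimir and 2 \<alpha> + 2 to D'^\<alpha>
    z^(-1).\<close>
  have N3: "killed a b = {3, 2 * \<alpha> + 2}"
    unfolding killed_image m by auto
  have N2: "{m. Suc m \<in> killed a b} = {2, 2 * \<alpha> + 1}"
    unfolding N3 by auto
  have "b \<noteq> a"
    using neg assms(1) by auto
  then show ?thesis
    unfolding rep_free [OF assms(1,2)] reps_exceptional_def C E N2 unfolding N3 by (simp only: if_False Un_empty_right)
qed

lemma reps_generic_eq:
  assumes "a \<noteq> 0" "b \<noteq> 0" "\<not> (b / a \<in> \<rat> \<and> 0 < b / a)" "\<nexists>\<alpha>::nat. 0 < \<alpha> \<and> b / a = - 1 / real \<alpha>"
  shows "rep a b ` (harm a b - killers a b - kill ` killers a b) = reps_generic"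
proof -
  have m: "mains a b = {(1, 1)}"
  proof -
    have e: "{(Suc \<alpha>, 0 :: nat) | \<alpha>. 0 < \<alpha> \<and> b / a = - 1 / real \<alpha>} = {}"
      using assms(4) by blast
    show ?thesis
      unfolding mains_other [OF assms(1,2,3)] e ..
  qed
  have C: "main_cas \<kappa> a b = {1}" for \<kappa>
  proof -
    have "{(i, k). (i, k) \<in> mains a b \<and> 0 < k} = {(1, 1)}"
      unfolding m by auto
    then show ?thesis
      unfolding main_cas_image by (simp only: image_insert image_empty prod.case diff_self_eq_0 cas_0_0)
  qed
  have "{(i, k). (i, k) \<in> mains a b \<and> k = 0} = {}"
    unfolding m by auto
  then have E: "edge_part a b = {}"
    unfolding edge_part_def by (simp only: UN_empty)
  have N3: "killed a b = {3}"
    unfolding killed_image m by auto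
  have N2: "{m. Suc m \<in> killed a b} = {2}"
    unfolding N3 by auto
  have "b \<noteq> a"
    using assms(1,3) by auto
  then show ?thesis
    unfolding rep_free [OF assms(1,2)] reps_generic_def C E N2 unfolding N3 by (simp only: if_False Un_empty_right)
qed

lemma rep_family:
  assumes "a \<noteq> 0" "b \<noteq> 0" "rep a b ` (harm a b - killers a b - kill ` killers a b) = B"
  shows "system_of_representatives (Lambda4 a b) B" "limit_isomorphic (Lambda4 a b) B"
proof -
  interpret adapted_family "Lambda4 a b" B
    using lambda4_family [OF assms(1,2)] unfolding assms(3) .
  show "system_of_representatives (Lambda4 a b) B" "limit_isomorphic (Lambda4 a b) B"
    by (rule system_of_representatives, rule limit_isomorphic)
qed

theorem theorem2:
  fixes a b :: real
  assumes "a \<noteq> 0" and "b \<noteq> 0"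
  shows
    "(\<forall>\<alpha> \<beta> :: nat. 0 < \<alpha> \<and> 0 < \<beta> \<and> coprime \<alpha> \<beta> \<and> b / a = real \<beta> / real \<alpha> \<longrightarrow>
        system_of_representatives (Lambda4 a b) (reps_positive a b \<alpha> \<beta>) \<and>
        limit_isomorphic (Lambda4 a b) (reps_positive a b \<alpha> \<beta>))
     \<and>
     (\<not> (b / a \<in> \<rat> \<and> 0 < b / a) \<longrightarrow>
        (\<forall>\<alpha> :: nat. 0 < \<alpha> \<and> b / a = - 1 / real \<alpha> \<longrightarrow>
           system_of_representatives (Lambda4 a b) (reps_exceptional \<alpha>) \<and>
           limit_isomorphic (Lambda4 a b) (reps_exceptional \<alpha>)) \<and>
        ((\<nexists>\<alpha> :: nat. 0 < \<alpha> \<and> b / a = - 1 / real \<alpha>) \<longrightarrow>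
           system_of_representatives (Lambda4 a b) reps_generic \<and>
           limit_isomorphic (Lambda4 a b) reps_generic))"
proof (intro conjI allI impI)
  fix \<alpha> \<beta> :: nat
  assume h: "0 < \<alpha> \<and> 0 < \<beta> \<and> coprime \<alpha> \<beta> \<and> b / a = real \<beta> / real \<alpha>"
  have "rep a b ` (harm a b - killers a b - kill ` killers a b) = reps_positive a b \<alpha> \<beta>"
    by (rule reps_positive_eq [OF assms]) (use h in simp_all)
  note * = rep_family [OF assms this]
  show "system_of_representatives (Lambda4 a b) (reps_positive a b \<alpha> \<beta>)"
    by (rule *)
  show "limit_isomorphic (Lambda4 a b) (reps_positive a b \<alpha> \<beta>)"
    by (rule *)
next
  fix \<alpha> :: nat
  assume h: "0 < \<alpha> \<and> b / a = - 1 / real \<alpha>"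
  have "rep a b ` (harm a b - killers a b - kill ` killers a b) = reps_exceptional \<alpha>"
    by (rule reps_exceptional_eq [OF assms]) (use h in simp_all)
  note * = rep_family [OF assms this]
  show "system_of_representatives (Lambda4 a b) (reps_exceptional \<alpha>)"
    by (rule *)
  show "limit_isomorphic (Lambda4 a b) (reps_exceptional \<alpha>)"
    by (rule *)
next
  assume h: "\<not> (b / a \<in> \<rat> \<and> 0 < b / a)" "\<nexists>\<alpha>::nat. 0 < \<alpha> \<and> b / a = - 1 / real \<alpha>"
  note * = rep_family [OF assms reps_generic_eq [OF assms h]]
  show "system_of_representatives (Lambda4 a b) reps_generic"
    by (rule *)
  show "limit_isomorphic (Lambda4 a b) reps_generic"
    by (rule *)
qed

end
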